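(* Let $(P,\omega)$ be a symplectic manifold and let $F:P\to\mathbf{R}$ be a smooth function such that the critical points of $F$ are contained in a codimension-$1$ submanifold of $P$. Then there exists a residual subset $\mathcal{C}$ of $\mathcal{C}^\infty(P,\mathbf{R})$ such that, for any $H\in\mathcal{C}$, the only solutions to the Hamiltonian vector field $X_H$ along which $F$ is constant are equilibria, and these are isolated.
   Context: All manifolds are $C^\infty$, paracompact, second countable, finite-dimensional and without boundary; smooth means $C^\infty$. $\mathcal{C}^\infty(P,\mathbf{R})$ carries the strong (Whitney) $C^\infty$ topology. A subset is residual if it contains the intersection of a countable number of open dense subsets. For $H\in\mathcal{C}^\infty(P,\mathbf{R})$, the Hamiltonian vector field $X_H$ is defined by $i_{X_H}\omega=dH$. A solution of a vector field is an integral curve; an equilibrium is a constant solution. *)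

theory Defs
  imports "HOL-Analysis.Analysis"
begin

section \<open>Smooth maps between Euclidean spaces\<close>

text \<open>Only meaningful for open sets: the derivatives are taken in the full space.\<close>

fun Ck_on :: "'a::euclidean_space set \<Rightarrow> nat \<Rightarrow> ('a \<Rightarrow> 'b::real_normed_vector) \<Rightarrow> bool" where
  "Ck_on S 0 f \<longleftrightarrow> continuous_on S f"
| "Ck_on S (Suc k) f \<longleftrightarrow>
     (\<forall>x\<in>S. f differentiable (at x)) \<and>
     (\<forall>v. Ck_on S k (\<lambda>x. frechet_derivative f (at x) v))"

definition smooth_map_on :: "'a::euclidean_space set \<Rightarrow> ('a \<Rightarrow> 'b::real_normed_vector) \<Rightarrow> bool" where
  "smooth_map_on S f \<longleftrightarrow> (\<forall>k. Ck_on S k f)"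

fun iterated_deriv :: "'a::euclidean_space list \<Rightarrow> ('a \<Rightarrow> real) \<Rightarrow> 'a \<Rightarrow> real" where
  "iterated_deriv [] f = f"
| "iterated_deriv (v # vs) f = (\<lambda>x. frechet_derivative (iterated_deriv vs f) (at x) v)"


section \<open>Smooth manifolds\<close>

text \<open>A manifold is the whole of a Hausdorff, second countable type \<open>'p\<close> together with a maximal
  smooth atlas of charts into a Euclidean space \<open>'e\<close>; paracompactness follows. Thus the smooth real
  functions on the manifold are genuine functions on \<open>'p\<close>. In a chart \<open>(U, \<phi>)\<close> the values of \<open>\<phi>\<close>
  outside \<open>U\<close> are irrelevant.\<close>

type_synonym ('p, 'e) chart = "'p set \<times> ('p \<Rightarrow> 'e)"

definition is_chart :: "('p::topological_space, 'e::euclidean_space) chart \<Rightarrow> bool" where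
  "is_chart = (\<lambda>(U, \<phi>). open U \<and> open (\<phi> ` U) \<and> homeomorphism U (\<phi> ` U) \<phi> (inv_into U \<phi>))"

definition compatible_charts ::
    "('p, 'e::euclidean_space) chart \<Rightarrow> ('p, 'e) chart \<Rightarrow> bool" where
  "compatible_charts = (\<lambda>(U, \<phi>) (V, \<psi>).
     smooth_map_on (\<phi> ` (U \<inter> V)) (\<psi> \<circ> inv_into U \<phi>) \<and>
     smooth_map_on (\<psi> ` (U \<inter> V)) (\<phi> \<circ> inv_into V \<psi>))"

definition smooth_manifold ::
    "('p::{t2_space,second_countable_topology}, 'e::euclidean_space) chart set \<Rightarrow> bool" where
  "smooth_manifold A \<longleftrightarrow>
     (\<forall>c\<in>A. is_chart c) \<and>
     (\<Union>c\<in>A. fst c) = UNIV \<and>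
     (\<forall>c\<in>A. \<forall>d\<in>A. compatible_charts c d) \<and>
     (\<forall>c. is_chart c \<and> (\<forall>d\<in>A. compatible_charts c d) \<longrightarrow> c \<in> A)"

definition in_chart :: "('p, 'e) chart \<Rightarrow> ('p \<Rightarrow> real) \<Rightarrow> 'e \<Rightarrow> real" where
  "in_chart = (\<lambda>(U, \<phi>) f. f \<circ> inv_into U \<phi>)"

definition smooth_functions :: "('p, 'e::euclidean_space) chart set \<Rightarrow> ('p \<Rightarrow> real) set" where
  "smooth_functions A = {f. \<forall>c\<in>A. smooth_map_on (snd c ` fst c) (in_chart c f)}"

text \<open>Embedded submanifolds, not necessarily closed as subsets.\<close>

definition submanifold_codim ::
    "('p, 'e::euclidean_space) chart set \<Rightarrow> nat \<Rightarrow> 'p set \<Rightarrow> bool" where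
  "submanifold_codim A k S \<longleftrightarrow>
     (\<forall>p\<in>S. \<exists>(U, \<phi>)\<in>A. p \<in> U \<and>
        (\<exists>L. subspace L \<and> dim L + k = DIM('e) \<and> \<phi> ` (U \<inter> S) = \<phi> ` U \<inter> L))"


section \<open>Tangent vectors and vector fields\<close>

text \<open>Tangent vectors at \<open>p\<close> are the derivations at \<open>p\<close> of the algebra of smooth functions. As HOL
  functions are total, they are extended by \<open>0\<close> to non-smooth functions, so that equality of tangent
  vectors is equality of derivations.\<close>

type_synonym 'p tangent = "('p \<Rightarrow> real) \<Rightarrow> real"

definition tangent_space ::
    "('p, 'e::euclidean_space) chart set \<Rightarrow> 'p \<Rightarrow> 'p tangent set" where
  "tangent_space A p = {v.
     (\<forall>f\<in>smooth_functions A. \<forall>g\<in>smooth_functions A. \<forall>a b.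
        v (\<lambda>q. a * f q + b * g q) = a * v f + b * v g) \<and>
     (\<forall>f\<in>smooth_functions A. \<forall>g\<in>smooth_functions A.
        v (\<lambda>q. f q * g q) = f p * v g + g p * v f) \<and>
     (\<forall>f. f \<notin> smooth_functions A \<longrightarrow> v f = 0)}"

text \<open>The differential \<open>dF\<close> at \<open>p\<close> is the map sending a tangent vector \<open>v\<close> to \<open>v F\<close>.\<close>

definition critical_points ::
    "('p, 'e::euclidean_space) chart set \<Rightarrow> ('p \<Rightarrow> real) \<Rightarrow> 'p set" where
  "critical_points A F = {p. \<forall>v\<in>tangent_space A p. v F = 0}"

definition smooth_vector_field ::
    "('p, 'e::euclidean_space) chart set \<Rightarrow> ('p \<Rightarrow> 'p tangent) \<Rightarrow> bool" where
  "smooth_vector_field A X \<longleftrightarrow>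
     (\<forall>p. X p \<in> tangent_space A p) \<and>
     (\<forall>f\<in>smooth_functions A. (\<lambda>p. X p f) \<in> smooth_functions A)"

definition lie_bracket ::
    "('p \<Rightarrow> 'p tangent) \<Rightarrow> ('p \<Rightarrow> 'p tangent) \<Rightarrow> 'p \<Rightarrow> 'p tangent" where
  "lie_bracket X Y p = (\<lambda>f. X p (\<lambda>q. Y q f) - Y p (\<lambda>q. X q f))"


section \<open>Symplectic forms and Hamiltonian vector fields\<close>

text \<open>Values of \<open>\<omega> p\<close> outside the tangent space at \<open>p\<close> are irrelevant.\<close>

type_synonym 'p two_form = "'p \<Rightarrow> 'p tangent \<Rightarrow> 'p tangent \<Rightarrow> real"

definition smooth_two_form ::
    "('p, 'e::euclidean_space) chart set \<Rightarrow> 'p two_form \<Rightarrow> bool" where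
  "smooth_two_form A \<omega> \<longleftrightarrow>
     (\<forall>p. \<forall>u\<in>tangent_space A p. \<forall>v\<in>tangent_space A p. \<forall>w\<in>tangent_space A p. \<forall>a b.
        \<omega> p (\<lambda>f. a * u f + b * v f) w = a * \<omega> p u w + b * \<omega> p v w) \<and>
     (\<forall>p. \<forall>u\<in>tangent_space A p. \<forall>v\<in>tangent_space A p. \<omega> p u v = - \<omega> p v u) \<and>
     (\<forall>X Y. smooth_vector_field A X \<and> smooth_vector_field A Y \<longrightarrow>
        (\<lambda>p. \<omega> p (X p) (Y p)) \<in> smooth_functions A)"

text \<open>\<open>d\<omega>(X, Y, Z)\<close> by the invariant (Palais) formula for the exterior derivative.\<close>

definition exterior_derivative ::
    "'p two_form \<Rightarrow> ('p \<Rightarrow> 'p tangent) \<Rightarrow> ('p \<Rightarrow> 'p tangent) \<Rightarrow> ('p \<Rightarrow> 'p tangent) \<Rightarrow> 'p \<Rightarrow> real" where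
  "exterior_derivative \<omega> X Y Z p =
     X p (\<lambda>q. \<omega> q (Y q) (Z q)) - Y p (\<lambda>q. \<omega> q (X q) (Z q)) + Z p (\<lambda>q. \<omega> q (X q) (Y q))
     - \<omega> p (lie_bracket X Y p) (Z p) + \<omega> p (lie_bracket X Z p) (Y p)
     - \<omega> p (lie_bracket Y Z p) (X p)"

definition closed_two_form ::
    "('p, 'e::euclidean_space) chart set \<Rightarrow> 'p two_form \<Rightarrow> bool" where
  "closed_two_form A \<omega> \<longleftrightarrow>
     (\<forall>X Y Z p. smooth_vector_field A X \<and> smooth_vector_field A Y \<and> smooth_vector_field A Z \<longrightarrow>
        exterior_derivative \<omega> X Y Z p = 0)"

definition nondegenerate_two_form ::
    "('p, 'e::euclidean_space) chart set \<Rightarrow> 'p two_form \<Rightarrow> bool" where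
  "nondegenerate_two_form A \<omega> \<longleftrightarrow>
     (\<forall>p. \<forall>v\<in>tangent_space A p. (\<forall>w\<in>tangent_space A p. \<omega> p v w = 0) \<longrightarrow> v = (\<lambda>f. 0))"

definition symplectic_manifold ::
    "('p::{t2_space,second_countable_topology}, 'e::euclidean_space) chart set \<Rightarrow> 'p two_form \<Rightarrow> bool"
  where
  "symplectic_manifold A \<omega> \<longleftrightarrow>
     smooth_manifold A \<and> smooth_two_form A \<omega> \<and> closed_two_form A \<omega> \<and> nondegenerate_two_form A \<omega>"

text \<open>The vector field \<open>X\<close> with \<open>\<omega>(X, w) = dH(w)\<close> for all tangent vectors \<open>w\<close>.\<close>

definition hamiltonian_vector_field ::
    "('p, 'e::euclidean_space) chart set \<Rightarrow> 'p two_form \<Rightarrow> ('p \<Rightarrow> real) \<Rightarrow> 'p \<Rightarrow> 'p tangent" where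
  "hamiltonian_vector_field A \<omega> H p =
     (THE v. v \<in> tangent_space A p \<and> (\<forall>w\<in>tangent_space A p. \<omega> p v w = w H))"


section \<open>Solutions and equilibria\<close>

text \<open>The velocity of \<open>\<gamma>\<close> at \<open>t\<close> is the tangent vector sending \<open>f\<close> to the derivative of \<open>f \<circ> \<gamma>\<close> at \<open>t\<close>.\<close>

definition integral_curve ::
    "('p::topological_space, 'e::euclidean_space) chart set \<Rightarrow> ('p \<Rightarrow> 'p tangent) \<Rightarrow>
     real set \<Rightarrow> (real \<Rightarrow> 'p) \<Rightarrow> bool" where
  "integral_curve A X J \<gamma> \<longleftrightarrow>
     open J \<and> is_interval J \<and> J \<noteq> {} \<and> continuous_on J \<gamma> \<and>
     (\<forall>t\<in>J. \<forall>f\<in>smooth_functions A. ((f \<circ> \<gamma>) has_real_derivative X (\<gamma> t) f) (at t))"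

definition equilibria ::
    "('p::topological_space, 'e::euclidean_space) chart set \<Rightarrow> ('p \<Rightarrow> 'p tangent) \<Rightarrow> 'p set" where
  "equilibria A X = {p. integral_curve A X UNIV (\<lambda>t. p)}"


section \<open>The strong topology and residual sets\<close>

definition locally_finite_charts :: "('p::topological_space, 'e) chart set \<Rightarrow> bool" where
  "locally_finite_charts \<Phi> \<longleftrightarrow>
     (\<forall>p. \<exists>V. open V \<and> p \<in> V \<and> finite {c\<in>\<Phi>. fst c \<inter> V \<noteq> {}})"

text \<open>The basic \<open>C\<^sup>r\<close> neighbourhoods of \<open>f\<close> for a locally finite family \<open>\<Phi>\<close> of charts, compact sets
  \<open>K c\<close> inside their domains, and \<open>\<epsilon> c > 0\<close>. The norm on the derivatives of order at most \<open>r\<close> is the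
  maximum of the partial derivatives; on the target the identity chart of the reals is used.\<close>

definition strong_nbhd ::
    "('p, 'e::euclidean_space) chart set \<Rightarrow> nat \<Rightarrow> ('p \<Rightarrow> real) \<Rightarrow> ('p, 'e) chart set \<Rightarrow>
     (('p, 'e) chart \<Rightarrow> 'p set) \<Rightarrow> (('p, 'e) chart \<Rightarrow> real) \<Rightarrow> ('p \<Rightarrow> real) set" where
  "strong_nbhd A r f \<Phi> K \<epsilon> =
     {g \<in> smooth_functions A. \<forall>c\<in>\<Phi>. \<forall>p\<in>K c. \<forall>vs. set vs \<subseteq> Basis \<and> length vs \<le> r \<longrightarrow>
        \<bar>iterated_deriv vs (in_chart c f) (snd c p) - iterated_deriv vs (in_chart c g) (snd c p)\<bar> < \<epsilon> c}"

text \<open>The order \<open>r\<close> is finite and the same for all charts of a family: the strong \<open>C\<^sup>\<infinity>\<close> topology is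
  the union over finite \<open>r\<close> of the strong \<open>C\<^sup>r\<close> topologies.\<close>

definition strong_topology ::
    "('p::topological_space, 'e::euclidean_space) chart set \<Rightarrow> ('p \<Rightarrow> real) topology" where
  "strong_topology A = topology_generated_by
     {strong_nbhd A r f \<Phi> K \<epsilon> | r f \<Phi> K \<epsilon>.
        f \<in> smooth_functions A \<and> \<Phi> \<subseteq> A \<and> locally_finite_charts \<Phi> \<and>
        (\<forall>c\<in>\<Phi>. compact (K c) \<and> K c \<subseteq> fst c \<and> 0 < \<epsilon> c)}"

lemma topspace_strong_topology: "topspace (strong_topology A) = smooth_functions A"
proof -
  let ?B = "{strong_nbhd A r f \<Phi> K \<epsilon> | r f \<Phi> K \<epsilon>.
        f \<in> smooth_functions A \<and> \<Phi> \<subseteq> A \<and> locally_finite_charts \<Phi> \<and>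
        (\<forall>c\<in>\<Phi>. compact (K c) \<and> K c \<subseteq> fst c \<and> 0 < \<epsilon> c)}"
  have "f \<in> \<Union>?B" if f: "f \<in> smooth_functions A" for f
  proof (rule UnionI)
    show "strong_nbhd A 0 f {} (\<lambda>c. {}) (\<lambda>c. 1) \<in> ?B"
      using f by (fastforce simp: locally_finite_charts_def)
    show "f \<in> strong_nbhd A 0 f {} (\<lambda>c. {}) (\<lambda>c. 1)"
      using f by (simp add: strong_nbhd_def)
  qed
  moreover have "\<Union>?B \<subseteq> smooth_functions A"
    by (auto simp: strong_nbhd_def)
  ultimately show ?thesis
    unfolding strong_topology_def topology_generated_by_topspace by blast
qed

definition residual_in :: "'a topology \<Rightarrow> 'a set \<Rightarrow> bool" where
  "residual_in T C \<longleftrightarrow>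
     C \<subseteq> topspace T \<and>
     (\<exists>\<U>. countable \<U> \<and> (\<forall>U\<in>\<U>. openin T U \<and> T closure_of U = topspace T) \<and>
          topspace T \<inter> \<Inter>\<U> \<subseteq> C)"

end

theory Submission
  imports Defs
begin

text \<open>In a chart let \<open>J\<close> be the inverse of the matrix of \<open>\<omega>\<close>, so that \<open>X\<^sub>H f = L\<^sub>H f\<close> with
  \<open>L\<^sub>h f = \<Sum> J\<^sub>i\<^sub>j \<partial>\<^sub>ih \<partial>\<^sub>jf\<close>. If \<open>f\<close> is constant along a solution, all \<open>L\<^sub>H\<^sup>k f\<close> with \<open>k \<ge> 1\<close> vanish on it.
  Let \<open>d\<close> be the dimension. For generic \<open>H\<close> the \<open>d + 1\<close> equations \<open>L\<^sub>H\<^sup>k f = 0\<close> have no common zero where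
  \<open>df \<noteq> 0\<close> and \<open>dH \<noteq> 0\<close>: perturb \<open>H\<close> by \<open>q(l(x))\<close> with a linear \<open>l\<close> and a polynomial \<open>q\<close> of degree
  \<open>d + 1\<close>. As \<open>\<omega>\<close> is alternating, \<open>L\<^sub>H l\<close> is unaffected, and the \<open>k\<close>-th equation reads
  \<open>q\<^sup>(\<^sup>k\<^sup>)(l(x)) (L\<^sub>H l)\<^sup>k\<^sup>-\<^sup>1 L\<^sub>l f = R\<^sub>k(x, q', \<dots>, q\<^sup>(\<^sup>k\<^sup>-\<^sup>1\<^sup>))\<close>. Where the coefficient is nonzero the point \<open>x\<close> thus
  determines \<open>q\<close>, and the bad \<open>q\<close> are the differentiable image of a set of dimension \<open>d\<close> in a space of
  dimension \<open>d + 1\<close>. This is applied to \<open>f = F\<close> and, for solutions inside the critical set of \<open>F\<close>, to the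
  local equation of the hypersurface. Isolated equilibria come from generically nondegenerate Hessians:
  a critical point and a normalized kernel vector have \<open>2d - 1\<close> parameters, but must meet \<open>2d\<close> conditions. No flow and no
  Baire category argument is needed, since residual sets are given as countable intersections.\<close>


section \<open>Calculus of smooth functions\<close>

text \<open>An open good set requires a closed bad condition, whereas \<open>df \<noteq> 0\<close>
  and \<open>dH \<noteq> 0\<close> are open. Both are therefore replaced by a lower bound \<epsilon>
  on the brackets of \<open>l\<close> with \<open>H\<close> and with \<open>f\<close>; letting
  \<open>l\<close> run through a countable dense set, \<epsilon> through the numbers 1/(m+1) and the
  point through a compact exhaustion of a chart costs only a countable intersection. Limits of bad
  points can then be extracted by compactness, because the k-th equation is polynomial in the
  derivatives of \<open>H\<close> of order at most k. For density the perturbations are multiplied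
  by a bump function: with compact support they depend continuously on their finitely many
  parameters even in the strong topology, and a nonempty open set of parameters is not contained in
  a null set of bad ones. The polynomial \<open>q\<close> has no constant term, so degree d + 1
  gives exactly d + 1 parameters. A solution through a nonequilibrium stays among nonequilibria for
  a short time; if \<open>F\<close> is critical all along this arc, the arc lies in the
  hypersurface, whose equation in an adapted chart is linear and hence has no critical
  points.\<close>

lemma Ck_on_subset: "Ck_on S k f \<Longrightarrow> T \<subseteq> S \<Longrightarrow> Ck_on T k f"
  by (induction k arbitrary: f) (auto intro: continuous_on_subset)

lemma differentiable_transform_open:
  assumes "f differentiable (at x)" "open S" "x \<in> S" "\<And>x. x \<in> S \<Longrightarrow> f x = g x"
  shows "g differentiable (at x)"
  using assms has_derivative_transform_within_open unfolding differentiable_def by blast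

lemma Ck_on_cong:
  assumes "open S" "\<And>x. x \<in> S \<Longrightarrow> f x = g x" "Ck_on S k f"
  shows "Ck_on S k g"
  using assms(2,3)
proof (induction k arbitrary: f g)
  case 0
  then show ?case by (metis Ck_on.simps(1) continuous_on_cong)
next
  case (Suc k)
  have d: "g differentiable (at x)" if "x \<in> S" for x
    by (rule differentiable_transform_open[OF _ assms(1) that Suc.prems(1)])
      (use Suc.prems(2) that in auto)
  have "frechet_derivative f (at x) v = frechet_derivative g (at x) v" if "x \<in> S" for x v
    using frechet_derivative_transform_within_open[of f x S g] Suc.prems that assms(1) by auto
  then have "Ck_on S k (\<lambda>x. frechet_derivative g (at x) v)" for v
    using Suc.IH[of "\<lambda>x. frechet_derivative f (at x) v" "\<lambda>x. frechet_derivative g (at x) v"] Suc.prems(2)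
    by auto
  with d show ?case by auto
qed

lemma Ck_on_local:
  assumes "\<And>x. x \<in> S \<Longrightarrow> \<exists>T. open T \<and> x \<in> T \<and> Ck_on T k f"
  shows "Ck_on S k f"
  using assms
proof (induction k arbitrary: f)
  case 0
  have "isCont f x" if "x \<in> S" for x
    using 0[OF that] by (auto simp: continuous_on_eq_continuous_at)
  then show ?case by (simp add: continuous_at_imp_continuous_on)
next
  case (Suc k)
  then show ?case by (simp, meson)
qed

lemma Ck_on_Suc_imp: "Ck_on S (Suc k) f \<Longrightarrow> Ck_on S k f"
proof (induction k arbitrary: f)
  case 0
  then show ?case
    by (auto intro!: continuous_at_imp_continuous_on differentiable_imp_continuous_within)
next
  case (Suc k)
  then show ?case by (metis Ck_on.simps(2))
qed

lemma Ck_on_const: "Ck_on S k (\<lambda>x. c)"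
proof (induction k arbitrary: c)
  case (Suc k)
  then show ?case by (simp add: frechet_derivative_const)
qed simp

text \<open>Lets the inductions below use an explicit derivative formula: by uniqueness of
  derivatives it agrees with \<open>frechet_derivative\<close> on the open set, and
  \<open>Ck_on_cong\<close> transfers the regularity.\<close>

lemma Ck_on_SucI:
  assumes "open S" "\<And>x. x \<in> S \<Longrightarrow> (f has_derivative f' x) (at x)" "\<And>v. Ck_on S k (\<lambda>x. f' x v)"
  shows "Ck_on S (Suc k) f"
proof -
  have "Ck_on S k (\<lambda>x. frechet_derivative f (at x) v)" for v
    by (rule Ck_on_cong[OF assms(1) _ assms(3)]) (simp add: frechet_derivative_at[OF assms(2), symmetric])
  then show ?thesis using assms(2) by (auto simp: differentiable_def)
qed

lemma Ck_on_has_derivative: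
  "Ck_on S (Suc k) f \<Longrightarrow> x \<in> S \<Longrightarrow> (f has_derivative frechet_derivative f (at x)) (at x)"
  by (simp add: frechet_derivative_works[symmetric])

lemma Ck_on_bounded_linear:
  assumes "open S" "bounded_linear L" "Ck_on S k f"
  shows "Ck_on S k (\<lambda>x. L (f x))"
  using assms(3)
proof (induction k arbitrary: f)
  case 0
  then show ?case
    using assms(2) by (simp add: bounded_linear.continuous_on)
next
  case (Suc k)
  show ?case
    by (rule Ck_on_SucI[OF assms(1) bounded_linear.has_derivative[OF assms(2)
          Ck_on_has_derivative[OF Suc.prems]]]) (use Suc in auto)
qed

lemma Ck_on_add:
  assumes "open S" "Ck_on S k f" "Ck_on S k g"
  shows "Ck_on S k (\<lambda>x. f x + g x)"
  using assms(2,3)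
proof (induction k arbitrary: f g)
  case 0
  then show ?case by (simp add: continuous_on_add)
next
  case (Suc k)
  show ?case
    by (rule Ck_on_SucI[OF assms(1) has_derivative_add[OF Ck_on_has_derivative[OF Suc.prems(1)]
          Ck_on_has_derivative[OF Suc.prems(2)]]]) (use Suc in auto)
qed

lemma Ck_on_scaleR:
  fixes f :: "'a::euclidean_space \<Rightarrow> real"
  assumes "open S" "Ck_on S k f" "Ck_on S k g"
  shows "Ck_on S k (\<lambda>x. f x *\<^sub>R g x)"
  using assms(2,3)
proof (induction k arbitrary: f g)
  case 0
  then show ?case by (simp add: continuous_on_scaleR)
next
  case (Suc k)
  have fg: "Ck_on S k f" "Ck_on S k g"
    using Suc.prems Ck_on_Suc_imp by blast+
  show ?case
    by (rule Ck_on_SucI[OF assms(1) has_derivative_scaleR[OF Ck_on_has_derivative[OF Suc.prems(1)]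
          Ck_on_has_derivative[OF Suc.prems(2)]]]) (use Suc fg in \<open>auto intro!: Ck_on_add assms(1)\<close>)
qed

lemma Ck_on_inverse:
  fixes f :: "'a::euclidean_space \<Rightarrow> real"
  assumes "open S" "Ck_on S k f" "\<And>x. x \<in> S \<Longrightarrow> f x \<noteq> 0"
  shows "Ck_on S k (\<lambda>x. inverse (f x))"
  using assms(2,3)
proof (induction k)
  case 0
  then show ?case by (simp add: continuous_on_inverse)
next
  case (Suc k)
  have f: "Ck_on S k f" using Suc.prems(1) Ck_on_Suc_imp by blast
  have inv: "Ck_on S k (\<lambda>x. inverse (f x))" using Suc.IH[OF f Suc.prems(2)] .
  have d: "((\<lambda>x. inverse (f x)) has_derivative
      (\<lambda>h. - (inverse (f x) * frechet_derivative f (at x) h * inverse (f x)))) (at x)"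
    if "x \<in> S" for x
    using Deriv.has_derivative_inverse[OF _ Ck_on_has_derivative[OF Suc.prems(1) that]] Suc.prems(2) that
    by blast
  have "Ck_on S k (\<lambda>x. - (inverse (f x) *\<^sub>R frechet_derivative f (at x) v *\<^sub>R inverse (f x)))" for v
    using Suc.prems(1) inv
    by (intro Ck_on_bounded_linear[OF assms(1) bounded_linear_minus[OF bounded_linear_ident]]
        Ck_on_scaleR assms(1)) auto
  then show ?case
    by (intro Ck_on_SucI[OF assms(1) d]) (auto simp: mult.assoc)
qed

lemma Ck_on_sum:
  assumes "open S" "finite I" "\<And>i. i \<in> I \<Longrightarrow> Ck_on S k (f i)"
  shows "Ck_on S k (\<lambda>x. \<Sum>i\<in>I. f i x)"
  using assms(2,3)
  by (induction I rule: finite_induct) (auto intro: Ck_on_const Ck_on_add[OF assms(1)])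

lemma Ck_on_compose:
  fixes f :: "'a::euclidean_space \<Rightarrow> 'b::euclidean_space" and g :: "'b \<Rightarrow> 'c::real_normed_vector"
  assumes "open S" "open T" "Ck_on S k f" "f ` S \<subseteq> T" "Ck_on T k g"
  shows "Ck_on S k (\<lambda>x. g (f x))"
  using assms(3,5)
proof (induction k arbitrary: g)
  case 0
  then show ?case using assms(4) by (simp add: continuous_on_compose2)
next
  case (Suc k)
  \<comment> \<open>The chain rule is expanded in a basis, so that the derivative of the composite
    becomes a finite sum of products to which the induction hypothesis for the partial derivatives
    of \<open>g\<close> applies.\<close>
  let ?d = "\<lambda>x v. \<Sum>b\<in>Basis. (frechet_derivative f (at x) v \<bullet> b) *\<^sub>R frechet_derivative g (at (f x)) b"
  have d: "((\<lambda>x. g (f x)) has_derivative ?d x) (at x)" if x: "x \<in> S" for x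
  proof -
    have g: "(g has_derivative frechet_derivative g (at (f x))) (at (f x))"
      using Ck_on_has_derivative[OF Suc.prems(2), of "f x"] x assms(4) by auto
    have f: "(f has_derivative frechet_derivative f (at x)) (at x)"
      using Ck_on_has_derivative[OF Suc.prems(1) x] .
    have lin: "linear (frechet_derivative g (at (f x)))"
      using g has_derivative_linear by blast
    have eq: "frechet_derivative g (at (f x)) (frechet_derivative f (at x) v) = ?d x v" for v
    proof -
      have "frechet_derivative g (at (f x)) (frechet_derivative f (at x) v)
          = frechet_derivative g (at (f x)) (\<Sum>b\<in>Basis. (frechet_derivative f (at x) v \<bullet> b) *\<^sub>R b)"
        by (simp add: euclidean_representation)
      also have "\<dots> = ?d x v"
        using lin by (simp add: linear_sum linear_scale)
      finally show ?thesis .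
    qed
    show ?thesis
      using diff_chain_at[OF f g] by (simp add: o_def eq)
  qed
  have f: "Ck_on S k f" using Suc.prems(1) Ck_on_Suc_imp by blast
  have "Ck_on S k (\<lambda>x. ?d x v)" for v
  proof (rule Ck_on_sum[OF assms(1) finite_Basis], rule Ck_on_scaleR[OF assms(1)])
    fix b :: 'b assume "b \<in> Basis"
    have "Ck_on S k (\<lambda>x. frechet_derivative f (at x) v)"
      using Suc.prems(1) by simp
    from Ck_on_bounded_linear[OF assms(1) bounded_linear_inner_left this]
    show "Ck_on S k (\<lambda>x. frechet_derivative f (at x) v \<bullet> b)" .
    show "Ck_on S k (\<lambda>x. frechet_derivative g (at (f x)) b)"
      using Suc.IH[OF f, of "\<lambda>y. frechet_derivative g (at y) b"] Suc.prems(2) by simp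
  qed
  then show ?case using Ck_on_SucI[OF assms(1) d] by blast
qed

lemma smooth_map_onI: "(\<And>k. Ck_on S k f) \<Longrightarrow> smooth_map_on S f"
  by (simp add: smooth_map_on_def)

text \<open>A class of functions that is closed under directional derivatives consists of smooth
  functions. This replaces formulas for k-th derivatives wherever a class is found that absorbs one
  differentiation.\<close>

lemma smooth_map_on_coinduct:
  assumes "open S" "Q f"
    and "\<And>f. Q f \<Longrightarrow> \<exists>f'. (\<forall>x\<in>S. (f has_derivative f' x) (at x)) \<and> (\<forall>v. Q (\<lambda>x. f' x v))"
  shows "smooth_map_on S f"
proof (rule smooth_map_onI)
  show "Ck_on S k f" for k
    using assms(2)
  proof (induction k arbitrary: f)
    case 0
    then obtain f' where "\<forall>x\<in>S. (f has_derivative f' x) (at x)"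
      using assms(3) by blast
    then show ?case
      by (metis Ck_on.simps(1) continuous_at_imp_continuous_on has_derivative_continuous)
  next
    case (Suc k)
    then obtain f' where "\<forall>x\<in>S. (f has_derivative f' x) (at x)" "\<forall>v. Q (\<lambda>x. f' x v)"
      using assms(3) by blast
    then show ?case using Ck_on_SucI[OF assms(1)] Suc.IH by blast
  qed
qed

lemma smooth_map_on_subset: "smooth_map_on S f \<Longrightarrow> T \<subseteq> S \<Longrightarrow> smooth_map_on T f"
  unfolding smooth_map_on_def using Ck_on_subset by blast

lemma smooth_map_on_cong:
  "open S \<Longrightarrow> smooth_map_on S f \<Longrightarrow> (\<And>x. x \<in> S \<Longrightarrow> f x = g x) \<Longrightarrow> smooth_map_on S g"
  unfolding smooth_map_on_def using Ck_on_cong by blast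

lemma smooth_map_on_local:
  "(\<And>x. x \<in> S \<Longrightarrow> \<exists>T. open T \<and> x \<in> T \<and> smooth_map_on T f) \<Longrightarrow> smooth_map_on S f"
  unfolding smooth_map_on_def by (meson Ck_on_local)

lemma smooth_map_on_continuous: "smooth_map_on S f \<Longrightarrow> continuous_on S f"
  unfolding smooth_map_on_def by (metis Ck_on.simps(1))

lemma smooth_map_on_differentiable: "smooth_map_on S f \<Longrightarrow> x \<in> S \<Longrightarrow> f differentiable (at x)"
  unfolding smooth_map_on_def by (metis Ck_on.simps(2))

lemma smooth_map_on_has_derivative:
  "smooth_map_on S f \<Longrightarrow> x \<in> S \<Longrightarrow> (f has_derivative frechet_derivative f (at x)) (at x)"
  using smooth_map_on_differentiable frechet_derivative_works by blast

lemma smooth_map_on_deriv: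
  "smooth_map_on S f \<Longrightarrow> smooth_map_on S (\<lambda>x. frechet_derivative f (at x) v)"
  unfolding smooth_map_on_def by (metis Ck_on.simps(2))

lemma smooth_map_on_const: "smooth_map_on S (\<lambda>x. c)"
  by (simp add: smooth_map_on_def Ck_on_const)

lemma smooth_map_on_bounded_linear:
  assumes "open S" "bounded_linear L" "smooth_map_on S f"
  shows "smooth_map_on S (\<lambda>x. L (f x))"
  using assms unfolding smooth_map_on_def by (blast intro: Ck_on_bounded_linear)

lemma smooth_map_on_linear:
  assumes "bounded_linear L"
  shows "smooth_map_on S L"
proof (rule smooth_map_on_subset)
  have "Ck_on UNIV k L" for k
  proof (cases k)
    case 0
    then show ?thesis using assms by (simp add: linear_continuous_on)
  next
    case (Suc n)
    show ?thesis
      unfolding Suc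
      by (rule Ck_on_SucI[where f' = "\<lambda>x. L"])
        (auto simp: Ck_on_const bounded_linear_imp_has_derivative assms)
  qed
  then show "smooth_map_on UNIV L" by (rule smooth_map_onI)
qed simp

lemma smooth_map_on_add:
  "open S \<Longrightarrow> smooth_map_on S f \<Longrightarrow> smooth_map_on S g \<Longrightarrow> smooth_map_on S (\<lambda>x. f x + g x)"
  unfolding smooth_map_on_def by (blast intro: Ck_on_add)

lemma smooth_map_on_mult:
  fixes f g :: "'a::euclidean_space \<Rightarrow> real"
  shows "open S \<Longrightarrow> smooth_map_on S f \<Longrightarrow> smooth_map_on S g \<Longrightarrow> smooth_map_on S (\<lambda>x. f x * g x)"
  unfolding smooth_map_on_def using Ck_on_scaleR[of S _ f g] by simp

lemma smooth_map_on_scaleR: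
  fixes f :: "'a::euclidean_space \<Rightarrow> real"
  shows "open S \<Longrightarrow> smooth_map_on S f \<Longrightarrow> smooth_map_on S g \<Longrightarrow> smooth_map_on S (\<lambda>x. f x *\<^sub>R g x)"
  unfolding smooth_map_on_def using Ck_on_scaleR[of S _ f g] by simp

lemma smooth_map_on_sum:
  "open S \<Longrightarrow> finite I \<Longrightarrow> (\<And>i. i \<in> I \<Longrightarrow> smooth_map_on S (f i)) \<Longrightarrow>
    smooth_map_on S (\<lambda>x. \<Sum>i\<in>I. f i x)"
  unfolding smooth_map_on_def by (blast intro: Ck_on_sum)

lemma smooth_map_on_uminus:
  "open S \<Longrightarrow> smooth_map_on S f \<Longrightarrow> smooth_map_on S (\<lambda>x. - f x)"
  by (rule smooth_map_on_bounded_linear[OF _ bounded_linear_minus[OF bounded_linear_ident]])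

lemma smooth_map_on_diff:
  "open S \<Longrightarrow> smooth_map_on S f \<Longrightarrow> smooth_map_on S g \<Longrightarrow> smooth_map_on S (\<lambda>x. f x - g x)"
  using smooth_map_on_add[of S f "\<lambda>x. - g x"] smooth_map_on_uminus[of S g] by simp

lemma smooth_map_on_power:
  fixes f :: "'a::euclidean_space \<Rightarrow> real"
  shows "open S \<Longrightarrow> smooth_map_on S f \<Longrightarrow> smooth_map_on S (\<lambda>x. f x ^ n)"
  by (induction n) (auto intro: smooth_map_on_const smooth_map_on_mult)

lemma smooth_map_on_divide:
  fixes f g :: "'a::euclidean_space \<Rightarrow> real"
  assumes "open S" "smooth_map_on S f" "smooth_map_on S g" "\<And>x. x \<in> S \<Longrightarrow> g x \<noteq> 0"
  shows "smooth_map_on S (\<lambda>x. f x / g x)"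
proof -
  have "smooth_map_on S (\<lambda>x. inverse (g x))"
    using assms unfolding smooth_map_on_def by (blast intro: Ck_on_inverse)
  from smooth_map_on_mult[OF assms(1,2) this] show ?thesis by (simp add: divide_inverse)
qed

lemma smooth_map_on_compose:
  fixes f :: "'a::euclidean_space \<Rightarrow> 'b::euclidean_space" and g :: "'b \<Rightarrow> 'c::real_normed_vector"
  assumes "open S" "open T" "smooth_map_on S f" "f ` S \<subseteq> T" "smooth_map_on T g"
  shows "smooth_map_on S (\<lambda>x. g (f x))"
  using assms unfolding smooth_map_on_def by (blast intro: Ck_on_compose)

lemma smooth_map_on_inner_left: "smooth_map_on S (\<lambda>x. x \<bullet> a)"
  and smooth_map_on_inner_right: "smooth_map_on S (\<lambda>x. a \<bullet> x)"
  by (simp_all add: smooth_map_on_linear bounded_linear_inner_left bounded_linear_inner_right)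

lemma smooth_map_on_iterated_deriv:
  "smooth_map_on S f \<Longrightarrow> smooth_map_on S (iterated_deriv vs f)"
  by (induction vs) (auto intro: smooth_map_on_deriv)

lemma iterated_deriv_cong:
  assumes "open S" "smooth_map_on S f" "\<And>x. x \<in> S \<Longrightarrow> f x = g x" "x \<in> S"
  shows "iterated_deriv vs f x = iterated_deriv vs g x"
  using assms(4)
proof (induction vs arbitrary: x)
  case (Cons v vs)
  have "iterated_deriv vs f differentiable at x"
    using smooth_map_on_differentiable smooth_map_on_iterated_deriv assms(2) Cons.prems by blast
  from frechet_derivative_transform_within_open[OF this assms(1) Cons.prems]
  show ?case using Cons.IH by simp
qed (simp add: assms)

lemma frechet_derivative_cong:
  assumes "open S" "smooth_map_on S f" "\<And>x. x \<in> S \<Longrightarrow> f x = g x" "x \<in> S"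
  shows "frechet_derivative f (at x) = frechet_derivative g (at x)"
  using frechet_derivative_transform_within_open smooth_map_on_differentiable assms by blast

lemma frechet_derivative_basis:
  fixes f :: "'a::euclidean_space \<Rightarrow> real"
  assumes "f differentiable (at x)"
  shows "frechet_derivative f (at x) v = (\<Sum>b\<in>Basis. (v \<bullet> b) * frechet_derivative f (at x) b)"
proof -
  have lin: "linear (frechet_derivative f (at x))"
    using assms linear_frechet_derivative by blast
  have "frechet_derivative f (at x) v = frechet_derivative f (at x) (\<Sum>b\<in>Basis. (v \<bullet> b) *\<^sub>R b)"
    by (simp add: euclidean_representation)
  also have "\<dots> = (\<Sum>b\<in>Basis. (v \<bullet> b) * frechet_derivative f (at x) b)"
    using lin by (simp add: linear_sum linear_scale)
  finally show ?thesis .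
qed

lemma frechet_derivative_add:
  fixes f g :: "'a::real_normed_vector \<Rightarrow> 'b::real_normed_vector"
  assumes "f differentiable (at x)" "g differentiable (at x)"
  shows "frechet_derivative (\<lambda>y. f y + g y) (at x) v
    = frechet_derivative f (at x) v + frechet_derivative g (at x) v"
  using frechet_derivative_at[OF has_derivative_add[OF assms[unfolded frechet_derivative_works]]]
  by metis

lemma frechet_derivative_mult:
  fixes f g :: "'a::real_normed_vector \<Rightarrow> real"
  assumes "f differentiable (at x)" "g differentiable (at x)"
  shows "frechet_derivative (\<lambda>y. f y * g y) (at x) v
    = f x * frechet_derivative g (at x) v + frechet_derivative f (at x) v * g x"
  using frechet_derivative_at[OF has_derivative_mult[OF assms[unfolded frechet_derivative_works]]]
  by metis

lemma frechet_derivative_sum: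
  fixes f :: "'i \<Rightarrow> 'a::real_normed_vector \<Rightarrow> real"
  assumes "\<And>i. i \<in> I \<Longrightarrow> f i differentiable (at x)"
  shows "frechet_derivative (\<lambda>y. \<Sum>i\<in>I. c i * f i y) (at x) v
    = (\<Sum>i\<in>I. c i * frechet_derivative (f i) (at x) v)"
proof -
  have "((\<lambda>y. \<Sum>i\<in>I. c i * f i y) has_derivative
      (\<lambda>v. \<Sum>i\<in>I. c i * frechet_derivative (f i) (at x) v)) (at x)"
    using assms
    by (intro has_derivative_sum has_derivative_mult_right) (simp add: frechet_derivative_works)
  then show ?thesis by (simp add: frechet_derivative_at[symmetric])
qed

lemma smooth_map_on_sum_iterated_deriv:
  assumes S: "open S" and f: "smooth_map_on S f" and g: "\<And>i. i \<in> I \<Longrightarrow> smooth_map_on S (g i)"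
    and I: "finite I" and x: "x \<in> S"
  shows "iterated_deriv vs (\<lambda>y. f y + (\<Sum>i\<in>I. c i * g i y)) x
    = iterated_deriv vs f x + (\<Sum>i\<in>I. c i * iterated_deriv vs (g i) x)"
  using x
proof (induction vs arbitrary: x)
  case (Cons v vs)
  let ?h = "\<lambda>y. f y + (\<Sum>i\<in>I. c i * g i y)"
  have sm: "smooth_map_on S (\<lambda>y. iterated_deriv vs f y)"
    "\<And>i. i \<in> I \<Longrightarrow> smooth_map_on S (\<lambda>y. iterated_deriv vs (g i) y)"
    using f g smooth_map_on_iterated_deriv by blast+
  then have sm2: "smooth_map_on S (\<lambda>y. (\<Sum>i\<in>I. c i * iterated_deriv vs (g i) y))"
    by (intro smooth_map_on_sum S I smooth_map_on_mult smooth_map_on_const) auto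
  have "frechet_derivative (iterated_deriv vs ?h) (at x)
      = frechet_derivative (\<lambda>y. iterated_deriv vs f y + (\<Sum>i\<in>I. c i * iterated_deriv vs (g i) y)) (at x)"
    using frechet_derivative_cong[OF S smooth_map_on_add[OF S sm(1) sm2], of "iterated_deriv vs ?h" x]
      Cons by simp
  then show ?case
    using smooth_map_on_differentiable[OF sm(1) Cons.prems] smooth_map_on_differentiable[OF sm2 Cons.prems]
      smooth_map_on_differentiable[OF sm(2) Cons.prems]
    by (simp add: frechet_derivative_add frechet_derivative_sum)
qed simp

text \<open>The open sets \<open>B\<close> and \<open>- C\<close> cover the space, and the extended
  function is smooth on each of them.\<close>

lemma smooth_map_on_extend_zero:
  fixes f :: "'a::euclidean_space \<Rightarrow> 'b::real_normed_vector"
  assumes "open B" "smooth_map_on B f" "closed C" "C \<subseteq> B" "\<And>x. x \<in> B - C \<Longrightarrow> f x = 0"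
  shows "smooth_map_on UNIV (\<lambda>x. if x \<in> B then f x else 0)"
proof (rule smooth_map_on_local)
  fix x :: 'a
  show "\<exists>T. open T \<and> x \<in> T \<and> smooth_map_on T (\<lambda>x. if x \<in> B then f x else 0)"
  proof (cases "x \<in> B")
    case True
    then show ?thesis
      using assms(1) smooth_map_on_cong[OF assms(1,2), of "\<lambda>x. if x \<in> B then f x else 0"] by auto
  next
    case False
    have "smooth_map_on (- C) (\<lambda>x. if x \<in> B then f x else 0)"
      by (rule smooth_map_on_cong[OF _ smooth_map_on_const[where c = 0]]) (use assms in auto)
    then show ?thesis
      using assms(3,4) False by (auto intro!: exI[of _ "- C"])
  qed
qed


section \<open>Bump functions\<close>

text \<open>The classical flat function exp(-1/t), with a polynomial factor in 1/t so that the
  family is closed under differentiation.\<close>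

definition flat_exp :: "real poly \<Rightarrow> real \<Rightarrow> real" where
  "flat_exp p t = (if t > 0 then poly p (inverse t) * exp (- inverse t) else 0)"

lemma tendsto_poly_times_exp_minus: "((\<lambda>s. poly p s * exp (- s)) \<longlongrightarrow> (0::real)) at_top"
proof -
  have "((\<lambda>s. \<Sum>i\<le>degree p. coeff p i * (s ^ i / exp s)) \<longlongrightarrow> (\<Sum>i\<le>degree p. coeff p i * 0)) at_top"
    by (intro tendsto_intros tendsto_power_div_exp_0)
  then show ?thesis
    by (simp add: poly_altdef sum_distrib_right exp_minus divide_inverse mult.assoc)
qed

text \<open>With s = 1/t, differentiation in t is -s^2 d/ds, which turns p(s) exp(-s) into s^2 (p -
  p')(s) exp(-s); \<open>monom 1 2\<close> is the factor s^2.\<close>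

lemma flat_exp_DERIV: "(flat_exp p has_real_derivative flat_exp (monom 1 2 * (p - pderiv p)) t) (at t)"
proof (cases t "0 :: real" rule: linorder_cases)
  case less
  have "((\<lambda>t. 0) has_real_derivative 0) (at t)" by simp
  then show ?thesis
    by (rule DERIV_cong[OF has_field_derivative_transform_within_open[OF _ open_lessThan[of 0]]])
      (use less in \<open>auto simp: flat_exp_def\<close>)
next
  case greater
  have "((\<lambda>t. poly p (inverse t) * exp (- inverse t)) has_real_derivative
      (- (inverse t)\<^sup>2 * poly (pderiv p) (inverse t)) * exp (- inverse t)
      + (exp (- inverse t) * (inverse t)\<^sup>2) * poly p (inverse t)) (at t)"
    using greater
    by (auto intro!: derivative_eq_intros poly_DERIV[THEN DERIV_chain2] simp: power2_eq_square)
  then have "((\<lambda>t. poly p (inverse t) * exp (- inverse t)) has_real_derivative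
      flat_exp (monom 1 2 * (p - pderiv p)) t) (at t)"
    by (rule DERIV_cong)
      (use greater in \<open>auto simp: flat_exp_def poly_monom algebra_simps\<close>)
  then show ?thesis
    by (rule has_field_derivative_transform_within_open[OF _ open_greaterThan[of 0]])
      (use greater in \<open>auto simp: flat_exp_def\<close>)
next
  case equal
  have "((\<lambda>y. flat_exp p y / y) \<longlongrightarrow> 0) (at 0)"
  proof (rule filterlim_split_at)
    show "((\<lambda>y. flat_exp p y / y) \<longlongrightarrow> 0) (at_left 0)"
      by (rule Lim_transform_eventually[OF tendsto_const])
        (auto simp: eventually_at flat_exp_def intro!: exI[of _ 1])
    \<comment> \<open>Dividing by y multiplies the polynomial by s = 1/y, so the difference quotient
      at 0 is again a polynomial in s times exp(-s), now with s tending to infinity.\<close>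
    have "((\<lambda>y. poly (p * monom 1 1) (inverse y) * exp (- inverse y)) \<longlongrightarrow> 0) (at_right 0)"
      by (rule filterlim_compose[OF tendsto_poly_times_exp_minus filterlim_inverse_at_top_right])
    then show "((\<lambda>y. flat_exp p y / y) \<longlongrightarrow> 0) (at_right 0)"
      by (rule Lim_transform_eventually)
        (auto simp: eventually_at flat_exp_def poly_monom divide_inverse intro!: exI[of _ 1])
  qed
  then show ?thesis
    using equal by (simp add: has_field_derivative_iff flat_exp_def)
qed

lemma smooth_flat_exp: "smooth_map_on UNIV (flat_exp p)"
proof (rule smooth_map_on_coinduct[where Q = "\<lambda>f. \<exists>p. f = flat_exp p"])
  fix f :: "real \<Rightarrow> real"
  assume "\<exists>p. f = flat_exp p"
  then obtain p where f: "f = flat_exp p" by blast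
  have "flat_exp (monom 1 2 * (p - pderiv p)) x * v = flat_exp (smult v (monom 1 2 * (p - pderiv p))) x"
    for x v
    by (simp add: flat_exp_def)
  then show "\<exists>f'. (\<forall>x\<in>UNIV. (f has_derivative f' x) (at x)) \<and> (\<forall>v. \<exists>p. (\<lambda>x. f' x v) = flat_exp p)"
    using flat_exp_DERIV[of p] unfolding f has_field_derivative_def
    by (intro exI[of _ "\<lambda>x v. flat_exp (monom 1 2 * (p - pderiv p)) x * v"]) blast
qed auto

text \<open>The value 1 is attained on a whole neighbourhood \<open>N\<close> of \<open>K\<close>,
  so that multiplying by \<beta> preserves the germs of a function at all points of
  \<open>K\<close>.\<close>

lemma bump_function:
  fixes K U :: "'a::euclidean_space set"
  assumes "compact K" "open U" "K \<subseteq> U"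
  obtains \<beta> :: "'a \<Rightarrow> real" and C N where
    "smooth_map_on UNIV \<beta>" "compact C" "C \<subseteq> U" "\<And>x. x \<notin> C \<Longrightarrow> \<beta> x = 0"
    "open N" "K \<subseteq> N" "\<And>x. x \<in> N \<Longrightarrow> \<beta> x = 1"
proof (cases "K = {}")
  case True
  show ?thesis
    by (rule that[of "\<lambda>x. 0" "{}" "{}"]) (use True in \<open>auto intro: smooth_map_on_const\<close>)
next
  case False
  define \<psi> where "\<psi> = flat_exp 1"
  have \<psi>_pos: "\<psi> t > 0 \<longleftrightarrow> t > 0" and \<psi>_nonneg: "\<psi> t \<ge> 0" for t
    by (auto simp: \<psi>_def flat_exp_def)
  have \<psi>_zero: "\<psi> t = 0 \<longleftrightarrow> t \<le> 0" for t
    by (auto simp: \<psi>_def flat_exp_def)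
  have \<psi>_smooth: "smooth_map_on UNIV (\<lambda>x. \<psi> (h x))" if "smooth_map_on UNIV h" for h :: "'a \<Rightarrow> real"
    unfolding \<psi>_def by (rule smooth_map_on_compose[OF _ _ that _ smooth_flat_exp]) simp_all
  have "\<exists>r>0. cball x r \<subseteq> U" if "x \<in> K" for x
    using that assms open_contains_cball by blast
  then obtain r where r: "\<And>x. x \<in> K \<Longrightarrow> r x > 0" "\<And>x. x \<in> K \<Longrightarrow> cball x (r x) \<subseteq> U"
    by metis
  obtain D where D: "D \<subseteq> K" "finite D" "K \<subseteq> (\<Union>x\<in>D. ball x (r x))"
    by (rule compactE_image[OF assms(1), of K "\<lambda>x. ball x (r x)"]) (use r in force)+
  \<comment> \<open>Positive exactly on a finite union of balls covering \<open>K\<close>, hence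
    bounded below on \<open>K\<close> by some \<open>d > 0\<close>. The bump is obtained by
    thresholding \<open>f\<close> between the levels d/3 and 2d/3.\<close>
  define f where "f y = (\<Sum>x\<in>D. \<psi> ((r x)\<^sup>2 - (y - x) \<bullet> (y - x)))" for y
  have f_smooth: "smooth_map_on UNIV f"
    unfolding f_def inner_diff_left inner_diff_right
  proof (intro smooth_map_on_sum \<psi>_smooth smooth_map_on_diff smooth_map_on_const
      smooth_map_on_inner_left smooth_map_on_inner_right D(2) open_UNIV)
    have "smooth_map_on UNIV (\<lambda>y::'a. \<Sum>b\<in>Basis. (y \<bullet> b) * (y \<bullet> b))"
      by (intro smooth_map_on_sum smooth_map_on_mult smooth_map_on_inner_left) auto
    then show "smooth_map_on UNIV (\<lambda>y::'a. y \<bullet> y)"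
      by (subst euclidean_inner) simp
  qed
  have term_pos: "\<psi> ((r x)\<^sup>2 - (y - x) \<bullet> (y - x)) > 0 \<longleftrightarrow> y \<in> ball x (r x)" if "x \<in> D" for x y
  proof -
    have "r x > 0" using r(1) D(1) that by blast
    then have "norm (y - x) < r x \<longleftrightarrow> (norm (y - x))\<^sup>2 < (r x)\<^sup>2"
      by (metis linorder_not_less norm_ge_zero order_less_imp_le power2_le_imp_le power_mono)
    then show ?thesis
      unfolding mem_ball dist_norm norm_minus_commute[of x y] by (simp add: \<psi>_pos power2_norm_eq_inner)
  qed
  have f_pos: "f y > 0 \<longleftrightarrow> y \<in> (\<Union>x\<in>D. ball x (r x))" for y
  proof -
    have "f y > 0 \<longleftrightarrow> (\<exists>x\<in>D. \<psi> ((r x)\<^sup>2 - (y - x) \<bullet> (y - x)) > 0)"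
    proof
      assume "f y > 0"
      show "\<exists>x\<in>D. \<psi> ((r x)\<^sup>2 - (y - x) \<bullet> (y - x)) > 0"
      proof (rule ccontr)
        assume "\<not> ?thesis"
        then have "f y \<le> 0" unfolding f_def by (intro sum_nonpos) force
        then show False using \<open>f y > 0\<close> by simp
      qed
    qed (auto simp: f_def intro!: sum_pos2[OF D(2)] \<psi>_nonneg)
    then show ?thesis using term_pos by blast
  qed
  have f_cont: "continuous_on UNIV f" using f_smooth by (rule smooth_map_on_continuous)
  obtain x0 where x0: "x0 \<in> K" "\<And>y. y \<in> K \<Longrightarrow> f x0 \<le> f y"
    using continuous_attains_inf[OF assms(1) False continuous_on_subset[OF f_cont]] by auto
  define d where "d = f x0"
  have d: "d > 0" using f_pos x0(1) D(3) unfolding d_def by blast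
  \<comment> \<open>The first summand of the denominator vanishes only for f \<le> d/3 and the
    second only for f \<ge> 2d/3, so the denominator is never 0; \<beta> is 0 below the first level
    and 1 above the second.\<close>
  define \<beta> where "\<beta> y = \<psi> (f y - d/3) / (\<psi> (f y - d/3) + \<psi> (2*d/3 - f y))" for y
  define C where "C = f -` {d/3..}"
  define N where "N = f -` {2*d/3<..}"
  have C_sub: "C \<subseteq> (\<Union>x\<in>D. cball x (r x))"
    using f_pos d ball_subset_cball unfolding C_def by fastforce
  show ?thesis
  proof (rule that[of \<beta> C N])
    show "smooth_map_on UNIV \<beta>"
      unfolding \<beta>_def
    proof (intro smooth_map_on_divide smooth_map_on_add \<psi>_smooth smooth_map_on_diff f_smooth
        smooth_map_on_const open_UNIV)
      fix y
      show "\<psi> (f y - d/3) + \<psi> (2*d/3 - f y) \<noteq> 0"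
        using \<psi>_nonneg[of "f y - d/3"] \<psi>_nonneg[of "2*d/3 - f y"] \<psi>_zero[of "f y - d/3"]
          \<psi>_zero[of "2*d/3 - f y"] d by (auto simp: add_nonneg_eq_0_iff)
    qed simp_all
    have "closed C" unfolding C_def by (intro closed_vimage f_cont) auto
    moreover have "bounded C"
      by (rule bounded_subset[OF _ C_sub]) (use D(2) in auto)
    ultimately show "compact C" by (simp add: compact_eq_bounded_closed)
    show "C \<subseteq> U" using C_sub r(2) D(1) by blast
    show "\<beta> x = 0" if "x \<notin> C" for x
    proof -
      have "\<psi> (f x - d/3) = 0" using that by (auto simp: C_def \<psi>_zero)
      then show ?thesis by (simp add: \<beta>_def)
    qed
    show "open N" unfolding N_def by (intro open_vimage f_cont) auto
    show "K \<subseteq> N" using x0(2) d unfolding N_def d_def by force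
    show "\<beta> x = 1" if "x \<in> N" for x
    proof -
      have "f x > 2*d/3" using that by (auto simp: N_def)
      then have "\<psi> (2*d/3 - f x) = 0" "\<psi> (f x - d/3) \<noteq> 0"
        using d by (auto simp: \<psi>_zero)
      then show ?thesis by (simp add: \<beta>_def)
    qed
  qed
qed

section \<open>Hadamard's lemma\<close>

text \<open>Differentiating under the integral sign in \<open>y\<close> produces one more factor t
  and a partial derivative of \<open>h\<close>. Admitting arbitrary powers of t makes the class of
  such integrals closed under differentiation, so that \<open>smooth_map_on_coinduct\<close>
  applies.\<close>

lemma smooth_radial_integral:
  fixes h :: "'a::euclidean_space \<Rightarrow> real"
  assumes h: "smooth_map_on (ball x r) h"
  shows "smooth_map_on (ball x r) (\<lambda>y. integral (cbox 0 1) (\<lambda>t. t ^ j * h (x + t *\<^sub>R (y - x))))"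
proof (rule smooth_map_on_coinduct[where Q = "\<lambda>f. \<exists>j h. smooth_map_on (ball x r) h \<and>
    f = (\<lambda>y. integral (cbox 0 1) (\<lambda>t. t ^ j * h (x + t *\<^sub>R (y - x))))"])
  fix f :: "'a \<Rightarrow> real"
  assume "\<exists>j h. smooth_map_on (ball x r) h \<and>
    f = (\<lambda>y. integral (cbox 0 1) (\<lambda>t. t ^ j * h (x + t *\<^sub>R (y - x))))"
  then obtain j h where h: "smooth_map_on (ball x r) h"
    and f: "f = (\<lambda>y. integral (cbox 0 1) (\<lambda>t. t ^ j * h (x + t *\<^sub>R (y - x))))" by blast
  have in_ball: "x + t *\<^sub>R (y - x) \<in> ball x r" if "y \<in> ball x r" "t \<in> cbox 0 1" for y and t :: real
  proof -
    have "norm (t *\<^sub>R (y - x)) \<le> norm (y - x)"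
      using that(2) by (simp add: mult_left_le_one_le)
    then show ?thesis using that(1) by (simp add: dist_norm norm_minus_commute)
  qed
  have cont: "continuous_on (ball x r \<times> cbox 0 1) (\<lambda>(y, t). k (x + t *\<^sub>R (y - x)))"
    if "smooth_map_on (ball x r) k" for k :: "'a \<Rightarrow> real"
    unfolding split_def
    by (rule continuous_on_compose2[OF smooth_map_on_continuous[OF that]])
      (use in_ball in \<open>auto intro!: continuous_intros\<close>)
  let ?d = "\<lambda>y t v. t ^ Suc j * frechet_derivative h (at (x + t *\<^sub>R (y - x))) v"
  have int: "(\<lambda>t. t ^ i * k (x + t *\<^sub>R (y - x))) integrable_on cbox 0 1"
    if "smooth_map_on (ball x r) k" "y \<in> ball x r" for k :: "'a \<Rightarrow> real" and y i
  proof (rule integrable_continuous)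
    have "continuous_on (cbox 0 1) (\<lambda>t. k (x + t *\<^sub>R (y - x)))"
      by (rule continuous_on_compose2[OF smooth_map_on_continuous[OF that(1)]])
        (use in_ball[OF that(2)] in \<open>auto intro!: continuous_intros\<close>)
    then show "continuous_on (cbox 0 1) (\<lambda>t. t ^ i * k (x + t *\<^sub>R (y - x)))"
      by (intro continuous_intros)
  qed
  have der: "((\<lambda>y. t ^ j * h (x + t *\<^sub>R (y - x))) has_derivative ?d y t) (at y)"
    if "y \<in> ball x r" "t \<in> cbox 0 1" for y t
  proof -
    have "((\<lambda>y. x + t *\<^sub>R (y - x)) has_derivative (\<lambda>v. t *\<^sub>R v)) (at y)"
      by (auto intro!: derivative_eq_intros)
    from diff_chain_at[OF this smooth_map_on_has_derivative[OF h in_ball[OF that]]]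
    have 1: "((\<lambda>y. h (x + t *\<^sub>R (y - x))) has_derivative
        (\<lambda>v. frechet_derivative h (at (x + t *\<^sub>R (y - x))) (t *\<^sub>R v))) (at y)"
      by (simp add: o_def)
    have "linear (frechet_derivative h (at (x + t *\<^sub>R (y - x))))"
      using linear_frechet_derivative smooth_map_on_differentiable[OF h in_ball[OF that]] by blast
    then show ?thesis
      using has_derivative_mult_right[OF 1, of "t ^ j"] by (simp add: linear_scale mult.assoc mult.left_commute)
  qed
  \<comment> \<open>The Leibniz rule is used with a derivative valued in the space of bounded linear
    maps.\<close>
  define fx where "fx y t = Blinfun (?d y t)" for y t
  have fx: "blinfun_apply (fx y t) = ?d y t" if "y \<in> ball x r" "t \<in> cbox 0 1" for y t
    unfolding fx_def
    by (rule bounded_linear_Blinfun_apply) (use der[OF that] has_derivative_bounded_linear in blast)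
  have fx_cont: "continuous_on (ball x r \<times> cbox 0 1) (\<lambda>(y, t). fx y t)"
  proof (rule continuous_on_blinfun_componentwise)
    fix b :: 'a
    have "continuous_on (ball x r \<times> cbox 0 1)
        (\<lambda>p. snd p ^ Suc j * (case p of (y, t) \<Rightarrow> frechet_derivative h (at (x + t *\<^sub>R (y - x))) b))"
      by (intro continuous_intros cont[OF smooth_map_on_deriv[OF h]])
    then show "continuous_on (ball x r \<times> cbox 0 1) (\<lambda>p. blinfun_apply (case p of (y, t) \<Rightarrow> fx y t) b)"
      by (rule continuous_on_eq) (auto simp: fx)
  qed
  have fx_int: "fx y integrable_on cbox 0 1" if "y \<in> ball x r" for y
  proof (rule integrable_continuous)
    show "continuous_on (cbox 0 1) (fx y)"
      using continuous_on_compose2[OF fx_cont, of "cbox 0 1" "\<lambda>t. (y, t)"] that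
      by (simp add: continuous_on_Pair image_subset_iff)
  qed
  have "(f has_derivative (\<lambda>v. integral (cbox 0 1) (\<lambda>t. ?d y t v))) (at y)" if y: "y \<in> ball x r" for y
  proof -
    have "(f has_derivative blinfun_apply (integral (cbox 0 1) (fx y))) (at y within ball x r)"
      unfolding f
    proof (rule leibniz_rule[OF _ _ fx_cont y convex_ball])
      fix z t assume "z \<in> ball x r" "t \<in> cbox (0::real) 1"
      then show "((\<lambda>y. t ^ j * h (x + t *\<^sub>R (y - x))) has_derivative blinfun_apply (fx z t))
          (at z within ball x r)"
        using der[of z t] fx[of z t] has_derivative_at_withinI by metis
    qed (rule int[OF h])
    moreover have "blinfun_apply (integral (cbox 0 1) (fx y)) v = integral (cbox 0 1) (\<lambda>t. ?d y t v)" for v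
      unfolding blinfun_apply_integral[OF fx_int[OF y]]
      by (rule integral_cong) (simp add: fx[OF y])
    ultimately show ?thesis
      using at_within_open[OF y open_ball] by (metis (no_types, lifting) ext)
  qed
  then show "\<exists>f'. (\<forall>y\<in>ball x r. (f has_derivative f' y) (at y)) \<and> (\<forall>v. \<exists>j h. smooth_map_on (ball x r) h \<and>
      (\<lambda>y. f' y v) = (\<lambda>y. integral (cbox 0 1) (\<lambda>t. t ^ j * h (x + t *\<^sub>R (y - x)))))"
    using smooth_map_on_deriv[OF h]
    by (intro exI[of _ "\<lambda>y v. integral (cbox 0 1) (\<lambda>t. ?d y t v)"]) blast
qed (use h in auto)

text \<open>The coefficient \<open>g b\<close> averages the partial derivative in direction
  \<open>b\<close> over the segment from \<open>x\<close> to \<open>y\<close>; the identity is the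
  fundamental theorem of calculus on that segment. It serves to identify derivations with coordinate
  vectors in \<open>tangent_chart\<close>.\<close>

lemma hadamard:
  fixes f :: "'a::euclidean_space \<Rightarrow> real"
  assumes f: "smooth_map_on (ball x r) f"
  obtains g where "\<And>b. smooth_map_on (ball x r) (g b)"
    "\<And>b. g b x = frechet_derivative f (at x) b"
    "\<And>y. y \<in> ball x r \<Longrightarrow> f y = f x + (\<Sum>b\<in>Basis. ((y - x) \<bullet> b) * g b y)"
proof -
  define g where "g b y = integral (cbox 0 1) (\<lambda>t. t ^ 0 * frechet_derivative f (at (x + t *\<^sub>R (y - x))) b)"
    for b y
  show ?thesis
  proof (rule that[of g])
    show "smooth_map_on (ball x r) (g b)" for b
      unfolding g_def by (rule smooth_radial_integral[OF smooth_map_on_deriv[OF f]])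
    show "g b x = frechet_derivative f (at x) b" for b
      by (simp add: g_def)
    fix y assume y: "y \<in> ball x r"
    have in_ball: "x + t *\<^sub>R (y - x) \<in> ball x r" if "t \<in> {0..1}" for t :: real
    proof -
      have "norm (t *\<^sub>R (y - x)) \<le> norm (y - x)"
        using that by (simp add: mult_left_le_one_le)
      then show ?thesis using y by (simp add: dist_norm norm_minus_commute)
    qed
    let ?D = "\<lambda>t b. frechet_derivative f (at (x + t *\<^sub>R (y - x))) b"
    have "((\<lambda>t. f (x + t *\<^sub>R (y - x))) has_vector_derivative ?D t (y - x)) (at t within {0..1})"
      if t: "t \<in> {0..1}" for t
    proof -
      have "((\<lambda>t. x + t *\<^sub>R (y - x)) has_vector_derivative (y - x)) (at t within {0..1})"
        by (auto intro!: derivative_eq_intros)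
      then show ?thesis
        using vector_derivative_diff_chain_within[of _ "y - x" t "{0..1}" f "?D t"]
          has_derivative_at_withinI[OF smooth_map_on_has_derivative[OF f in_ball[OF t]]]
        by (simp add: o_def)
    qed
    from fundamental_theorem_of_calculus[OF _ this]
    have 1: "((\<lambda>t. ?D t (y - x)) has_integral f y - f x) {0..1}"
      by simp
    have int: "(\<lambda>t. ?D t b) integrable_on {0..1}" for b
    proof -
      have "continuous_on {0..1} (\<lambda>t. ?D t b)"
        by (rule continuous_on_compose2[OF smooth_map_on_continuous[OF smooth_map_on_deriv[OF f]]])
          (use in_ball in \<open>auto intro!: continuous_intros\<close>)
      then show ?thesis by (rule integrable_continuous_real)
    qed
    have 2: "((\<lambda>t. \<Sum>b\<in>Basis. ((y - x) \<bullet> b) * ?D t b) has_integral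
        (\<Sum>b\<in>Basis. ((y - x) \<bullet> b) * integral {0..1} (\<lambda>t. ?D t b))) {0..1}"
      by (intro has_integral_sum has_integral_mult_right integrable_integral int) auto
    have "((\<lambda>t. ?D t (y - x)) has_integral
        (\<Sum>b\<in>Basis. ((y - x) \<bullet> b) * integral {0..1} (\<lambda>t. ?D t b))) {0..1}"
      by (rule has_integral_eq[OF _ 2])
        (metis frechet_derivative_basis smooth_map_on_differentiable[OF f in_ball])
    from has_integral_unique[OF 1 this]
    show "f y = f x + (\<Sum>b\<in>Basis. ((y - x) \<bullet> b) * g b y)"
      by (simp add: g_def)
  qed
qed


section \<open>Linear systems with smooth coefficients\<close>

text \<open>Gaussian elimination with smooth coefficients. Unknowns are indexed by \<open>R\<close>
  and equations by \<open>C\<close>; the neighbourhood shrinks at each step to the set where the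
  pivot is nonzero. Injectivity is required at \<open>y0\<close> only.\<close>

lemma smooth_linear_system:
  fixes M :: "'i \<Rightarrow> 'j \<Rightarrow> 'a::euclidean_space \<Rightarrow> real"
  assumes "finite R" "finite C" "card R = card C" "open N" "y0 \<in> N"
    and "\<And>i j. i \<in> R \<Longrightarrow> j \<in> C \<Longrightarrow> smooth_map_on N (M i j)"
    and "\<And>j. j \<in> C \<Longrightarrow> smooth_map_on N (b j)"
    and "\<And>a. (\<And>j. j \<in> C \<Longrightarrow> (\<Sum>i\<in>R. a i * M i j y0) = 0) \<Longrightarrow> \<forall>i\<in>R. a i = 0"
  shows "\<exists>N' x. open N' \<and> y0 \<in> N' \<and> N' \<subseteq> N \<and> (\<forall>i\<in>R. smooth_map_on N' (x i)) \<and>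
    (\<forall>y\<in>N'. \<forall>j\<in>C. (\<Sum>i\<in>R. x i y * M i j y) = b j y)"
  using assms
proof (induction R arbitrary: C N M b rule: finite_induct)
  case empty
  then show ?case by (intro exI[of _ N]) auto
next
  case (insert r R)
  note S = smooth_map_on_subset
  have "\<exists>c\<in>C. M r c y0 \<noteq> 0"
  proof (rule ccontr)
    \<comment> \<open>Without a pivot in row \<open>r\<close>, the unit vector at \<open>r\<close>
      would be a nonzero null vector at \<open>y0\<close>.\<close>
    assume "\<not> ?thesis"
    then have "(\<Sum>i\<in>insert r R. (if i = r then 1 else 0) * M i j y0) = 0" if "j \<in> C" for j
      using that insert.hyps by (intro sum.neutral) auto
    from insert.prems(7)[of "\<lambda>i. if i = r then 1 else 0", OF this] show False by simp
  qed
  then obtain c where c: "c \<in> C" "M r c y0 \<noteq> 0" by blast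
  have Mrc: "smooth_map_on N (M r c)" using insert.prems(5) c by simp
  define N1 where "N1 = {y \<in> N. M r c y \<noteq> 0}"
  have "open N1"
    unfolding N1_def using continuous_open_preimage[OF smooth_map_on_continuous[OF Mrc] insert.prems(3), of "- {0}"]
    by (simp add: vimage_def Int_def open_Compl)
  have N1: "y0 \<in> N1" "N1 \<subseteq> N" using c insert.prems(4) by (auto simp: N1_def)
  \<comment> \<open>Equation \<open>c\<close> is solved for the unknown \<open>r\<close> and
    substituted into the remaining equations.\<close>
  define M' where "M' i j y = M i j y - M i c y * M r j y / M r c y" for i j y
  define b' where "b' j y = b j y - b c y * M r j y / M r c y" for j y
  have "\<exists>N' x. open N' \<and> y0 \<in> N' \<and> N' \<subseteq> N1 \<and> (\<forall>i\<in>R. smooth_map_on N' (x i)) \<and>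
    (\<forall>y\<in>N'. \<forall>j\<in>C - {c}. (\<Sum>i\<in>R. x i y * M' i j y) = b' j y)"
  proof (rule insert.IH[OF _ _ \<open>open N1\<close> N1(1)])
    show "finite (C - {c})" "card R = card (C - {c})"
      using insert c by auto
    show "smooth_map_on N1 (M' i j)" if "i \<in> R" "j \<in> C - {c}" for i j
      unfolding M'_def using that c
      by (intro smooth_map_on_diff smooth_map_on_divide smooth_map_on_mult S[OF insert.prems(5) N1(2)]
          \<open>open N1\<close>) (auto simp: N1_def)
    show "smooth_map_on N1 (b' j)" if "j \<in> C - {c}" for j
      unfolding b'_def using that c
      by (intro smooth_map_on_diff smooth_map_on_divide smooth_map_on_mult S[OF insert.prems(5) N1(2)]
          S[OF insert.prems(6) N1(2)] \<open>open N1\<close>) (auto simp: N1_def)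
    fix a assume a: "\<And>j. j \<in> C - {c} \<Longrightarrow> (\<Sum>i\<in>R. a i * M' i j y0) = 0"
    \<comment> \<open>The value for the unknown \<open>r\<close> that equation \<open>c\<close>
      forces; it extends a null vector of the reduced system to one of the full system.\<close>
    define t where "t = - (\<Sum>i\<in>R. a i * M i c y0) / M r c y0"
    have *: "(\<Sum>i\<in>insert r R. (if i = r then t else a i) * M i j y0) = (\<Sum>i\<in>R. a i * M i j y0) + t * M r j y0"
      for j
    proof -
      have "(\<Sum>i\<in>R. (if i = r then t else a i) * M i j y0) = (\<Sum>i\<in>R. a i * M i j y0)"
        by (rule sum.cong) (use insert.hyps in auto)
      then show ?thesis using insert.hyps by simp
    qed
    have "(\<Sum>i\<in>R. a i * M' i j y0) = (\<Sum>i\<in>R. a i * M i j y0) + t * M r j y0" for j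
      by (simp add: M'_def t_def right_diff_distrib sum_subtractf sum_distrib_right sum_divide_distrib
          mult.assoc)
    then have "(\<Sum>i\<in>insert r R. (if i = r then t else a i) * M i j y0) = 0" if "j \<in> C" for j
      using * a[of j] that c by (cases "j = c") (auto simp: t_def)
    from insert.prems(7)[of "\<lambda>i. if i = r then t else a i", OF this]
    show "\<forall>i\<in>R. a i = 0" using insert.hyps by (metis insert_iff)
  qed
  then obtain N' x where N': "open N'" "y0 \<in> N'" "N' \<subseteq> N1" and x: "\<forall>i\<in>R. smooth_map_on N' (x i)"
    and sol: "\<forall>y\<in>N'. \<forall>j\<in>C - {c}. (\<Sum>i\<in>R. x i y * M' i j y) = b' j y" by blast
  have N'N: "N' \<subseteq> N" using N' N1 by blast
  define z where "z y = (b c y - (\<Sum>i\<in>R. x i y * M i c y)) / M r c y" for y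
  have "smooth_map_on N' z"
    unfolding z_def using c x N'(3)
    by (intro smooth_map_on_diff smooth_map_on_divide smooth_map_on_mult smooth_map_on_sum insert.hyps(1)
        S[OF insert.prems(5) N'N] S[OF insert.prems(6) N'N] \<open>open N'\<close>) (auto simp: N1_def)
  then have sm: "\<forall>i\<in>insert r R. smooth_map_on N' (if i = r then z else x i)"
    using x by auto
  have eq: "(\<Sum>i\<in>insert r R. (if i = r then z else x i) y * M i j y) = b j y" if "y \<in> N'" "j \<in> C" for y j
  proof -
    have nz: "M r c y \<noteq> 0" using that N' by (auto simp: N1_def)
    have "(\<Sum>i\<in>R. (if i = r then z else x i) y * M i j y) = (\<Sum>i\<in>R. x i y * M i j y)"
      by (rule sum.cong) (use insert.hyps in auto)
    then have 1: "(\<Sum>i\<in>insert r R. (if i = r then z else x i) y * M i j y) = z y * M r j y + (\<Sum>i\<in>R. x i y * M i j y)"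
      using insert.hyps by simp
    have 2: "(\<Sum>i\<in>R. x i y * M' i j y) = (\<Sum>i\<in>R. x i y * M i j y) - (\<Sum>i\<in>R. x i y * M i c y) * M r j y / M r c y"
      by (simp add: M'_def right_diff_distrib sum_subtractf sum_distrib_right sum_divide_distrib mult.assoc)
    show ?thesis
    proof (cases "j = c")
      case True
      then show ?thesis using 1 nz by (simp add: z_def)
    next
      case False
      then have "(\<Sum>i\<in>R. x i y * M' i j y) = b' j y" using sol that by blast
      then show ?thesis using 1 2 nz by (simp add: z_def b'_def field_simps)
    qed
  qed
  show ?case
    using N' N'N sm eq by (intro exI[of _ N'] exI[of _ "\<lambda>i. if i = r then z else x i"]) blast
qed

section \<open>Polynomials with smooth coefficients\<close>

text \<open>The variables \<open>a j\<close> stand for the partial derivatives of a Hamiltonian, indexed by lists of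
  directions, or for the derivatives of a polynomial in one variable, indexed by their order.\<close>

inductive jetpoly :: "'a::euclidean_space set \<Rightarrow> 'j set \<Rightarrow> (('j \<Rightarrow> real) \<Rightarrow> 'a \<Rightarrow> real) \<Rightarrow> bool"
  for U V where
  coeff: "smooth_map_on U f \<Longrightarrow> jetpoly U V (\<lambda>a x. f x)"
| var: "j \<in> V \<Longrightarrow> jetpoly U V (\<lambda>a x. a j)"
| add: "jetpoly U V G \<Longrightarrow> jetpoly U V H \<Longrightarrow> jetpoly U V (\<lambda>a x. G a x + H a x)"
| mult: "jetpoly U V G \<Longrightarrow> jetpoly U V H \<Longrightarrow> jetpoly U V (\<lambda>a x. G a x * H a x)"

lemma jetpoly_mono:
  assumes "jetpoly U V G" "V \<subseteq> V'"
  shows "jetpoly U V' G"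
  using assms by induction (auto intro: jetpoly.intros)

lemma jetpoly_sum:
  "finite I \<Longrightarrow> (\<And>i. i \<in> I \<Longrightarrow> jetpoly U V (G i)) \<Longrightarrow> jetpoly U V (\<lambda>a x. \<Sum>i\<in>I. G i a x)"
proof (induction I rule: finite_induct)
  case empty
  show ?case using jetpoly.coeff[OF smooth_map_on_const[of U 0]] by simp
qed (auto intro: jetpoly.add)

lemma jetpoly_cong:
  assumes "jetpoly U V G" "\<And>j. j \<in> V \<Longrightarrow> a j = a' j"
  shows "G a x = G a' x"
  using assms by induction auto

lemma jetpoly_smooth:
  assumes "jetpoly U V G" "open U'" "U' \<subseteq> U" "\<And>j. j \<in> V \<Longrightarrow> smooth_map_on U' (\<alpha> j)"
  shows "smooth_map_on U' (\<lambda>x. G (\<lambda>j. \<alpha> j x) x)"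
  using assms
  by induction (auto intro: smooth_map_on_subset smooth_map_on_add smooth_map_on_mult)

lemma jetpoly_tendsto:
  assumes "jetpoly U V G" "open U" "x \<in> U" "X \<longlonglongrightarrow> x"
    and "\<And>j. j \<in> V \<Longrightarrow> (\<lambda>n. a n j) \<longlonglongrightarrow> a' j"
  shows "(\<lambda>n. G (a n) (X n)) \<longlonglongrightarrow> G a' x"
  using assms
proof induction
  case (coeff f)
  then have "isCont f x"
    using smooth_map_on_continuous continuous_on_eq_continuous_at by blast
  then show ?case using coeff isCont_tendsto_compose by blast
qed (auto intro: tendsto_add tendsto_mult)

text \<open>The derivative polynomial \<open>G'\<close> is chosen before the member \<open>i\<close>
  of the family, so one formula serves all Hamiltonians, or all polynomials \<open>q\<close>, at
  once. \<open>Y j\<close> expresses the derivative of the variable \<open>j\<close> through the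
  larger set of variables.\<close>

lemma jetpoly_deriv:
  fixes X :: "'i \<Rightarrow> 'j \<Rightarrow> 'a::euclidean_space \<Rightarrow> real"
  assumes "jetpoly U V G" "open U" "V \<subseteq> V'"
    and X: "\<And>i j. i \<in> I \<Longrightarrow> j \<in> V \<Longrightarrow> smooth_map_on U (X i j)"
    and Y: "\<And>j. j \<in> V \<Longrightarrow> jetpoly U V' (Y j)"
    and XY: "\<And>i j x. i \<in> I \<Longrightarrow> j \<in> V \<Longrightarrow> x \<in> U \<Longrightarrow>
      frechet_derivative (X i j) (at x) b = Y j (\<lambda>j. X i j x) x"
  shows "\<exists>G'. jetpoly U V' G' \<and> (\<forall>i\<in>I. \<forall>x\<in>U.
    frechet_derivative (\<lambda>x. G (\<lambda>j. X i j x) x) (at x) b = G' (\<lambda>j. X i j x) x)"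
  using assms(1)
proof induction
  case (coeff f)
  then show ?case using jetpoly.coeff[OF smooth_map_on_deriv[OF coeff]] by blast
next
  case (var j)
  then show ?case using Y XY by blast
next
  case (add G H)
  then obtain G' H' where GH: "jetpoly U V' G'" "jetpoly U V' H'"
    "\<forall>i\<in>I. \<forall>x\<in>U. frechet_derivative (\<lambda>x. G (\<lambda>j. X i j x) x) (at x) b = G' (\<lambda>j. X i j x) x"
    "\<forall>i\<in>I. \<forall>x\<in>U. frechet_derivative (\<lambda>x. H (\<lambda>j. X i j x) x) (at x) b = H' (\<lambda>j. X i j x) x"
    by blast
  have "frechet_derivative (\<lambda>x. G (\<lambda>j. X i j x) x + H (\<lambda>j. X i j x) x) (at x) b
      = G' (\<lambda>j. X i j x) x + H' (\<lambda>j. X i j x) x" if "i \<in> I" "x \<in> U" for i x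
    using GH that X
      smooth_map_on_differentiable[OF jetpoly_smooth[OF add.hyps(1) assms(2) order_refl, of "X i"]]
      smooth_map_on_differentiable[OF jetpoly_smooth[OF add.hyps(2) assms(2) order_refl, of "X i"]]
    by (subst frechet_derivative_add) auto
  then show ?case
    using jetpoly.add[OF GH(1,2)] by (intro exI[of _ "\<lambda>a x. G' a x + H' a x"]) blast
next
  case (mult G H)
  then obtain G' H' where GH: "jetpoly U V' G'" "jetpoly U V' H'"
    "\<forall>i\<in>I. \<forall>x\<in>U. frechet_derivative (\<lambda>x. G (\<lambda>j. X i j x) x) (at x) b = G' (\<lambda>j. X i j x) x"
    "\<forall>i\<in>I. \<forall>x\<in>U. frechet_derivative (\<lambda>x. H (\<lambda>j. X i j x) x) (at x) b = H' (\<lambda>j. X i j x) x"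
    by blast
  have "frechet_derivative (\<lambda>x. G (\<lambda>j. X i j x) x * H (\<lambda>j. X i j x) x) (at x) b
      = G (\<lambda>j. X i j x) x * H' (\<lambda>j. X i j x) x + G' (\<lambda>j. X i j x) x * H (\<lambda>j. X i j x) x"
    if "i \<in> I" "x \<in> U" for i x
    using GH that X
      smooth_map_on_differentiable[OF jetpoly_smooth[OF mult.hyps(1) assms(2) order_refl, of "X i"]]
      smooth_map_on_differentiable[OF jetpoly_smooth[OF mult.hyps(2) assms(2) order_refl, of "X i"]]
    by (subst frechet_derivative_mult) auto
  moreover have "jetpoly U V' (\<lambda>a x. G a x * H' a x + G' a x * H a x)"
    using GH mult.hyps jetpoly_mono[OF _ assms(3)] by (intro jetpoly.intros) auto
  ultimately show ?case
    by (intro exI[of _ "\<lambda>a x. G a x * H' a x + G' a x * H a x"]) blast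
qed


section \<open>Taylor expansion of real polynomials\<close>

text \<open>Taylor's theorem of order N + 1, whose remainder contains the vanishing derivative of
  that order. The theorem needs distinct points, hence the separate case
  \<open>u = s\<close>.\<close>

lemma poly_taylor:
  fixes p :: "real poly"
  assumes "degree p \<le> N"
  shows "poly p u = (\<Sum>k\<le>N. poly ((pderiv ^^ k) p) s * (u - s) ^ k / fact k)"
proof (cases "u = s")
  case True
  have "(\<Sum>k\<le>N. poly ((pderiv ^^ k) p) s * (u - s) ^ k / fact k)
      = (\<Sum>k\<le>N. if k = 0 then poly p s else 0)"
    by (rule sum.cong) (use True in auto)
  then show ?thesis using True by simp
next
  case False
  have zero: "(pderiv ^^ Suc N) p = 0"
  proof (rule poly_eqI)
    fix n
    show "coeff ((pderiv ^^ Suc N) p) n = coeff 0 n"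
      unfolding coeff_higher_pderiv using assms coeff_eq_0[of p "n + Suc N"] by simp
  qed
  have "\<exists>t. (if u < s then u < t \<and> t < s else s < t \<and> t < u) \<and>
    poly p u = (\<Sum>m<Suc N. (poly ((pderiv ^^ m) p) s / fact m) * (u - s) ^ m)
      + (poly ((pderiv ^^ Suc N) p) t / fact (Suc N)) * (u - s) ^ Suc N"
    by (rule Taylor[where a = "min u s" and b = "max u s"
          and diff = "\<lambda>m. poly ((pderiv ^^ m) p)"]) (use False in auto)
  then show ?thesis
    unfolding zero by (auto simp: lessThan_Suc_atMost intro!: sum.cong)
qed

text \<open>Expands the j-th derivative of \<open>q\<close> at \<open>s\<close> and evaluates at 0.
  This recovers the coefficients of \<open>q\<close> from its derivatives at the single point
  \<open>s\<close>.\<close>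

lemma fact_coeff_eq_taylor:
  fixes q :: "real poly"
  assumes "degree q \<le> N"
  shows "fact j * coeff q j = (\<Sum>k\<le>N - j. poly ((pderiv ^^ (k + j)) q) s * (- s) ^ k / fact k)"
proof -
  have "poly ((pderiv ^^ j) q) 0 = fact j * coeff q j"
    by (simp add: poly_0_coeff_0 coeff_higher_pderiv pochhammer_fact)
  moreover have "degree ((pderiv ^^ j) q) \<le> N - j"
    using assms by (simp add: degree_higher_pderiv)
  ultimately show ?thesis
    using poly_taylor[of "(pderiv ^^ j) q" "N - j" 0 s] by (simp add: funpow_add)
qed

section \<open>Iterated Hamiltonian derivatives in a chart\<close>

definition grad :: "('a::euclidean_space \<Rightarrow> real) \<Rightarrow> 'a \<Rightarrow> 'a" where
  "grad f x = (\<Sum>b\<in>Basis. frechet_derivative f (at x) b *\<^sub>R b)"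

lemma grad_inner_Basis: "b \<in> Basis \<Longrightarrow> grad f x \<bullet> b = frechet_derivative f (at x) b"
  by (simp add: grad_def)

lemma grad_inner: "f differentiable (at x) \<Longrightarrow> grad f x \<bullet> v = frechet_derivative f (at x) v"
  using frechet_derivative_basis[of f x v]
  by (simp add: grad_def inner_sum_left inner_commute[of v] mult.commute)

lemma grad_eqI:
  assumes "(f has_derivative (\<lambda>v. a \<bullet> v)) (at x)"
  shows "grad f x = a"
  by (simp add: grad_def frechet_derivative_at[OF assms, symmetric] euclidean_representation)

lemma grad_linear: "grad (\<lambda>x. x \<bullet> l) x = l"
  by (rule grad_eqI) (auto intro!: derivative_eq_intros simp: inner_commute)

lemma grad_cong:
  assumes "open N" "smooth_map_on N f" "\<And>x. x \<in> N \<Longrightarrow> f x = g x" "x \<in> N"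
  shows "grad f x = grad g x"
  using frechet_derivative_cong[OF assms(1,2,3,4)] by (simp add: grad_def)

locale local_poisson =
  fixes U :: "'a::euclidean_space set" and J :: "'a \<Rightarrow> 'a \<Rightarrow> 'a \<Rightarrow> real"
  assumes open_U: "open U"
    and J_smooth: "\<And>i j. i \<in> Basis \<Longrightarrow> j \<in> Basis \<Longrightarrow> smooth_map_on U (J i j)"
    and J_alternating: "\<And>x a. x \<in> U \<Longrightarrow> (\<Sum>i\<in>Basis. \<Sum>j\<in>Basis. J i j x * (a \<bullet> i) * (a \<bullet> j)) = 0"
    and J_nondegenerate:
      "\<And>x a. x \<in> U \<Longrightarrow> (\<And>j. j \<in> Basis \<Longrightarrow> (\<Sum>i\<in>Basis. J i j x * (a \<bullet> i)) = 0) \<Longrightarrow> a = 0"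
begin

definition form :: "'a \<Rightarrow> 'a \<Rightarrow> 'a \<Rightarrow> real" where
  "form x a b = (\<Sum>i\<in>Basis. \<Sum>j\<in>Basis. J i j x * (a \<bullet> i) * (b \<bullet> j))"

text \<open>The Poisson bracket up to sign convention: the derivative of \<open>f\<close> along the
  Hamiltonian vector field of \<open>h\<close>.\<close>

definition ham :: "('a \<Rightarrow> real) \<Rightarrow> ('a \<Rightarrow> real) \<Rightarrow> 'a \<Rightarrow> real" where
  "ham h f x = form x (grad h x) (grad f x)"

lemma form_add_left: "form x (a + a') b = form x a b + form x a' b"
  and form_add_right: "form x a (b + b') = form x a b + form x a b'"
  and form_scale_left: "form x (r *\<^sub>R a) b = r * form x a b"
  and form_scale_right: "form x a (r *\<^sub>R b) = r * form x a b"
  by (simp_all add: form_def inner_add_left algebra_simps sum.distrib sum_distrib_left)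

lemma form_self: "x \<in> U \<Longrightarrow> form x a a = 0"
  using J_alternating by (simp add: form_def)

lemma form_skew: "x \<in> U \<Longrightarrow> form x a b = - form x b a"
  using form_self[of x "a + b"] form_self[of x a] form_self[of x b]
  by (simp add: form_add_left form_add_right)

lemma form_left_vector: "form x a b = (\<Sum>j\<in>Basis. (\<Sum>i\<in>Basis. J i j x * (a \<bullet> i)) *\<^sub>R j) \<bullet> b"
  unfolding form_def
  by (subst sum.swap) (simp add: inner_sum_left sum_distrib_right inner_commute[of b])

lemma form_nondegenerate:
  assumes "x \<in> U" "a \<noteq> 0"
  obtains w where "w \<noteq> 0" "\<And>b. form x a b = w \<bullet> b"
proof -
  let ?w = "\<Sum>j\<in>Basis. (\<Sum>i\<in>Basis. J i j x * (a \<bullet> i)) *\<^sub>R j"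
  have "?w \<noteq> 0"
  proof
    assume "?w = 0"
    have "?w \<bullet> j = (\<Sum>i\<in>Basis. J i j x * (a \<bullet> i))" if "j \<in> Basis" for j
      using that by simp
    then show False using J_nondegenerate[OF assms(1), of a] assms(2) \<open>?w = 0\<close> by simp
  qed
  then show ?thesis using that form_left_vector by blast
qed

lemma ham_alt: "ham h f x = (\<Sum>i\<in>Basis. \<Sum>j\<in>Basis.
    J i j x * frechet_derivative h (at x) i * frechet_derivative f (at x) j)"
  by (simp add: ham_def form_def grad_inner_Basis)

lemma ham_smooth:
  "smooth_map_on U h \<Longrightarrow> smooth_map_on U f \<Longrightarrow> smooth_map_on U (ham h f)"
  unfolding ham_alt[abs_def]
  by (intro smooth_map_on_sum smooth_map_on_mult open_U J_smooth smooth_map_on_deriv) auto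

lemma ham_funpow_smooth:
  "smooth_map_on U h \<Longrightarrow> smooth_map_on U f \<Longrightarrow> smooth_map_on U ((ham h ^^ n) f)"
  by (induction n) (auto intro: ham_smooth)

lemma ham_cong:
  assumes "open N" "smooth_map_on N h" "smooth_map_on N f" "x \<in> N"
    and "\<And>x. x \<in> N \<Longrightarrow> h x = h' x" "\<And>x. x \<in> N \<Longrightarrow> f x = f' x"
  shows "ham h f x = ham h' f' x"
  unfolding ham_def using grad_cong[OF assms(1,2,5,4)] grad_cong[OF assms(1,3,6,4)] by simp

lemma ham_funpow_cong:
  assumes "open N" "N \<subseteq> U" "smooth_map_on U h" "smooth_map_on U f" "x \<in> N"
    and "\<And>x. x \<in> N \<Longrightarrow> h x = h' x"
  shows "(ham h ^^ n) f x = (ham h' ^^ n) f x"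
  using assms(5)
proof (induction n arbitrary: x)
  case (Suc n)
  show ?case
    using ham_cong[OF assms(1) _ _ Suc.prems assms(6), where f = "(ham h ^^ n) f" and f' = "(ham h' ^^ n) f"] Suc.IH
      smooth_map_on_subset[OF assms(3,2)]
      smooth_map_on_subset[OF ham_funpow_smooth[OF assms(3,4), of n] assms(2)]
    by simp
qed simp

lemma ham_add:
  assumes "smooth_map_on U f" "smooth_map_on U g" "x \<in> U"
  shows "ham h (\<lambda>x. f x + g x) x = ham h f x + ham h g x"
  unfolding ham_alt
  using smooth_map_on_differentiable[OF assms(1,3)] smooth_map_on_differentiable[OF assms(2,3)]
  by (simp add: frechet_derivative_add algebra_simps sum.distrib)

lemma ham_mult:
  assumes "smooth_map_on U f" "smooth_map_on U g" "x \<in> U"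
  shows "ham h (\<lambda>x. f x * g x) x = f x * ham h g x + ham h f x * g x"
  unfolding ham_alt
  using smooth_map_on_differentiable[OF assms(1,3)] smooth_map_on_differentiable[OF assms(2,3)]
  by (simp add: frechet_derivative_mult algebra_simps sum.distrib sum_distrib_left)

text \<open>Each further bracket with \<open>h\<close> takes one more derivative of the previous
  expression and multiplies by first derivatives of \<open>h\<close>. As \<open>G\<close> does not
  depend on \<open>h\<close>, the iterates are continuous in \<open>h\<close> for convergence of the
  derivatives up to order \<open>n\<close>.\<close>

lemma ham_funpow_jetpoly:
  assumes f: "smooth_map_on U f"
  shows "\<exists>G. jetpoly U {vs. set vs \<subseteq> Basis \<and> length vs \<le> n} G \<and>
    (\<forall>h\<in>Collect (smooth_map_on U). \<forall>x\<in>U. (ham h ^^ n) f x = G (\<lambda>vs. iterated_deriv vs h x) x)"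
proof (induction n)
  case 0
  show ?case using jetpoly.coeff[OF f] by (intro exI[of _ "\<lambda>a. f"]) simp
next
  case (Suc n)
  let ?V = "\<lambda>n. {vs. set vs \<subseteq> Basis \<and> length vs \<le> n} :: 'a list set"
  obtain G where G: "jetpoly U (?V n) G"
    "\<forall>h\<in>Collect (smooth_map_on U). \<forall>x\<in>U. (ham h ^^ n) f x = G (\<lambda>vs. iterated_deriv vs h x) x"
    using Suc.IH by blast
  have "\<forall>b\<in>Basis. \<exists>G'. jetpoly U (?V (Suc n)) G' \<and> (\<forall>h\<in>Collect (smooth_map_on U). \<forall>x\<in>U.
    frechet_derivative (\<lambda>x. G (\<lambda>j. iterated_deriv j h x) x) (at x) b = G' (\<lambda>j. iterated_deriv j h x) x)"
  proof
    fix b :: 'a assume b: "b \<in> Basis"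
    show "\<exists>G'. jetpoly U (?V (Suc n)) G' \<and> (\<forall>h\<in>Collect (smooth_map_on U). \<forall>x\<in>U.
      frechet_derivative (\<lambda>x. G (\<lambda>j. iterated_deriv j h x) x) (at x) b = G' (\<lambda>j. iterated_deriv j h x) x)"
      \<comment> \<open>In \<open>iterated_deriv\<close> the head of the list is differentiated
        last, so one more derivative in direction \<open>b\<close> turns the variable
        \<open>vs\<close> into \<open>b # vs\<close>.\<close>
      by (rule jetpoly_deriv[OF G(1) open_U, where X = "\<lambda>h vs. iterated_deriv vs h"
            and Y = "\<lambda>vs a x. a (b # vs)"])
        (use b in \<open>auto intro!: jetpoly.var smooth_map_on_iterated_deriv\<close>)
  qed
  from bchoice[OF this] obtain G' where "\<forall>b\<in>Basis. jetpoly U (?V (Suc n)) (G' b) \<and>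
    (\<forall>h\<in>Collect (smooth_map_on U). \<forall>x\<in>U. frechet_derivative (\<lambda>x. G (\<lambda>j. iterated_deriv j h x) x) (at x) b
      = G' b (\<lambda>j. iterated_deriv j h x) x)" ..
  then have G': "\<And>b. b \<in> Basis \<Longrightarrow> jetpoly U (?V (Suc n)) (G' b)"
    "\<And>b h x. b \<in> Basis \<Longrightarrow> smooth_map_on U h \<Longrightarrow> x \<in> U \<Longrightarrow>
      frechet_derivative (\<lambda>x. G (\<lambda>j. iterated_deriv j h x) x) (at x) b = G' b (\<lambda>j. iterated_deriv j h x) x"
    by blast+
  let ?G = "\<lambda>a x. \<Sum>i\<in>Basis. \<Sum>j\<in>Basis. J i j x * a [i] * G' j a x"
  have "jetpoly U (?V (Suc n)) ?G"
    by (intro jetpoly_sum jetpoly.mult G'(1) jetpoly.coeff J_smooth jetpoly.var) auto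
  moreover have "(ham h ^^ Suc n) f x = ?G (\<lambda>vs. iterated_deriv vs h x) x"
    if h: "smooth_map_on U h" and x: "x \<in> U" for h x
  proof -
    have "ham h ((ham h ^^ n) f) x = ham h (\<lambda>x. G (\<lambda>j. iterated_deriv j h x) x) x"
      by (rule ham_cong[OF open_U h ham_funpow_smooth[OF h f] x refl]) (use G(2) h in auto)
    then show ?thesis using G'(2)[OF _ h x] by (simp add: ham_alt)
  qed
  ultimately show ?case by (intro exI[of _ ?G]) blast
qed

text \<open>Joint continuity in the Hamiltonian and the point; it makes the vanishing of the
  iterates a closed condition.\<close>

lemma ham_funpow_tendsto:
  assumes f: "smooth_map_on U f" and h: "smooth_map_on U h" "\<And>i. smooth_map_on U (H i)"
    and x: "x \<in> U" "\<And>i. X i \<in> U" "X \<longlonglongrightarrow> x"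
    and conv: "\<And>vs. set vs \<subseteq> Basis \<Longrightarrow> length vs \<le> n \<Longrightarrow>
      (\<lambda>i. iterated_deriv vs (H i) (X i)) \<longlonglongrightarrow> iterated_deriv vs h x"
  shows "(\<lambda>i. (ham (H i) ^^ n) f (X i)) \<longlonglongrightarrow> (ham h ^^ n) f x"
proof -
  obtain G where G: "jetpoly U {vs. set vs \<subseteq> Basis \<and> length vs \<le> n} G"
    "\<forall>h\<in>Collect (smooth_map_on U). \<forall>x\<in>U. (ham h ^^ n) f x = G (\<lambda>vs. iterated_deriv vs h x) x"
    using ham_funpow_jetpoly[OF f] by blast
  have "(\<lambda>i. G (\<lambda>vs. iterated_deriv vs (H i) (X i)) (X i)) \<longlonglongrightarrow> G (\<lambda>vs. iterated_deriv vs h x) x"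
    using conv by (intro jetpoly_tendsto[OF G(1) open_U x(1,3)]) auto
  then show ?thesis using G(2) h x by simp
qed

end

section \<open>Polynomial perturbations along a linear function\<close>

locale ridge_perturbation = local_poisson +
  fixes l :: 'a and h f :: "'a \<Rightarrow> real"
  assumes h_smooth: "smooth_map_on U h" and f_smooth: "smooth_map_on U f"
begin

definition jet :: "real poly \<Rightarrow> nat \<Rightarrow> 'a \<Rightarrow> real" where
  "jet q k x = poly ((pderiv ^^ k) q) (x \<bullet> l)"

definition perturbed :: "real poly \<Rightarrow> 'a \<Rightarrow> real" where
  "perturbed q x = h x + jet q 0 x"

lemma jet_has_derivative: "(jet q k has_derivative (\<lambda>v. jet q (Suc k) x * (v \<bullet> l))) (at x)"
  unfolding jet_def
  by (auto intro!: derivative_eq_intros has_derivative_compose[OF _ poly_DERIV[unfolded has_field_derivative_def]])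

lemma jet_smooth: "smooth_map_on S (jet q k)"
proof (rule smooth_map_on_subset)
  show "smooth_map_on UNIV (jet q k)"
  proof (rule smooth_map_on_coinduct[where Q = "\<lambda>f. \<exists>c q k. f = (\<lambda>x. jet q k x * c)"])
    show "\<exists>c q' k'. jet q k = (\<lambda>x. jet q' k' x * c)"
      by (intro exI[of _ 1] exI[of _ q] exI[of _ k]) simp
    fix f :: "'a \<Rightarrow> real" assume "\<exists>c q k. f = (\<lambda>x. jet q k x * c)"
    then obtain c q k where f: "f = (\<lambda>x. jet q k x * c)" by blast
    have "(f has_derivative (\<lambda>v. jet q (Suc k) x * ((v \<bullet> l) * c))) (at x)" for x
      unfolding f using has_derivative_mult_left[OF jet_has_derivative] by (simp add: mult.assoc)
    then show "\<exists>f'. (\<forall>x\<in>UNIV. (f has_derivative f' x) (at x)) \<and> (\<forall>v. \<exists>c q k. (\<lambda>x. f' x v) = (\<lambda>x. jet q k x * c))"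
      by (intro exI[of _ "\<lambda>x v. jet q (Suc k) x * ((v \<bullet> l) * c)"]) blast
  qed simp
qed simp

lemma perturbed_smooth: "smooth_map_on U (perturbed q)"
  unfolding perturbed_def by (intro smooth_map_on_add open_U h_smooth jet_smooth)

lemma grad_jet: "grad (jet q k) x = jet q (Suc k) x *\<^sub>R l"
  using jet_has_derivative by (intro grad_eqI) (simp add: inner_commute)

lemma grad_perturbed:
  assumes "x \<in> U"
  shows "grad (perturbed q) x = grad h x + jet q 1 x *\<^sub>R l"
proof (rule grad_eqI)
  have "(h has_derivative (\<lambda>v. grad h x \<bullet> v)) (at x)"
    using smooth_map_on_has_derivative[OF h_smooth assms] grad_inner[OF smooth_map_on_differentiable[OF h_smooth assms]]
    by presburger
  from has_derivative_add[OF this jet_has_derivative[of q 0]]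
  show "(perturbed q has_derivative (\<bullet>) (grad h x + jet q 1 x *\<^sub>R l)) (at x)"
    unfolding perturbed_def[abs_def]
    by (rule has_derivative_eq_rhs) (simp add: fun_eq_iff inner_add_left inner_commute[of l])
qed

text \<open>\<open>speed\<close> is the rate of change of the linear function \<open>l\<close> along
  the field of \<open>h\<close>. \<open>slope\<close> is the amount by which the first equation
  changes per unit of q'.\<close>

abbreviation "speed \<equiv> ham h (\<lambda>x. x \<bullet> l)"
abbreviation "slope \<equiv> ham (\<lambda>x. x \<bullet> l) f"

lemma speed_smooth: "smooth_map_on U speed" and slope_smooth: "smooth_map_on U slope"
  by (intro ham_smooth h_smooth f_smooth smooth_map_on_inner_left)+

text \<open>The perturbation changes the gradient by a multiple of \<open>l\<close>, and
  \<open>form x l l\<close> vanishes.\<close>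

lemma speed_perturbed: "x \<in> U \<Longrightarrow> ham (perturbed q) (\<lambda>x. x \<bullet> l) x = speed x"
  by (simp add: ham_def grad_perturbed grad_linear form_add_left form_scale_left form_self)

lemma ham_perturbed_jet:
  assumes "x \<in> U"
  shows "ham (perturbed q) (jet q k) x = jet q (Suc k) x * speed x"
  using speed_perturbed[OF assms, of q]
  by (simp add: ham_def grad_jet grad_linear form_scale_right)

lemma ham_perturbed: "x \<in> U \<Longrightarrow> ham (perturbed q) f' x = ham h f' x + jet q 1 x * ham (\<lambda>x. x \<bullet> l) f' x"
  by (simp add: ham_def grad_perturbed grad_linear form_add_left form_scale_left)

text \<open>Differentiation raises the order of each jet variable by one, and the perturbed gradient
  brings in the variable of order 1. Indices start at 1 because only derivatives of
  \<open>q\<close>, never its values, enter a bracket.\<close>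

lemma ham_perturbed_jetpoly:
  assumes G: "jetpoly U {1..n} G"
  shows "\<exists>G'. jetpoly U {1..Suc n} G' \<and> (\<forall>q. \<forall>x\<in>U.
    ham (perturbed q) (\<lambda>x. G (\<lambda>k. jet q k x) x) x = G' (\<lambda>k. jet q k x) x)"
proof -
  have "\<forall>b\<in>Basis. \<exists>G'. jetpoly U {1..Suc n} G' \<and> (\<forall>q\<in>UNIV. \<forall>x\<in>U.
    frechet_derivative (\<lambda>x. G (\<lambda>k. jet q k x) x) (at x) b = G' (\<lambda>k. jet q k x) x)"
  proof
    fix b :: 'a
    show "\<exists>G'. jetpoly U {1..Suc n} G' \<and> (\<forall>q\<in>UNIV. \<forall>x\<in>U.
      frechet_derivative (\<lambda>x. G (\<lambda>k. jet q k x) x) (at x) b = G' (\<lambda>k. jet q k x) x)"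
    proof (rule jetpoly_deriv[OF G open_U, where Y = "\<lambda>k a x. a (Suc k) * (b \<bullet> l)"])
      show "jetpoly U {1..Suc n} (\<lambda>a x. a (Suc k) * (b \<bullet> l))" if "k \<in> {1..n}" for k
        using that by (intro jetpoly.mult jetpoly.var jetpoly.coeff smooth_map_on_const) auto
    qed (auto simp: jet_smooth frechet_derivative_at[OF jet_has_derivative, symmetric])
  qed
  from bchoice[OF this] obtain G' where "\<forall>b\<in>Basis. jetpoly U {1..Suc n} (G' b) \<and>
    (\<forall>q\<in>UNIV. \<forall>x\<in>U. frechet_derivative (\<lambda>x. G (\<lambda>k. jet q k x) x) (at x) b
      = G' b (\<lambda>k. jet q k x) x)" ..
  then have G': "\<And>b. b \<in> Basis \<Longrightarrow> jetpoly U {1..Suc n} (G' b)"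
    "\<And>b q x. b \<in> Basis \<Longrightarrow> x \<in> U \<Longrightarrow>
      frechet_derivative (\<lambda>x. G (\<lambda>k. jet q k x) x) (at x) b = G' b (\<lambda>k. jet q k x) x"
    by blast+
  let ?G = "\<lambda>a x. \<Sum>i\<in>Basis. \<Sum>j\<in>Basis.
      J i j x * (frechet_derivative h (at x) i + a 1 * (l \<bullet> i)) * G' j a x"
  have "jetpoly U {1..Suc n} ?G"
    by (intro jetpoly_sum jetpoly.mult jetpoly.add G'(1) jetpoly.coeff J_smooth jetpoly.var
        smooth_map_on_const smooth_map_on_deriv h_smooth) auto
  moreover have "ham (perturbed q) (\<lambda>x. G (\<lambda>k. jet q k x) x) x = ?G (\<lambda>k. jet q k x) x" if "x \<in> U" for q x
    using G'(2)[OF _ that]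
    by (simp add: ham_def form_def grad_perturbed[OF that] grad_inner_Basis inner_add_left)
  ultimately show ?thesis by (intro exI[of _ ?G]) blast
qed

text \<open>The coefficient of the highest derivative of \<open>q\<close> does not depend on \<open>q\<close> because the form is
  alternating.\<close>

lemma ham_funpow_leading:
  "\<exists>R. jetpoly U {1..n} R \<and> (\<forall>q. \<forall>x\<in>U. (ham (perturbed q) ^^ Suc n) f x
    = jet q (Suc n) x * (speed x ^ n * slope x) + R (\<lambda>k. jet q k x) x)"
proof (induction n)
  case 0
  show ?case
    using jetpoly.coeff[OF ham_smooth[OF h_smooth f_smooth]]
    by (intro exI[of _ "\<lambda>a. ham h f"]) (simp add: ham_perturbed)
next
  case (Suc n)
  then obtain R where R: "jetpoly U {1..n} R"
    and eq: "\<And>q x. x \<in> U \<Longrightarrow> (ham (perturbed q) ^^ Suc n) f x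
      = jet q (Suc n) x * (speed x ^ n * slope x) + R (\<lambda>k. jet q k x) x" by blast
  let ?g = "\<lambda>x. speed x ^ n * slope x"
  have g: "smooth_map_on U ?g"
    by (intro smooth_map_on_mult smooth_map_on_power speed_smooth slope_smooth open_U)
  obtain R' where R': "jetpoly U {1..Suc n} R'"
    "\<And>q x. x \<in> U \<Longrightarrow> ham (perturbed q) (\<lambda>x. R (\<lambda>k. jet q k x) x) x = R' (\<lambda>k. jet q k x) x"
    using ham_perturbed_jetpoly[OF R] by blast
  let ?R = "\<lambda>a x. a (Suc n) * (ham h ?g x + a 1 * ham (\<lambda>x. x \<bullet> l) ?g x) + R' a x"
  have "jetpoly U {1..Suc n} ?R"
    by (intro jetpoly.mult jetpoly.add jetpoly.coeff jetpoly.var R'(1) ham_smooth g h_smooth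
        smooth_map_on_inner_left) auto
  moreover have "(ham (perturbed q) ^^ Suc (Suc n)) f x
      = jet q (Suc (Suc n)) x * (speed x ^ Suc n * slope x) + ?R (\<lambda>k. jet q k x) x"
    if x: "x \<in> U" for q x
  proof -
    have sm: "smooth_map_on U (\<lambda>x. R (\<lambda>k. jet q k x) x)"
      by (rule jetpoly_smooth[OF R open_U order_refl jet_smooth])
    have "(ham (perturbed q) ^^ Suc (Suc n)) f x = ham (perturbed q) ((ham (perturbed q) ^^ Suc n) f) x"
      by simp
    also have "\<dots> = ham (perturbed q) (\<lambda>x. jet q (Suc n) x * ?g x + R (\<lambda>k. jet q k x) x) x"
      by (rule ham_cong[OF open_U perturbed_smooth ham_funpow_smooth[OF perturbed_smooth f_smooth] x refl])
        (rule eq)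
    also have "\<dots> = jet q (Suc n) x * ham (perturbed q) ?g x + ham (perturbed q) (jet q (Suc n)) x * ?g x
        + R' (\<lambda>k. jet q k x) x"
      \<comment> \<open>By the product rule the new leading term comes from the bracket with
        \<open>jet q (Suc n)\<close>, which is \<open>jet q (Suc (Suc n)) x * speed x\<close>. The
        other terms involve derivatives of \<open>q\<close> of order at most n + 1 and go into
        \<open>?R\<close>.\<close>
      by (simp only: ham_add[OF smooth_map_on_mult[OF open_U jet_smooth g] sm x]
          ham_mult[OF jet_smooth g x] R'(2)[OF x])
    finally show ?thesis
      by (simp add: ham_perturbed_jet[OF x] ham_perturbed[OF x, of q ?g])
  qed
  ultimately show ?case by (intro exI[of _ ?R]) blast
qed

text \<open>The set on which the leading coefficients \<open>speed x ^ n * slope x\<close> are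
  nonzero for all \<open>n\<close>.\<close>

definition transversal :: "'a set" where
  "transversal = {x \<in> U. speed x \<noteq> 0 \<and> slope x \<noteq> 0}"

lemma open_transversal: "open transversal"
proof -
  have "open {x \<in> U. speed x * slope x \<in> - {0}}"
    by (intro continuous_open_preimage[of U, unfolded vimage_def Int_def, simplified]
        smooth_map_on_continuous smooth_map_on_mult open_U speed_smooth slope_smooth) auto
  then show ?thesis by (simp add: transversal_def)
qed

text \<open>The equations are triangular: the k-th is affine in \<open>jet q k x\<close> with a
  nonvanishing coefficient, and the rest involves lower orders only. They are solved recursively by
  functions of the point that do not mention \<open>q\<close>.\<close>

lemma jets_determined:
  "\<exists>\<beta>. (\<forall>k\<in>{1..n}. smooth_map_on transversal (\<beta> k)) \<and>
    (\<forall>q. \<forall>x\<in>transversal. (\<forall>k\<in>{1..n}. (ham (perturbed q) ^^ k) f x = 0) \<longrightarrow>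
      (\<forall>k\<in>{1..n}. jet q k x = \<beta> k x))"
proof (induction n)
  case (Suc n)
  then obtain \<beta> where \<beta>: "\<And>k. k \<in> {1..n} \<Longrightarrow> smooth_map_on transversal (\<beta> k)"
    "\<And>q x k. x \<in> transversal \<Longrightarrow> (\<And>k. k \<in> {1..n} \<Longrightarrow> (ham (perturbed q) ^^ k) f x = 0) \<Longrightarrow>
      k \<in> {1..n} \<Longrightarrow> jet q k x = \<beta> k x" by blast
  obtain R where R: "jetpoly U {1..n} R"
    and eq: "\<And>q x. x \<in> U \<Longrightarrow> (ham (perturbed q) ^^ Suc n) f x
      = jet q (Suc n) x * (speed x ^ n * slope x) + R (\<lambda>k. jet q k x) x"
    using ham_funpow_leading[of n] by blast
  define \<beta>' where "\<beta>' = \<beta>(Suc n := \<lambda>x. - R (\<lambda>k. \<beta> k x) x / (speed x ^ n * slope x))"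
  have sub: "transversal \<subseteq> U" by (auto simp: transversal_def)
  have "smooth_map_on transversal (\<lambda>x. - R (\<lambda>k. \<beta> k x) x / (speed x ^ n * slope x))"
    by (intro smooth_map_on_divide smooth_map_on_uminus jetpoly_smooth[OF R] smooth_map_on_mult
        smooth_map_on_power smooth_map_on_subset[OF speed_smooth sub] smooth_map_on_subset[OF slope_smooth sub]
        \<beta>(1) open_transversal sub) (auto simp: transversal_def)
  then have "\<forall>k\<in>{1..Suc n}. smooth_map_on transversal (\<beta>' k)"
    using \<beta>(1) by (auto simp: \<beta>'_def)
  moreover have "jet q k x = \<beta>' k x"
    if x: "x \<in> transversal" and z: "\<And>k. k \<in> {1..Suc n} \<Longrightarrow> (ham (perturbed q) ^^ k) f x = 0"
      and k: "k \<in> {1..Suc n}" for q x k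
  proof -
    have old: "jet q k x = \<beta> k x" if "k \<in> {1..n}" for k
      using \<beta>(2)[OF x _ that, of q] z by simp
    show ?thesis
    proof (cases "k = Suc n")
      case True
      have "jet q (Suc n) x * (speed x ^ n * slope x) + R (\<lambda>k. jet q k x) x = 0"
        using z[of "Suc n"] eq[of x q] x sub by auto
      moreover have "R (\<lambda>k. jet q k x) x = R (\<lambda>k. \<beta> k x) x"
        by (rule jetpoly_cong[OF R]) (rule old)
      ultimately show ?thesis
        using x True by (auto simp: \<beta>'_def transversal_def field_simps)
    next
      case False
      then show ?thesis using old[of k] k by (simp add: \<beta>'_def)
    qed
  qed
  ultimately show ?case by blast
qed simp

text \<open>A bad coefficient vector is a smooth function of the bad point, so the bad vectors lie
  in the image of an open set under a differentiable map into a space of larger dimension.\<close>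

lemma negligible_bad_polynomials:
  fixes e :: "nat \<Rightarrow> 'b::euclidean_space"
  assumes e: "bij_betw e {1..N} Basis" and dim: "DIM('a) < DIM('b)"
  shows "negligible {c. \<exists>x\<in>transversal. \<forall>k\<in>{1..N}.
    (ham (perturbed (\<Sum>i\<in>{1..N}. monom (c \<bullet> e i) i)) ^^ k) f x = 0}"
proof -
  obtain \<beta> where \<beta>: "\<And>k. k \<in> {1..N} \<Longrightarrow> smooth_map_on transversal (\<beta> k)"
    "\<And>q x k. x \<in> transversal \<Longrightarrow> (\<And>k. k \<in> {1..N} \<Longrightarrow> (ham (perturbed q) ^^ k) f x = 0) \<Longrightarrow>
      k \<in> {1..N} \<Longrightarrow> jet q k x = \<beta> k x"
    using jets_determined[of N] by blast
  let ?q = "\<lambda>c. \<Sum>i\<in>{1..N}. monom (c \<bullet> e i) i"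
  \<comment> \<open>\<open>fact_coeff_eq_taylor\<close> at \<open>s = x \<bullet> l\<close>, with
    the derivatives of \<open>q\<close> replaced by \<beta>. Since j \<ge> 1, only the orders 1 to N
    that \<beta> covers occur.\<close>
  define g where "g x = (\<Sum>j\<in>{1..N}. ((\<Sum>k\<le>N - j. \<beta> (k + j) x * (- (x \<bullet> l)) ^ k / fact k) / fact j) *\<^sub>R e j)" for x
  have "smooth_map_on transversal g"
    unfolding g_def
    by (intro smooth_map_on_sum smooth_map_on_scaleR smooth_map_on_divide smooth_map_on_mult
        smooth_map_on_power smooth_map_on_uminus smooth_map_on_inner_left smooth_map_on_const \<beta>(1)
        open_transversal) auto
  then have "g differentiable_on transversal"
    using smooth_map_on_differentiable differentiable_at_withinI unfolding differentiable_on_def by blast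
  then have "negligible (g ` transversal)"
    by (rule negligible_differentiable_image_lowdim[OF dim])
  moreover have "c \<in> g ` transversal"
    if x: "x \<in> transversal" and z: "\<forall>k\<in>{1..N}. (ham (perturbed (?q c)) ^^ k) f x = 0" for c x
  proof
    have co: "coeff (?q c) j = c \<bullet> e j" if "j \<in> {1..N}" for j
      using that by (simp add: coeff_sum sum.delta)
    have deg: "degree (?q c) \<le> N"
      by (intro degree_sum_le) (auto intro: order_trans[OF degree_monom_le])
    have "c \<bullet> e j = (\<Sum>k\<le>N - j. \<beta> (k + j) x * (- (x \<bullet> l)) ^ k / fact k) / fact j" if j: "j \<in> {1..N}" for j
    proof -
      have "fact j * (c \<bullet> e j) = (\<Sum>k\<le>N - j. jet (?q c) (k + j) x * (- (x \<bullet> l)) ^ k / fact k)"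
        using fact_coeff_eq_taylor[OF deg, of j "x \<bullet> l"] co[OF j] by (simp add: jet_def)
      also have "\<dots> = (\<Sum>k\<le>N - j. \<beta> (k + j) x * (- (x \<bullet> l)) ^ k / fact k)"
        by (rule sum.cong) (use \<beta>(2)[OF x, of "?q c"] z j in auto)
      finally show ?thesis by (simp add: field_simps)
    qed
    then have "g x = (\<Sum>j\<in>{1..N}. (c \<bullet> e j) *\<^sub>R e j)"
      unfolding g_def by (intro sum.cong) auto
    also have "\<dots> = (\<Sum>b\<in>Basis. (c \<bullet> b) *\<^sub>R b)"
      by (rule sum.reindex_bij_betw[OF e])
    finally show "c = g x" by (simp add: euclidean_representation)
  qed (use x in auto)
  ultimately show ?thesis
    by (elim negligible_subset) blast
qed

end


section \<open>Charts\<close>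

definition cod :: "('p, 'e) chart \<Rightarrow> 'e set" where
  "cod c = snd c ` fst c"

definition pt :: "('p, 'e) chart \<Rightarrow> 'e \<Rightarrow> 'p" where
  "pt c = inv_into (fst c) (snd c)"

lemma in_chart_eq: "in_chart c f = (\<lambda>y. f (pt c y))"
  by (simp add: in_chart_def pt_def split_def o_def)

definition lift :: "('p, 'e) chart \<Rightarrow> ('e \<Rightarrow> real) \<Rightarrow> 'p \<Rightarrow> real" where
  "lift c g p = (if p \<in> fst c then g (snd c p) else 0)"

locale smooth_atlas =
  fixes A :: "('p::{t2_space,second_countable_topology}, 'e::euclidean_space) chart set"
  assumes manifold: "smooth_manifold A"
begin

lemma chart:
  assumes "c \<in> A"
  shows open_dom: "open (fst c)" and open_cod: "open (cod c)"
    and cont_chart: "continuous_on (fst c) (snd c)" and cont_pt: "continuous_on (cod c) (pt c)"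
    and pt_in: "y \<in> cod c \<Longrightarrow> pt c y \<in> fst c" and chart_pt: "y \<in> cod c \<Longrightarrow> snd c (pt c y) = y"
    and pt_chart: "p \<in> fst c \<Longrightarrow> pt c (snd c p) = p" and chart_in: "p \<in> fst c \<Longrightarrow> snd c p \<in> cod c"
proof -
  have "is_chart c" using assms manifold by (simp add: smooth_manifold_def)
  then have *: "open (fst c)" "open (cod c)" "homeomorphism (fst c) (cod c) (snd c) (pt c)"
    by (simp_all add: is_chart_def cod_def pt_def split_def)
  then show "open (fst c)" "open (cod c)" by auto
  show "continuous_on (fst c) (snd c)" "continuous_on (cod c) (pt c)"
    using *(3) by (auto simp: homeomorphism_def)
  show "y \<in> cod c \<Longrightarrow> pt c y \<in> fst c" "y \<in> cod c \<Longrightarrow> snd c (pt c y) = y"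
    "p \<in> fst c \<Longrightarrow> pt c (snd c p) = p" "p \<in> fst c \<Longrightarrow> snd c p \<in> cod c"
    using *(3) by (auto simp: homeomorphism_def)
qed

lemma chart_at:
  obtains c where "c \<in> A" "p \<in> fst c"
  using manifold that unfolding smooth_manifold_def by (metis UNIV_I UN_E)

lemma open_chart_preimage:
  assumes "c \<in> A" "open W"
  shows "open {p \<in> fst c. snd c p \<in> W}"
  using continuous_open_preimage[OF cont_chart open_dom assms(2)] assms(1)
  by (simp add: vimage_def Int_def)

lemma open_chart_image:
  assumes "c \<in> A" "open V" "V \<subseteq> fst c"
  shows "open (snd c ` V)"
proof -
  have "snd c ` V = {y \<in> cod c. pt c y \<in> V}"
    using assms(3) chart_pt[OF assms(1)] chart_in[OF assms(1)] pt_chart[OF assms(1)] by force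
  then show ?thesis
    using continuous_open_preimage[OF cont_pt open_cod assms(2)] assms(1)
    by (simp add: vimage_def Int_def)
qed

lemma smooth_transition:
  assumes "c \<in> A" "d \<in> A"
  shows "smooth_map_on (snd c ` (fst c \<inter> fst d)) (\<lambda>y. snd d (pt c y))"
proof -
  have "compatible_charts c d" using assms manifold by (simp add: smooth_manifold_def)
  then show ?thesis by (simp add: compatible_charts_def split_def pt_def o_def)
qed

lemma smooth_functions_in_chart:
  "f \<in> smooth_functions A \<Longrightarrow> c \<in> A \<Longrightarrow> smooth_map_on (cod c) (in_chart c f)"
  by (simp add: smooth_functions_def cod_def)

text \<open>Smoothness may be tested near each point in one chart of choice, because the transition
  maps to all other charts are smooth.\<close>

lemma smooth_functionsI:
  assumes "\<And>p. \<exists>c\<in>A. \<exists>N. p \<in> fst c \<and> open N \<and> snd c p \<in> N \<and> N \<subseteq> cod c \<and> smooth_map_on N (in_chart c f)"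
  shows "f \<in> smooth_functions A"
proof -
  have "smooth_map_on (cod d) (in_chart d f)" if d: "d \<in> A" for d
  proof (rule smooth_map_on_local)
    fix y assume y: "y \<in> cod d"
    obtain c N where c: "c \<in> A" "pt d y \<in> fst c" and N: "open N" "snd c (pt d y) \<in> N" "N \<subseteq> cod c"
      "smooth_map_on N (in_chart c f)"
      using assms by blast
    define V where "V = fst d \<inter> {p \<in> fst c. snd c p \<in> N}"
    have V: "open V" "V \<subseteq> fst d" "V \<subseteq> fst c"
      using open_dom[OF d] open_chart_preimage[OF c(1) N(1)] by (auto simp: V_def)
    have sub: "snd d ` V \<subseteq> snd d ` (fst d \<inter> fst c)" using V by blast
    have "smooth_map_on (snd d ` V) (\<lambda>z. in_chart c f (snd c (pt d z)))"
      by (rule smooth_map_on_compose[OF open_chart_image[OF d V(1,2)] N(1)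
            smooth_map_on_subset[OF smooth_transition[OF d c(1)] sub] _ N(4)])
        (use pt_chart[OF d] in \<open>auto simp: V_def\<close>)
    then have "smooth_map_on (snd d ` V) (in_chart d f)"
      by (rule smooth_map_on_cong[OF open_chart_image[OF d V(1,2)]])
        (use pt_chart[OF d subsetD[OF V(2)]] pt_chart[OF c(1) subsetD[OF V(3)]] in \<open>auto simp: in_chart_eq\<close>)
    moreover have "y \<in> snd d ` V"
      using chart_pt[OF d y] pt_in[OF d y] c N by (force simp: V_def)
    ultimately show "\<exists>T. open T \<and> y \<in> T \<and> smooth_map_on T (in_chart d f)"
      using open_chart_image[OF d V(1,2)] by blast
  qed
  then show ?thesis by (simp add: smooth_functions_def cod_def)
qed

lemma smooth_functions_const: "(\<lambda>p. r) \<in> smooth_functions A"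
  by (simp add: smooth_functions_def in_chart_eq smooth_map_on_const)

lemma smooth_functions_add:
  "f \<in> smooth_functions A \<Longrightarrow> g \<in> smooth_functions A \<Longrightarrow> (\<lambda>p. f p + g p) \<in> smooth_functions A"
  using open_cod unfolding smooth_functions_def
  by (auto simp: in_chart_eq cod_def intro!: smooth_map_on_add)

lemma smooth_functions_mult:
  "f \<in> smooth_functions A \<Longrightarrow> g \<in> smooth_functions A \<Longrightarrow> (\<lambda>p. f p * g p) \<in> smooth_functions A"
  using open_cod unfolding smooth_functions_def
  by (auto simp: in_chart_eq cod_def intro!: smooth_map_on_mult)

lemma smooth_functions_sum:
  "finite I \<Longrightarrow> (\<And>i. i \<in> I \<Longrightarrow> f i \<in> smooth_functions A) \<Longrightarrow> (\<lambda>p. \<Sum>i\<in>I. f i p) \<in> smooth_functions A"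
  by (induction I rule: finite_induct) (auto intro: smooth_functions_const smooth_functions_add)

lemma compact_pt_image: "c \<in> A \<Longrightarrow> compact C \<Longrightarrow> C \<subseteq> cod c \<Longrightarrow> compact (pt c ` C)"
  by (meson compact_continuous_image cont_pt continuous_on_subset)

lemma lift_smooth:
  assumes c: "c \<in> A" and g: "smooth_map_on (cod c) g" and C: "compact C" "C \<subseteq> cod c"
    and zero: "\<And>y. y \<in> cod c - C \<Longrightarrow> g y = 0"
  shows "lift c g \<in> smooth_functions A"
proof (rule smooth_functionsI)
  fix p
  show "\<exists>d\<in>A. \<exists>N. p \<in> fst d \<and> open N \<and> snd d p \<in> N \<and> N \<subseteq> cod d \<and> smooth_map_on N (in_chart d (lift c g))"
  proof (cases "p \<in> fst c")
    case True
    have "smooth_map_on (cod c) (in_chart c (lift c g))"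
      by (rule smooth_map_on_cong[OF open_cod[OF c] g])
        (simp add: in_chart_eq lift_def pt_in[OF c] chart_pt[OF c])
    then show ?thesis using True c open_cod[OF c] chart_in[OF c] by blast
  next
    case False
    obtain d where d: "d \<in> A" "p \<in> fst d" using chart_at by blast
    define V where "V = fst d - pt c ` C"
    have "open V"
      unfolding V_def by (intro open_Diff open_dom[OF d(1)] compact_imp_closed compact_pt_image c C)
    have "p \<in> V" using d False C(2) pt_in[OF c] by (auto simp: V_def)
    have V: "V \<subseteq> fst d" by (auto simp: V_def)
    have "lift c g q = 0" if "q \<in> V" for q
    proof -
      have "snd c q \<notin> C" if "q \<in> fst c"
        using that \<open>q \<in> V\<close> pt_chart[OF c that] by (force simp: V_def)
      then show ?thesis using zero chart_in[OF c] by (auto simp: lift_def)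
    qed
    then have "smooth_map_on (snd d ` V) (in_chart d (lift c g))"
      using V pt_chart[OF d(1)]
      by (intro smooth_map_on_cong[OF open_chart_image[OF d(1) \<open>open V\<close> V] smooth_map_on_const[where c = 0]])
        (auto simp: in_chart_eq)
    then show ?thesis
      using d open_chart_image[OF d(1) \<open>open V\<close> V] \<open>p \<in> V\<close> V chart_in[OF d(1)]
      by (intro bexI[of _ d] exI[of _ "snd d ` V"]) auto
  qed
qed

lemma in_chart_lift: "c \<in> A \<Longrightarrow> y \<in> cod c \<Longrightarrow> in_chart c (lift c g) y = g y"
  by (simp add: in_chart_eq lift_def pt_in chart_pt)

section \<open>Perturbations in the strong topology\<close>

text \<open>The complement is the projection of a closed set along the compact factor
  \<open>K\<close>, hence closed.\<close>

lemma open_perturbations_small: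
  fixes g :: "'b::euclidean_space \<Rightarrow> 'e \<Rightarrow> real"
  assumes K: "compact K" and f: "continuous_on K f" and g: "\<And>b. b \<in> Basis \<Longrightarrow> continuous_on K (g b)"
  shows "open {c. \<forall>y\<in>K. \<bar>f y - (\<Sum>b\<in>Basis. (c \<bullet> b) * g b y)\<bar> < e}"
proof -
  let ?F = "\<lambda>p. \<bar>f (fst p) - (\<Sum>b\<in>Basis. (snd p \<bullet> b) * g b (fst p))\<bar>"
  have "continuous_on (K \<times> UNIV) ?F"
    by (intro continuous_intros continuous_on_compose2[OF f] continuous_on_compose2[OF g]) auto
  then have "closed ((K \<times> UNIV) \<inter> ?F -` {e..})"
    by (rule continuous_closed_preimage[OF _ closed_Times[OF compact_imp_closed[OF K] closed_UNIV] closed_atLeast])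
  from closed_compact_projection[OF K this]
  have "closed {c. \<exists>y. y \<in> K \<and> (y, c) \<in> (K \<times> UNIV) \<inter> ?F -` {e..}}" .
  moreover have "- {c. \<exists>y. y \<in> K \<and> (y, c) \<in> (K \<times> UNIV) \<inter> ?F -` {e..}}
      = {c. \<forall>y\<in>K. \<bar>f y - (\<Sum>b\<in>Basis. (c \<bullet> b) * g b y)\<bar> < e}"
    by (auto simp: not_le)
  ultimately show ?thesis by (simp only: closed_def)
qed

lemma locally_finite_compact:
  assumes "locally_finite_charts \<Phi>" "compact C"
  shows "finite {c \<in> \<Phi>. fst c \<inter> C \<noteq> {}}"
proof -
  from choice[OF assms(1)[unfolded locally_finite_charts_def]]
  obtain V where V: "\<forall>p. open (V p) \<and> p \<in> V p \<and> finite {c\<in>\<Phi>. fst c \<inter> V p \<noteq> {}}" ..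
  then have "open (V p)" and "C \<subseteq> (\<Union>p\<in>C. V p)" for p by blast+
  then obtain D where D: "finite D" "C \<subseteq> (\<Union>p\<in>D. V p)"
    by (rule compactE_image[OF assms(2)])
  have "finite (\<Union>p\<in>D. {c\<in>\<Phi>. fst c \<inter> V p \<noteq> {}})" using D V by blast
  moreover have "{c \<in> \<Phi>. fst c \<inter> C \<noteq> {}} \<subseteq> (\<Union>p\<in>D. {c\<in>\<Phi>. fst c \<inter> V p \<noteq> {}})"
  proof
    fix c assume "c \<in> {c \<in> \<Phi>. fst c \<inter> C \<noteq> {}}"
    then obtain q where q: "c \<in> \<Phi>" "q \<in> fst c" "q \<in> C" by blast
    then obtain p where "p \<in> D" "q \<in> V p" using D(2) by blast
    then show "c \<in> (\<Union>p\<in>D. {c\<in>\<Phi>. fst c \<inter> V p \<noteq> {}})" using q by blast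
  qed
  ultimately show ?thesis by (rule finite_subset[rotated])
qed

text \<open>On a noncompact manifold the strong topology is too fine for a linear family of
  functions to be continuous in general. The compact common support \<open>C\<close> meets only
  finitely many charts of a locally finite family, so only finitely many conditions depend on the
  parameter.\<close>

lemma continuous_perturbation:
  fixes \<zeta> :: "'b::euclidean_space \<Rightarrow> 'p \<Rightarrow> real"
  assumes H: "H \<in> smooth_functions A" and \<zeta>: "\<And>b. b \<in> Basis \<Longrightarrow> \<zeta> b \<in> smooth_functions A"
    and C: "compact C" "\<And>b p. b \<in> Basis \<Longrightarrow> p \<notin> C \<Longrightarrow> \<zeta> b p = 0"
  shows "continuous_map euclidean (strong_topology A) (\<lambda>c p. H p + (\<Sum>b\<in>Basis. (c \<bullet> b) * \<zeta> b p))"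
proof -
  let ?H = "\<lambda>c p. H p + (\<Sum>b\<in>Basis. (c \<bullet> b) * \<zeta> b p)"
  have H_smooth: "?H c \<in> smooth_functions A" for c
    by (intro smooth_functions_add smooth_functions_sum smooth_functions_mult smooth_functions_const H \<zeta>) auto
  have "open {c. ?H c \<in> strong_nbhd A r f \<Phi> K \<epsilon>}"
    if f: "f \<in> smooth_functions A" and \<Phi>: "\<Phi> \<subseteq> A" "locally_finite_charts \<Phi>"
      and K: "\<forall>d\<in>\<Phi>. compact (K d) \<and> K d \<subseteq> fst d \<and> 0 < \<epsilon> d" for r f \<Phi> K \<epsilon>
  proof -
    define D where "D = {d \<in> \<Phi>. fst d \<inter> C \<noteq> {}}"
    have D: "finite D" "D \<subseteq> \<Phi>"
      using locally_finite_compact[OF \<Phi>(2) C(1)] by (auto simp: D_def)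
    let ?V = "{vs :: 'e list. set vs \<subseteq> Basis \<and> length vs \<le> r}"
    have finV: "finite ?V" using finite_lists_length_le[OF finite_Basis] .
    define Q where "Q d vs c \<longleftrightarrow> (\<forall>p\<in>K d. \<bar>iterated_deriv vs (in_chart d f) (snd d p)
        - iterated_deriv vs (in_chart d (?H c)) (snd d p)\<bar> < \<epsilon> d)" for d vs c
    have Q_open: "open {c. Q d vs c}" if d: "d \<in> \<Phi>" for d vs
    proof -
      have dA: "d \<in> A" using d \<Phi> by blast
      have Kd: "compact (snd d ` K d)" "snd d ` K d \<subseteq> cod d"
        using K d cont_chart[OF dA] by (auto simp: cod_def intro: compact_continuous_image continuous_on_subset)
      note sm = smooth_functions_in_chart[OF _ dA]
      note cont = continuous_on_subset[OF smooth_map_on_continuous[OF smooth_map_on_iterated_deriv[OF sm]] Kd(2)]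
      have eq: "iterated_deriv vs (in_chart d (?H c)) y = iterated_deriv vs (in_chart d H) y
          + (\<Sum>b\<in>Basis. (c \<bullet> b) * iterated_deriv vs (in_chart d (\<zeta> b)) y)" if "y \<in> cod d" for c y
        using smooth_map_on_sum_iterated_deriv[OF open_cod[OF dA] sm[OF H], of Basis "\<lambda>b. in_chart d (\<zeta> b)" y vs "\<lambda>b. c \<bullet> b"]
          sm[OF \<zeta>] that by (simp add: in_chart_eq)
      have "open {c. \<forall>y\<in>snd d ` K d. \<bar>(iterated_deriv vs (in_chart d f) y - iterated_deriv vs (in_chart d H) y)
          - (\<Sum>b\<in>Basis. (c \<bullet> b) * iterated_deriv vs (in_chart d (\<zeta> b)) y)\<bar> < \<epsilon> d}"
        by (intro open_perturbations_small Kd(1) continuous_on_diff cont f H \<zeta>)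
      moreover have "Q d vs c \<longleftrightarrow> (\<forall>y\<in>snd d ` K d. \<bar>(iterated_deriv vs (in_chart d f) y - iterated_deriv vs (in_chart d H) y)
          - (\<Sum>b\<in>Basis. (c \<bullet> b) * iterated_deriv vs (in_chart d (\<zeta> b)) y)\<bar> < \<epsilon> d)" for c
        unfolding Q_def using Kd(2) eq[of _ c] by (simp add: image_subset_iff diff_diff_eq)
      ultimately show ?thesis by simp
    qed
    \<comment> \<open>On a chart that misses the support all members of the family coincide, so the
      condition there does not depend on the parameter and can be read at 0.\<close>
    have Q_const: "Q d vs c \<longleftrightarrow> Q d vs 0" if "d \<in> \<Phi> - D" for d vs c
    proof -
      have dA: "d \<in> A" and disj: "fst d \<inter> C = {}" using that \<Phi> by (auto simp: D_def)
      have "iterated_deriv vs (in_chart d (?H c)) y = iterated_deriv vs (in_chart d (?H 0)) y" if "y \<in> cod d" for y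
      proof (rule iterated_deriv_cong[OF open_cod[OF dA] smooth_functions_in_chart[OF H_smooth dA] _ that])
        fix y assume "y \<in> cod d"
        then have "pt d y \<notin> C" using pt_in[OF dA] disj by blast
        then show "in_chart d (?H c) y = in_chart d (?H 0) y"
          using C(2) by (simp add: in_chart_eq)
      qed
      then show ?thesis unfolding Q_def using K that chart_in[OF dA] by (simp add: subset_iff)
    qed
    have "?H c \<in> strong_nbhd A r f \<Phi> K \<epsilon> \<longleftrightarrow>
        (\<forall>d\<in>\<Phi> - D. \<forall>vs\<in>?V. Q d vs 0) \<and> (\<forall>d\<in>D. \<forall>vs\<in>?V. Q d vs c)" for c
    proof -
      have "?H c \<in> strong_nbhd A r f \<Phi> K \<epsilon> \<longleftrightarrow> (\<forall>d\<in>\<Phi>. \<forall>vs\<in>?V. Q d vs c)"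
        using H_smooth[of c] by (auto simp: strong_nbhd_def Q_def)
      also have "\<dots> \<longleftrightarrow> (\<forall>d\<in>\<Phi> - D. \<forall>vs\<in>?V. Q d vs c) \<and> (\<forall>d\<in>D. \<forall>vs\<in>?V. Q d vs c)"
        using D(2) by blast
      also have "(\<forall>d\<in>\<Phi> - D. \<forall>vs\<in>?V. Q d vs c) \<longleftrightarrow> (\<forall>d\<in>\<Phi> - D. \<forall>vs\<in>?V. Q d vs 0)"
        by (intro ball_cong refl Q_const)
      finally show ?thesis .
    qed
    then have "{c. ?H c \<in> strong_nbhd A r f \<Phi> K \<epsilon>}
        = {c. \<forall>d\<in>\<Phi> - D. \<forall>vs\<in>?V. Q d vs 0} \<inter> (\<Inter>d\<in>D. \<Inter>vs\<in>?V. {c. Q d vs c})"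
      by (simp only: set_eq_iff Int_iff INT_iff mem_Collect_eq simp_thms)
    then show ?thesis
      using D finV Q_open by (auto intro!: open_Int open_INT)
  qed
  then show ?thesis
    unfolding strong_topology_def
    by (intro continuous_on_generated_topo)
      (use H_smooth topspace_strong_topology[of A, unfolded strong_topology_def topology_generated_by_topspace]
        in \<open>auto simp: vimage_def\<close>)
qed

end

section \<open>Generic avoidance of a differential condition\<close>

text \<open>What genericity of the negation of \<open>bad\<close> needs. \<open>bad_limit\<close>
  together with compactness of \<open>V\<close> makes the good set open; \<open>bad_thin\<close>
  gives good parameters arbitrarily near 0; \<open>bad_germ\<close> allows the perturbations
  \<open>P\<close> to be cut off away from the compact set under consideration. The vector
  \<open>v\<close> is a witness, such as a kernel vector of a Hessian.\<close>

locale thin_condition =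
  fixes U :: "'a::euclidean_space set" and V :: "'v::euclidean_space set" and r :: nat
    and P :: "'b::euclidean_space \<Rightarrow> 'a \<Rightarrow> real"
    and bad :: "('a \<Rightarrow> real) \<Rightarrow> 'a \<Rightarrow> 'v \<Rightarrow> bool"
  assumes compact_V: "compact V"
    and P_smooth: "\<And>b. b \<in> Basis \<Longrightarrow> smooth_map_on UNIV (P b)"
    and bad_germ: "\<And>N h h' x v. open N \<Longrightarrow> N \<subseteq> U \<Longrightarrow> smooth_map_on U h \<Longrightarrow> smooth_map_on U h' \<Longrightarrow>
      (\<And>y. y \<in> N \<Longrightarrow> h y = h' y) \<Longrightarrow> x \<in> N \<Longrightarrow> bad h x v \<Longrightarrow> bad h' x v"
    and bad_limit: "\<And>h x v H X W. smooth_map_on U h \<Longrightarrow> (\<And>n. smooth_map_on U (H n)) \<Longrightarrow>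
      x \<in> U \<Longrightarrow> (\<And>n. X n \<in> U) \<Longrightarrow> X \<longlonglongrightarrow> x \<Longrightarrow> W \<longlonglongrightarrow> v \<Longrightarrow>
      (\<And>vs. set vs \<subseteq> Basis \<Longrightarrow> length vs \<le> r \<Longrightarrow>
        (\<lambda>n. iterated_deriv vs (H n) (X n)) \<longlonglongrightarrow> iterated_deriv vs h x) \<Longrightarrow>
      (\<And>n. bad (H n) (X n) (W n)) \<Longrightarrow> bad h x v"
    and bad_thin: "\<And>h. smooth_map_on U h \<Longrightarrow>
      negligible {c. \<exists>x\<in>U. \<exists>v\<in>V. bad (\<lambda>y. h y + (\<Sum>b\<in>Basis. (c \<bullet> b) * P b y)) x v}"

locale thin_condition_on_chart = smooth_atlas A + thin_condition U V r P bad
  for A :: "('p::{t2_space,second_countable_topology}, 'e::euclidean_space) chart set"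
    and U :: "'e set" and V :: "'v::euclidean_space set" and r
    and P :: "'b::euclidean_space \<Rightarrow> 'e \<Rightarrow> real" and bad +
  fixes c :: "('p, 'e) chart"
  assumes c: "c \<in> A" and U: "U = cod c"
begin

definition good :: "'e set \<Rightarrow> ('p \<Rightarrow> real) set" where
  "good K = {H \<in> smooth_functions A. \<forall>x\<in>K. \<forall>v\<in>V. \<not> bad (in_chart c H) x v}"

text \<open>If no neighbourhood of \<open>H\<close> of order \<open>r\<close> and radius 1/(n+1)
  were good, bad functions in them would have bad points in the compact set
  \<open>K \<times> V\<close>; along a convergent subsequence \<open>bad_limit\<close> makes
  \<open>H\<close> itself bad.\<close>

lemma openin_good:
  assumes K: "compact K" "K \<subseteq> U"
  shows "openin (strong_topology A) (good K)"
proof (subst openin_subopen, rule ballI)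
  fix H assume H: "H \<in> good K"
  let ?N = "\<lambda>n::nat. strong_nbhd A r H {c} (\<lambda>_. pt c ` K) (\<lambda>_. inverse (real (Suc n)))"
  have Hs: "H \<in> smooth_functions A" using H by (simp add: good_def)
  note Hc = smooth_functions_in_chart[OF Hs c, folded U]
  have KU: "pt c ` K \<subseteq> fst c" using K(2) pt_in[OF c] U by blast
  have "\<exists>n. ?N n \<subseteq> good K"
  proof (rule ccontr)
    assume "\<not> ?thesis"
    then have "\<forall>n. \<exists>g x v. g \<in> ?N n \<and> x \<in> K \<and> v \<in> V \<and> bad (in_chart c g) x v"
      by (force simp: good_def strong_nbhd_def)
    from choice[OF this] obtain g where
      "\<forall>n. \<exists>x v. g n \<in> ?N n \<and> x \<in> K \<and> v \<in> V \<and> bad (in_chart c (g n)) x v" ..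
    from choice[OF this] obtain x where
      "\<forall>n. \<exists>v. g n \<in> ?N n \<and> x n \<in> K \<and> v \<in> V \<and> bad (in_chart c (g n)) (x n) v" ..
    from choice[OF this] obtain v where
      gxv: "\<forall>n. g n \<in> ?N n \<and> x n \<in> K \<and> v n \<in> V \<and> bad (in_chart c (g n)) (x n) (v n)" ..
    then have g: "g n \<in> ?N n" and x: "x n \<in> K" and v: "v n \<in> V"
      and bad: "bad (in_chart c (g n)) (x n) (v n)" for n
      by blast+
    obtain z s where z: "z \<in> K \<times> V" and s: "strict_mono s" "((\<lambda>n. (x n, v n)) \<circ> s) \<longlonglongrightarrow> z"
      by (rule seq_compactE[OF compact_imp_seq_compact[OF compact_Times[OF K(1) compact_V]], of "\<lambda>n. (x n, v n)"])
        (use x v in auto)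
    have lim: "(\<lambda>n. x (s n)) \<longlonglongrightarrow> fst z" "(\<lambda>n. v (s n)) \<longlonglongrightarrow> snd z"
      using tendsto_fst[OF s(2)] tendsto_snd[OF s(2)] by (simp_all add: o_def)
    have "bad (in_chart c H) (fst z) (snd z)"
    proof (rule bad_limit[OF Hc _ _ _ lim])
      show "smooth_map_on U (in_chart c (g (s n)))" for n
        using g[of "s n"] smooth_functions_in_chart[OF _ c] U by (auto simp: strong_nbhd_def)
      show "fst z \<in> U" "\<And>n. x (s n) \<in> U" using z x K(2) by auto
      show "bad (in_chart c (g (s n))) (x (s n)) (v (s n))" for n by (rule bad)
      fix vs :: "'e list" assume vs: "set vs \<subseteq> Basis" "length vs \<le> r"
      let ?d = "\<lambda>n. iterated_deriv vs (in_chart c H) (x (s n)) - iterated_deriv vs (in_chart c (g (s n))) (x (s n))"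
      have "isCont (iterated_deriv vs (in_chart c H)) (fst z)"
        using smooth_map_on_continuous[OF smooth_map_on_iterated_deriv[OF Hc]] z K(2) open_cod[OF c] U
        by (auto simp: continuous_on_eq_continuous_at)
      then have 1: "(\<lambda>n. iterated_deriv vs (in_chart c H) (x (s n))) \<longlonglongrightarrow> iterated_deriv vs (in_chart c H) (fst z)"
        using lim(1) isCont_tendsto_compose by blast
      have bound: "norm (?d n) \<le> inverse (real (Suc n))" for n
      proof -
        have "x (s n) \<in> cod c" using x K(2) U by blast
        then have "\<bar>?d n\<bar> < inverse (real (Suc (s n)))"
          using g[of "s n"] vs x[of "s n"] chart_pt[OF c, of "x (s n)"] by (auto simp: strong_nbhd_def)
        also have "\<dots> \<le> inverse (real (Suc n))"
          using seq_suble[OF s(1), of n] by (intro le_imp_inverse_le) auto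
        finally show ?thesis by simp
      qed
      have "?d \<longlonglongrightarrow> 0"
        by (rule Lim_null_comparison[OF always_eventually LIMSEQ_inverse_real_of_nat]) (use bound in blast)
      from tendsto_diff[OF 1 this]
      show "(\<lambda>n. iterated_deriv vs (in_chart c (g (s n))) (x (s n))) \<longlonglongrightarrow> iterated_deriv vs (in_chart c H) (fst z)"
        by simp
    qed
    then show False using H z by (auto simp: good_def)
  qed
  then obtain n where n: "?N n \<subseteq> good K" by blast
  have "openin (strong_topology A) (?N n)"
    unfolding strong_topology_def
  proof (rule topology_generated_by_Basis, rule CollectI, intro exI conjI)
    show "locally_finite_charts {c}" by (auto simp: locally_finite_charts_def)
    show "\<forall>d\<in>{c}. compact (pt c ` K) \<and> pt c ` K \<subseteq> fst d \<and> 0 < inverse (real (Suc n))"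
      using KU compact_pt_image[OF c K(1)] K(2) U by auto
  qed (use Hs c in auto)
  moreover have "H \<in> ?N n" using Hs by (simp add: strong_nbhd_def)
  ultimately show "\<exists>T. openin (strong_topology A) T \<and> H \<in> T \<and> T \<subseteq> good K"
    using n by blast
qed

text \<open>The parameters whose cut-off perturbation stays in a given neighbourhood of
  \<open>H\<close> form an open set containing 0. It is not negligible, so it contains a parameter
  outside the negligible bad set.\<close>

lemma dense_good:
  assumes K: "compact K" "K \<subseteq> U"
  shows "strong_topology A closure_of good K = topspace (strong_topology A)"
proof -
  have "\<exists>G. G \<in> good K \<and> G \<in> T"
    if H: "H \<in> smooth_functions A" and T: "H \<in> T" "openin (strong_topology A) T" for H T
  proof -
    note Hc = smooth_functions_in_chart[OF H c, folded U]
    have openU: "open U" using open_cod[OF c] U by simp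
    obtain \<beta> C N where \<beta>: "smooth_map_on UNIV \<beta>" "compact C" "C \<subseteq> U" "\<And>x. x \<notin> C \<Longrightarrow> \<beta> x = 0"
      and N: "open N" "K \<subseteq> N" "\<And>x. x \<in> N \<Longrightarrow> \<beta> x = (1::real)"
      by (rule bump_function[OF K(1) openU K(2)]) (rule that; assumption)
    define \<zeta> where "\<zeta> b = lift c (\<lambda>y. \<beta> y * P b y)" for b
    let ?H = "\<lambda>a p. H p + (\<Sum>b\<in>Basis. (a \<bullet> b) * \<zeta> b p)"
    have \<zeta>_smooth: "\<zeta> b \<in> smooth_functions A" if "b \<in> Basis" for b
      unfolding \<zeta>_def
      by (rule lift_smooth[OF c smooth_map_on_subset[OF smooth_map_on_mult[OF open_UNIV \<beta>(1) P_smooth[OF that]]] \<beta>(2)])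
        (use \<beta> U in auto)
    have \<zeta>_zero: "\<zeta> b p = 0" if "p \<notin> pt c ` C" for b p
    proof -
      have "snd c p \<notin> C" if "p \<in> fst c" using that \<open>p \<notin> pt c ` C\<close> pt_chart[OF c that] by force
      then show ?thesis by (simp add: \<zeta>_def lift_def \<beta>(4))
    qed
    have "continuous_map euclidean (strong_topology A) ?H"
      using \<zeta>_smooth \<zeta>_zero compact_pt_image[OF c \<beta>(2)] \<beta>(3) U
      by (intro continuous_perturbation[OF H]) auto
    from openin_continuous_map_preimage[OF this T(2)]
    have "open {a. ?H a \<in> T}" by simp
    moreover have "0 \<in> {a. ?H a \<in> T}" using T(1) by simp
    ultimately have "\<not> negligible {a. ?H a \<in> T}"
      using open_not_negligible by blast
    then have "\<not> {a. ?H a \<in> T} \<subseteq> {a. \<exists>x\<in>U. \<exists>v\<in>V. bad (\<lambda>y. in_chart c H y + (\<Sum>b\<in>Basis. (a \<bullet> b) * P b y)) x v}"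
      using negligible_subset[OF bad_thin[OF Hc]] by (rule contrapos_nn)
    then obtain a where a: "?H a \<in> T"
      and nb: "\<not> (\<exists>x\<in>U. \<exists>v\<in>V. bad (\<lambda>y. in_chart c H y + (\<Sum>b\<in>Basis. (a \<bullet> b) * P b y)) x v)"
      by blast
    have Hs: "?H a \<in> smooth_functions A"
      by (intro smooth_functions_add smooth_functions_sum smooth_functions_mult smooth_functions_const H \<zeta>_smooth) auto
    have "\<not> bad (in_chart c (?H a)) x v" if x: "x \<in> K" and v: "v \<in> V" for x v
    proof
      assume "bad (in_chart c (?H a)) x v"
      then have "bad (\<lambda>y. in_chart c H y + (\<Sum>b\<in>Basis. (a \<bullet> b) * P b y)) x v"
      \<comment> \<open>The cut-off is 1 on \<open>N\<close>, so at points of \<open>K\<close> the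
        cut-off perturbation has the same germ as the original one.\<close>
      proof (rule bad_germ[rotated -1])
        show "open (N \<inter> U)" "N \<inter> U \<subseteq> U" "x \<in> N \<inter> U" using N openU x K(2) by auto
        show "smooth_map_on U (in_chart c (?H a))"
          using smooth_functions_in_chart[OF Hs c] U by simp
        show "smooth_map_on U (\<lambda>y. in_chart c H y + (\<Sum>b\<in>Basis. (a \<bullet> b) * P b y))"
          using smooth_map_on_subset[OF P_smooth]
          by (intro smooth_map_on_add smooth_map_on_sum smooth_map_on_mult smooth_map_on_const openU Hc) auto
        show "in_chart c (?H a) y = in_chart c H y + (\<Sum>b\<in>Basis. (a \<bullet> b) * P b y)" if "y \<in> N \<inter> U" for y
          using that U N(3) by (auto simp: in_chart_eq \<zeta>_def lift_def pt_in[OF c] chart_pt[OF c])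
      qed
      then show False using nb x v K(2) by blast
    qed
    then have "?H a \<in> good K" using Hs by (simp add: good_def)
    then show ?thesis using a by blast
  qed
  moreover have "good K \<subseteq> topspace (strong_topology A)"
    by (auto simp: good_def topspace_strong_topology)
  ultimately show ?thesis
    by (auto simp: in_closure_of topspace_strong_topology set_eq_iff)
qed

end


section \<open>The two conditions avoided by generic functions\<close>

context local_poisson
begin

text \<open>The last argument is a dummy: only the condition on Hessians below needs an auxiliary vector.\<close>

definition degenerate_jet ::
    "nat \<Rightarrow> real \<Rightarrow> 'a \<Rightarrow> ('a \<Rightarrow> real) \<Rightarrow> ('a \<Rightarrow> real) \<Rightarrow> 'a \<Rightarrow> real \<Rightarrow> bool" where
  "degenerate_jet n \<epsilon> l f h x v \<longleftrightarrow> \<epsilon> \<le> \<bar>ham h (\<lambda>y. y \<bullet> l) x\<bar> \<and> \<epsilon> \<le> \<bar>ham (\<lambda>y. y \<bullet> l) f x\<bar> \<and>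
    (\<forall>k\<in>{1..n}. (ham h ^^ k) f x = 0)"

text \<open>The bounds by \<epsilon> survive limits, unlike the conditions that the brackets be
  nonzero, and still place every bad point in \<open>transversal\<close>. The perturbations are the
  powers of \<open>x \<bullet> l\<close> with exponents 1 to \<open>n\<close>, attached to basis
  vectors through the enumeration \<open>e\<close>.\<close>

lemma thin_condition_degenerate_jet:
  fixes e :: "nat \<Rightarrow> 'b::euclidean_space"
  assumes f: "smooth_map_on U f" and \<epsilon>: "0 < \<epsilon>" and e: "bij_betw e {1..n} Basis" and dim: "DIM('a) < DIM('b)"
  shows "thin_condition U {0} n (\<lambda>b x. (x \<bullet> l) ^ inv_into {1..n} e b) (degenerate_jet n \<epsilon> l f)"
proof
  have n: "1 \<le> n" using bij_betw_same_card[OF e] dim by simp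
  have lin: "smooth_map_on S (\<lambda>y. y \<bullet> l)" for S by (rule smooth_map_on_inner_left)
  show "compact {0::real}" by simp
  show "smooth_map_on UNIV (\<lambda>x. (x \<bullet> l) ^ inv_into {1..n} e b)" for b
    by (intro smooth_map_on_power lin) simp
  show "degenerate_jet n \<epsilon> l f h' x v"
    if "open N" "N \<subseteq> U" "smooth_map_on U h" "smooth_map_on U h'"
      "\<And>y. y \<in> N \<Longrightarrow> h y = h' y" "x \<in> N" "degenerate_jet n \<epsilon> l f h x v" for N h h' x v
  proof -
    have 1: "ham h (\<lambda>y. y \<bullet> l) x = ham h' (\<lambda>y. y \<bullet> l) x"
      using ham_funpow_cong[OF that(1-3) lin that(6,5), of 1] by simp
    have "(ham h ^^ k) f x = (ham h' ^^ k) f x" for k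
      by (rule ham_funpow_cong[OF that(1-3) f that(6,5)])
    then show ?thesis using that(7) 1 by (simp add: degenerate_jet_def)
  qed
  show "degenerate_jet n \<epsilon> l f h x v"
    if h: "smooth_map_on U h" "\<And>n. smooth_map_on U (H n)" and x: "x \<in> U" "\<And>n. X n \<in> U" "X \<longlonglongrightarrow> x"
      and conv: "\<And>vs. set vs \<subseteq> Basis \<Longrightarrow> length vs \<le> n \<Longrightarrow>
        (\<lambda>n. iterated_deriv vs (H n) (X n)) \<longlonglongrightarrow> iterated_deriv vs h x"
      and bad: "\<And>m. degenerate_jet n \<epsilon> l f (H m) (X m) (W m)" for h x v H X W
  proof -
    have lim: "(\<lambda>i. (ham (H i) ^^ k) g (X i)) \<longlonglongrightarrow> (ham h ^^ k) g x"
      if "k \<le> n" "smooth_map_on U g" for k g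
      by (rule ham_funpow_tendsto[OF that(2) h x]) (use conv that in auto)
    have "\<epsilon> \<le> \<bar>ham h (\<lambda>y. y \<bullet> l) x\<bar>"
      using lim[OF n lin] bad unfolding degenerate_jet_def
      by (intro LIMSEQ_le_const[OF tendsto_rabs]) auto
    moreover have "\<epsilon> \<le> \<bar>ham (\<lambda>y. y \<bullet> l) f x\<bar>"
    proof (rule LIMSEQ_le_const[OF tendsto_rabs])
      have "isCont (ham (\<lambda>y. y \<bullet> l) f) x"
        using smooth_map_on_continuous[OF ham_smooth[OF lin f]] open_U x(1)
        by (simp add: continuous_on_eq_continuous_at)
      then show "(\<lambda>i. ham (\<lambda>y. y \<bullet> l) f (X i)) \<longlonglongrightarrow> ham (\<lambda>y. y \<bullet> l) f x"
        using x(3) isCont_tendsto_compose by blast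
    qed (use bad in \<open>auto simp: degenerate_jet_def\<close>)
    moreover have "(ham h ^^ k) f x = 0" if k: "k \<in> {1..n}" for k
    proof -
      have "(\<lambda>i. (ham (H i) ^^ k) f (X i)) = (\<lambda>i. 0)"
        using bad k by (simp add: degenerate_jet_def)
      then show ?thesis using lim[OF _ f, of k] k LIMSEQ_unique[OF _ tendsto_const] by auto
    qed
    ultimately show ?thesis by (simp add: degenerate_jet_def)
  qed
  fix h :: "'a \<Rightarrow> real" assume h: "smooth_map_on U h"
  interpret ridge_perturbation U J l h f by unfold_locales (fact h f)+
  let ?q = "\<lambda>c. \<Sum>i\<in>{1..n}. monom (c \<bullet> e i) i"
  have eq: "(\<lambda>y. h y + (\<Sum>b\<in>Basis. (c \<bullet> b) * (y \<bullet> l) ^ inv_into {1..n} e b)) = perturbed (?q c)" for c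
  proof
    fix y
    have "(\<Sum>b\<in>Basis. (c \<bullet> b) * (y \<bullet> l) ^ inv_into {1..n} e b)
        = (\<Sum>i\<in>{1..n}. (c \<bullet> e i) * (y \<bullet> l) ^ inv_into {1..n} e (e i))"
      by (rule sum.reindex_bij_betw[OF e, symmetric])
    also have "\<dots> = (\<Sum>i\<in>{1..n}. (c \<bullet> e i) * (y \<bullet> l) ^ i)"
      by (intro sum.cong refl) (simp only: bij_betw_inv_into_left[OF e])
    finally show "h y + (\<Sum>b\<in>Basis. (c \<bullet> b) * (y \<bullet> l) ^ inv_into {1..n} e b) = perturbed (?q c) y"
      by (simp add: perturbed_def jet_def poly_sum poly_monom)
  qed
  show "negligible {c. \<exists>x\<in>U. \<exists>v\<in>{0}. degenerate_jet n \<epsilon> l f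
    (\<lambda>y. h y + (\<Sum>b\<in>Basis. (c \<bullet> b) * (y \<bullet> l) ^ inv_into {1..n} e b)) x v}"
    unfolding eq
  proof (rule negligible_subset[OF negligible_bad_polynomials[OF e dim]], rule subsetI)
    fix c assume "c \<in> {c. \<exists>x\<in>U. \<exists>v\<in>{0}. degenerate_jet n \<epsilon> l f (perturbed (?q c)) x v}"
    then obtain x where x: "x \<in> U" and d: "degenerate_jet n \<epsilon> l f (perturbed (?q c)) x 0" by blast
    have "x \<in> transversal"
      using x d \<epsilon> speed_perturbed[OF x] by (auto simp: transversal_def degenerate_jet_def)
    then show "c \<in> {c. \<exists>x\<in>transversal. \<forall>k\<in>{1..n}. (ham (perturbed (?q c)) ^^ k) f x = 0}"
      using d by (auto simp: degenerate_jet_def)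
  qed
qed

end

section \<open>Critical points with degenerate Hessian\<close>

definition degenerate_critical :: "('a::euclidean_space \<Rightarrow> real) \<Rightarrow> 'a \<Rightarrow> 'a \<Rightarrow> bool" where
  "degenerate_critical h x v \<longleftrightarrow> (\<forall>j\<in>Basis. iterated_deriv [j] h x = 0) \<and>
    (\<forall>j\<in>Basis. (\<Sum>i\<in>Basis. (v \<bullet> i) * iterated_deriv [i, j] h x) = 0)"

text \<open>A perturbation family with only 2d parameters. \<open>fst c\<close> moves the
  differential freely; \<open>snd c = s\<close> adds \<open>(s \<bullet> v) b + s\<close> to the
  image of \<open>v\<close> under the Hessian when \<open>v \<bullet> b = 1\<close>, and this map of
  \<open>s\<close> is bijective.\<close>

definition quadric :: "'a::euclidean_space \<Rightarrow> 'a \<times> 'a \<Rightarrow> 'a \<Rightarrow> real" where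
  "quadric b c x = fst c \<bullet> x + (b \<bullet> x) * (snd c \<bullet> x)"

lemma smooth_quadric: "smooth_map_on S (quadric b c)"
  by (rule smooth_map_on_subset[of UNIV])
    (auto simp: quadric_def[abs_def] intro!: smooth_map_on_add smooth_map_on_mult smooth_map_on_inner_right)

lemma quadric_deriv: "iterated_deriv [j] (quadric b c) = (\<lambda>x. fst c \<bullet> j + (b \<bullet> j) * (snd c \<bullet> x) + (b \<bullet> x) * (snd c \<bullet> j))"
proof
  fix x
  have "(quadric b c has_derivative (\<lambda>v. fst c \<bullet> v + (b \<bullet> v) * (snd c \<bullet> x) + (b \<bullet> x) * (snd c \<bullet> v))) (at x)"
    unfolding quadric_def[abs_def] by (auto intro!: derivative_eq_intros)
  then show "iterated_deriv [j] (quadric b c) x = fst c \<bullet> j + (b \<bullet> j) * (snd c \<bullet> x) + (b \<bullet> x) * (snd c \<bullet> j)"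
    by (simp add: frechet_derivative_at[symmetric])
qed

lemma quadric_deriv2: "iterated_deriv [i, j] (quadric b c) x = (b \<bullet> j) * (snd c \<bullet> i) + (b \<bullet> i) * (snd c \<bullet> j)"
proof -
  have "((\<lambda>x. fst c \<bullet> j + (b \<bullet> j) * (snd c \<bullet> x) + (b \<bullet> x) * (snd c \<bullet> j)) has_derivative
      (\<lambda>v. (b \<bullet> j) * (snd c \<bullet> v) + (b \<bullet> v) * (snd c \<bullet> j))) (at x)"
    by (auto intro!: derivative_eq_intros)
  then show ?thesis
    using quadric_deriv[of j b c] by (simp add: frechet_derivative_at[symmetric])
qed

lemma quadric_basis: "(\<Sum>p\<in>Basis. (c \<bullet> p) * quadric b p x) = quadric b c x"
proof -
  have lin: "linear (\<lambda>c. quadric b c x)"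
    by (intro linearI) (simp_all add: quadric_def inner_add_left algebra_simps)
  have "quadric b (\<Sum>p\<in>Basis. (c \<bullet> p) *\<^sub>R p) x = (\<Sum>p\<in>Basis. (c \<bullet> p) * quadric b p x)"
    using linear_sum[OF lin, of "\<lambda>p. (c \<bullet> p) *\<^sub>R p" Basis] linear_scale[OF lin] by simp
  then show ?thesis by (simp add: euclidean_representation)
qed

text \<open>The equations for a degenerate critical point are linear in \<open>c\<close>. Once the
  point \<open>x\<close> and the normalized kernel vector \<open>v\<close> are given, they determine
  \<open>c\<close> completely; \<open>w\<close> is the image of \<open>v\<close> under the
  unperturbed Hessian.\<close>

lemma degenerate_critical_quadric:
  assumes U: "open U" and h: "smooth_map_on U h" and x: "x \<in> U" and v: "v \<bullet> b = 1"
    and bad: "degenerate_critical (\<lambda>y. h y + quadric b c y) x v"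
    and w: "w = (\<Sum>j\<in>Basis. (\<Sum>i\<in>Basis. (v \<bullet> i) * iterated_deriv [i, j] h x) *\<^sub>R j)"
  shows "snd c = ((w \<bullet> v) / 2) *\<^sub>R b - w" "fst c = - grad h x - (snd c \<bullet> x) *\<^sub>R b - (b \<bullet> x) *\<^sub>R snd c"
proof -
  have add: "iterated_deriv vs (\<lambda>y. h y + quadric b c y) x = iterated_deriv vs h x + iterated_deriv vs (quadric b c) x" for vs
    using smooth_map_on_sum_iterated_deriv[OF U h smooth_quadric _ x, of "{()}" vs "\<lambda>_. 1"] by simp
  have "grad h x + fst c + (snd c \<bullet> x) *\<^sub>R b + (b \<bullet> x) *\<^sub>R snd c = 0"
  proof (rule euclidean_eqI)
    fix j :: 'a assume j: "j \<in> Basis"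
    then have "iterated_deriv [j] h x + iterated_deriv [j] (quadric b c) x = 0"
      using bad add[of "[j]"] by (simp add: degenerate_critical_def)
    then show "(grad h x + fst c + (snd c \<bullet> x) *\<^sub>R b + (b \<bullet> x) *\<^sub>R snd c) \<bullet> j = 0 \<bullet> j"
      using j by (simp only: quadric_deriv) (simp add: inner_add_left grad_inner_Basis mult.commute)
  qed
  then have "fst c = - (grad h x + (snd c \<bullet> x) *\<^sub>R b + (b \<bullet> x) *\<^sub>R snd c)"
    by (subst eq_neg_iff_add_eq_0) (simp only: add_ac)
  then show "fst c = - grad h x - (snd c \<bullet> x) *\<^sub>R b - (b \<bullet> x) *\<^sub>R snd c" by simp
  have 2: "w + (snd c \<bullet> v) *\<^sub>R b + snd c = 0"
  proof (rule euclidean_eqI)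
    fix j :: 'a assume j: "j \<in> Basis"
    have "(\<Sum>i\<in>Basis. (v \<bullet> i) * (iterated_deriv [i, j] h x + ((b \<bullet> j) * (snd c \<bullet> i) + (b \<bullet> i) * (snd c \<bullet> j)))) = 0"
      using bad j unfolding degenerate_critical_def add quadric_deriv2 by blast
    then have "w \<bullet> j + (b \<bullet> j) * (\<Sum>i\<in>Basis. (v \<bullet> i) * (snd c \<bullet> i)) + (\<Sum>i\<in>Basis. (v \<bullet> i) * (b \<bullet> i)) * (snd c \<bullet> j) = 0"
      using j by (simp add: w distrib_left sum.distrib sum_distrib_left sum_distrib_right mult.commute mult.left_commute add.assoc)
    then show "(w + (snd c \<bullet> v) *\<^sub>R b + snd c) \<bullet> j = 0 \<bullet> j"
      using v by (simp add: euclidean_inner[symmetric] inner_add_left inner_commute[of "snd c" v] inner_commute[of b v] mult.commute)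
  qed
  \<comment> \<open>Pairing with \<open>v\<close> uses \<open>v \<bullet> b = 1\<close> and counts
    the unknown \<open>snd c \<bullet> v\<close> twice; this is the origin of the factor
    1/2.\<close>
  have "w \<bullet> v + (snd c \<bullet> v) + (snd c \<bullet> v) = 0"
    using arg_cong[OF 2, of "\<lambda>u. u \<bullet> v"] v by (simp add: inner_add_left inner_commute[of b])
  then have "snd c \<bullet> v = - (w \<bullet> v) / 2" by simp
  moreover have "snd c = - (w + (snd c \<bullet> v) *\<^sub>R b)"
    using 2 by (subst eq_neg_iff_add_eq_0) (simp only: add_ac)
  ultimately have "snd c = - (w + (- (w \<bullet> v) / 2) *\<^sub>R b)" by simp
  then show "snd c = ((w \<bullet> v) / 2) *\<^sub>R b - w" by simp
qed

text \<open>The bad parameters are a differentiable image of pairs (x, v) with v in an affine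
  hyperplane. Such pairs form a null set in the product space, and differentiable maps into a space
  of the same dimension preserve null sets.\<close>

lemma negligible_degenerate_critical:
  fixes U :: "'a::euclidean_space set"
  assumes U: "open U" and h: "smooth_map_on U h"
  shows "negligible {c. \<exists>x\<in>U. \<exists>v. v \<bullet> b = 1 \<and> degenerate_critical (\<lambda>y. h y + quadric b c y) x v}"
proof -
  define w where "w p = (\<Sum>j\<in>Basis. (\<Sum>i\<in>Basis. (snd p \<bullet> i) * iterated_deriv [i, j] h (fst p)) *\<^sub>R j)" for p :: "'a \<times> 'a"
  define s where "s p = ((w p \<bullet> snd p) / 2) *\<^sub>R b - w p" for p
  define t where "t p = - grad h (fst p) - (s p \<bullet> fst p) *\<^sub>R b - (b \<bullet> fst p) *\<^sub>R s p" for p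
  let ?S = "(U \<times> UNIV) \<inter> {p. (0, b) \<bullet> p = 1}"
  have d1: "(\<lambda>p. iterated_deriv vs h (fst p)) differentiable (at p)" if "fst p \<in> U" for vs and p :: "'a \<times> 'a"
    using differentiable_chain_at[of fst p "iterated_deriv vs h"]
      smooth_map_on_differentiable[OF smooth_map_on_iterated_deriv[OF h] that]
    by (simp add: o_def bounded_linear_imp_differentiable bounded_linear_fst)
  have d2: "(\<lambda>p. f p \<bullet> g p) differentiable (at p)"
    if "f differentiable (at p)" "g differentiable (at p)" for f g :: "'a \<times> 'a \<Rightarrow> 'a" and p
    using that unfolding differentiable_def by (blast intro: has_derivative_inner)
  have d4: "(\<lambda>p. k p *\<^sub>R g p) differentiable (at p)"
    if "k differentiable (at p)" "g differentiable (at p)"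
    for g :: "'a \<times> 'a \<Rightarrow> 'a" and k :: "'a \<times> 'a \<Rightarrow> real" and p
    using that unfolding differentiable_def by (blast intro: has_derivative_scaleR)
  have d3: "fst differentiable (at p)" "snd differentiable (at p)" for p :: "'a \<times> 'a"
    by (simp_all add: bounded_linear_imp_differentiable bounded_linear_fst bounded_linear_snd)
  have dw: "w differentiable (at p)" if "fst p \<in> U" for p
    unfolding w_def
    by (intro differentiable_sum differentiable_mult d1[OF that] d2 d4 d3 differentiable_const finite_Basis ballI)
  have ds: "s differentiable (at p)" if "fst p \<in> U" for p
    unfolding s_def divide_inverse
    by (intro differentiable_diff differentiable_mult d2 d4 d3 dw[OF that] differentiable_const)
  have dg: "(\<lambda>p. grad h (fst p)) differentiable (at p)" if "fst p \<in> U" for p :: "'a \<times> 'a"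
    unfolding grad_def using d1[OF that, of "[_]"]
    by (intro differentiable_sum d2 d4 d3 differentiable_const finite_Basis ballI) auto
  have dt: "t differentiable (at p)" if "fst p \<in> U" for p
    unfolding t_def
    by (intro differentiable_diff differentiable_minus d2 d4 d3 ds[OF that] dg[OF that] differentiable_const)
  have "(\<lambda>p. (t p, s p)) differentiable_on ?S"
  proof (unfold differentiable_on_def, rule ballI)
    fix p assume "p \<in> ?S"
    then have "fst p \<in> U" by auto
    obtain t' s' where "(t has_derivative t') (at p)" "(s has_derivative s') (at p)"
      using dt[OF \<open>fst p \<in> U\<close>] ds[OF \<open>fst p \<in> U\<close>] unfolding differentiable_def by blast
    from has_derivative_Pair[OF this] show "(\<lambda>p. (t p, s p)) differentiable (at p within ?S)"
      by (rule differentiable_at_withinI[OF differentiableI])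
  qed
  moreover have "negligible ?S"
    by (rule negligible_subset[OF negligible_hyperplane[of "(0, b)" 1]]) auto
  ultimately have "negligible ((\<lambda>p. (t p, s p)) ` ?S)"
    by (intro negligible_differentiable_image_negligible) auto
  then show ?thesis
  proof (rule negligible_subset, intro subsetI)
    fix c assume "c \<in> {c. \<exists>x\<in>U. \<exists>v. v \<bullet> b = 1 \<and> degenerate_critical (\<lambda>y. h y + quadric b c y) x v}"
    then obtain x v where xv: "x \<in> U" "v \<bullet> b = 1" "degenerate_critical (\<lambda>y. h y + quadric b c y) x v" by blast
    have "snd c = s (x, v)" "fst c = t (x, v)"
      using degenerate_critical_quadric[OF U h xv refl] by (simp_all add: s_def t_def w_def)
    then have "c = (t (x, v), s (x, v))" by (simp add: prod_eq_iff)
    moreover have "(x, v) \<in> ?S" using xv by (simp add: inner_commute)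
    ultimately show "c \<in> (\<lambda>p. (t p, s p)) ` ?S" by (rule image_eqI)
  qed
qed

text \<open>The normalization \<open>v \<bullet> b = 1\<close> excludes the zero vector by a closed
  condition; the bound \<open>m\<close> makes the set of witnesses compact.\<close>

lemma thin_condition_degenerate_critical:
  fixes U :: "'a::euclidean_space set"
  assumes U: "open U"
  shows "thin_condition U {v. v \<bullet> b = 1 \<and> norm v \<le> m} 2 (quadric b) degenerate_critical"
proof
  have "{v. v \<bullet> b = 1 \<and> norm v \<le> m} = {v. b \<bullet> v = 1} \<inter> cball 0 m"
    by (auto simp: inner_commute)
  then show "compact {v. v \<bullet> b = 1 \<and> norm v \<le> m}"
    by (simp add: closed_Int_compact closed_hyperplane)
  show "smooth_map_on UNIV (quadric b c)" for c by (rule smooth_quadric)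
  show "degenerate_critical h' x v"
    if "open N" "N \<subseteq> U" "smooth_map_on U h" "smooth_map_on U h'"
      "\<And>y. y \<in> N \<Longrightarrow> h y = h' y" "x \<in> N" "degenerate_critical h x v" for N h h' and x v :: 'a
    using that(7) iterated_deriv_cong[OF that(1) smooth_map_on_subset[OF that(3,2)] that(5,6)]
    unfolding degenerate_critical_def by (simp only:)
  show "degenerate_critical h x v"
    if W: "W \<longlonglongrightarrow> v" and conv: "\<And>vs. set vs \<subseteq> Basis \<Longrightarrow> length vs \<le> 2 \<Longrightarrow>
        (\<lambda>n. iterated_deriv vs (H n) (X n)) \<longlonglongrightarrow> iterated_deriv vs h x"
      and bad: "\<And>m. degenerate_critical (H m) (X m) (W m)" for h and x v :: 'a and H X W
    unfolding degenerate_critical_def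
  proof (intro conjI ballI)
    fix j :: 'a assume j: "j \<in> Basis"
    have "(\<lambda>n. iterated_deriv [j] (H n) (X n)) \<longlonglongrightarrow> iterated_deriv [j] h x"
      using j by (intro conv) auto
    moreover have "(\<lambda>n. iterated_deriv [j] (H n) (X n)) = (\<lambda>n. 0)"
      using bad j by (simp add: degenerate_critical_def)
    ultimately have "(\<lambda>n. 0) \<longlonglongrightarrow> iterated_deriv [j] h x" by (simp only:)
    then show "iterated_deriv [j] h x = 0" by (rule LIMSEQ_unique[OF _ tendsto_const])
    have "(\<lambda>n. \<Sum>i\<in>Basis. (W n \<bullet> i) * iterated_deriv [i, j] (H n) (X n))
        \<longlonglongrightarrow> (\<Sum>i\<in>Basis. (v \<bullet> i) * iterated_deriv [i, j] h x)"
      using j by (intro tendsto_sum tendsto_mult tendsto_inner W tendsto_const conv) auto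
    moreover have "(\<lambda>n. \<Sum>i\<in>Basis. (W n \<bullet> i) * iterated_deriv [i, j] (H n) (X n)) = (\<lambda>n. 0)"
      using bad j by (simp add: degenerate_critical_def)
    ultimately have "(\<lambda>n. 0) \<longlonglongrightarrow> (\<Sum>i\<in>Basis. (v \<bullet> i) * iterated_deriv [i, j] h x)" by (simp only:)
    then show "(\<Sum>i\<in>Basis. (v \<bullet> i) * iterated_deriv [i, j] h x) = 0"
      by (rule LIMSEQ_unique[OF _ tendsto_const])
  qed
  show "negligible {c. \<exists>x\<in>U. \<exists>v\<in>{v. v \<bullet> b = 1 \<and> norm v \<le> m}.
      degenerate_critical (\<lambda>y. h y + (\<Sum>p\<in>Basis. (c \<bullet> p) * quadric b p y)) x v}"
    if "smooth_map_on U h" for h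
    unfolding quadric_basis
    by (rule negligible_subset[OF negligible_degenerate_critical[OF U that, of b]]) blast
qed

section \<open>Residual properties and the two genericity statements\<close>

context smooth_atlas
begin

definition residual_property :: "(('p \<Rightarrow> real) \<Rightarrow> bool) \<Rightarrow> bool" where
  "residual_property Q \<longleftrightarrow> residual_in (strong_topology A) {H \<in> smooth_functions A. Q H}"

lemma residual_propertyI:
  assumes "countable I"
    and "\<And>i. i \<in> I \<Longrightarrow> openin (strong_topology A) (G i)"
    and "\<And>i. i \<in> I \<Longrightarrow> strong_topology A closure_of G i = topspace (strong_topology A)"
    and "\<And>H. H \<in> smooth_functions A \<Longrightarrow> (\<And>i. i \<in> I \<Longrightarrow> H \<in> G i) \<Longrightarrow> Q H"
  shows "residual_property Q"
  unfolding residual_property_def residual_in_def topspace_strong_topology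
  using assms by (intro conjI exI[of _ "G ` I"]) (auto simp: topspace_strong_topology)

lemma residual_property_countable_all:
  assumes "countable I" "\<And>i. i \<in> I \<Longrightarrow> residual_property (Q i)"
  shows "residual_property (\<lambda>H. \<forall>i\<in>I. Q i H)"
proof -
  have "\<forall>i\<in>I. \<exists>\<U>. countable \<U> \<and> (\<forall>W\<in>\<U>. openin (strong_topology A) W \<and>
      strong_topology A closure_of W = topspace (strong_topology A)) \<and>
      smooth_functions A \<inter> \<Inter>\<U> \<subseteq> {H \<in> smooth_functions A. Q i H}"
    using assms(2) by (simp add: residual_property_def residual_in_def topspace_strong_topology)
  from bchoice[OF this] obtain \<U> where \<U>: "\<forall>i\<in>I. countable (\<U> i) \<and> (\<forall>W\<in>\<U> i. openin (strong_topology A) W \<and>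
      strong_topology A closure_of W = topspace (strong_topology A)) \<and>
      smooth_functions A \<inter> \<Inter>(\<U> i) \<subseteq> {H \<in> smooth_functions A. Q i H}" ..
  show ?thesis
  proof (rule residual_propertyI[where I = "\<Union>i\<in>I. \<U> i" and G = "\<lambda>W. W"])
    show "countable (\<Union>i\<in>I. \<U> i)" using \<U> assms(1) by (intro countable_UN) auto
    show "\<forall>i\<in>I. Q i H" if H: "H \<in> smooth_functions A" "\<And>W. W \<in> (\<Union>i\<in>I. \<U> i) \<Longrightarrow> H \<in> W" for H
    proof
      fix i assume i: "i \<in> I"
      have "H \<in> smooth_functions A \<inter> \<Inter>(\<U> i)" using H i by blast
      then show "Q i H" using \<U> i by blast
    qed
  qed (use \<U> in blast)+
qed

lemma residual_property_conj:
  assumes "residual_property Q" "residual_property R"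
  shows "residual_property (\<lambda>H. Q H \<and> R H)"
proof -
  have "residual_property (\<lambda>H. \<forall>i\<in>{0, 1 :: nat}. if i = 0 then Q H else R H)"
  proof (rule residual_property_countable_all)
    show "residual_property (\<lambda>H. if i = 0 then Q H else R H)" for i :: nat
      using assms by (cases "i = 0") simp_all
  qed simp
  then show ?thesis by simp
qed

text \<open>Countable intersection over directions \<open>l\<close> in a dense set, compact pieces
  \<open>K n\<close> of the chart and bounds 1/(m+1). At a point where both gradients are nonzero,
  some such \<open>l\<close> has nonzero bracket with both functions.\<close>

lemma residual_degenerate_jet:
  assumes c: "c \<in> A" and J: "local_poisson (cod c) J" and f: "smooth_map_on (cod c) f"
  shows "residual_property (\<lambda>H. \<forall>y\<in>cod c. grad f y \<noteq> 0 \<longrightarrow> grad (in_chart c H) y \<noteq> 0 \<longrightarrow>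
    (\<exists>k\<ge>1. (local_poisson.ham J (in_chart c H) ^^ k) f y \<noteq> 0))"
proof -
  interpret local_poisson "cod c" J by (rule J)
  obtain K :: "nat \<Rightarrow> 'e set" where K: "\<And>n. compact (K n)" "\<And>n. K n \<subseteq> cod c" "\<Union>(range K) = cod c"
    by (rule open_Union_compact_subsets[OF open_cod[OF c]]) (rule that; assumption)
  obtain D :: "'e set" where D: "countable D" "\<And>X. open X \<Longrightarrow> X \<noteq> {} \<Longrightarrow> \<exists>d\<in>D. d \<in> X"
    using countable_dense_exists by blast
  \<comment> \<open>The extra factor \<open>real\<close> makes this d + 1, one more than the
    dimension of the manifold, as the dimension count for bad polynomials requires.\<close>
  let ?n = "DIM('e \<times> real)"
  obtain e where e: "bij_betw e {1..?n} (Basis :: ('e \<times> real) set)"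
    using ex_bij_betw_nat_finite_1[of "Basis :: ('e \<times> real) set"] by auto
  define G where "G = (\<lambda>(l, n, m). {H \<in> smooth_functions A. \<forall>x\<in>K n. \<forall>v\<in>{0}.
      \<not> degenerate_jet ?n (inverse (real (Suc m))) l f (in_chart c H) x v})"
  have loc: "thin_condition_on_chart A (cod c) {0::real} ?n (\<lambda>b x. (x \<bullet> l) ^ inv_into {1..?n} e b)
      (degenerate_jet ?n (inverse (real (Suc m))) l f) c" for l m
    by (intro thin_condition_on_chart.intro thin_condition_degenerate_jet[OF f _ e]
        thin_condition_on_chart_axioms.intro c refl smooth_atlas_axioms) auto
  have G_good: "G (l, n, m) = thin_condition_on_chart.good A {0::real}
      (degenerate_jet ?n (inverse (real (Suc m))) l f) c (K n)" for l n m
    unfolding G_def by (simp only: prod.case thin_condition_on_chart.good_def[OF loc])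
  show ?thesis
  proof (rule residual_propertyI[where I = "D \<times> UNIV \<times> UNIV" and G = G])
    show "countable (D \<times> (UNIV :: nat set) \<times> (UNIV :: nat set))" using D(1) by blast
    show "openin (strong_topology A) (G i)" for i
      by (cases i) (simp only: G_good thin_condition_on_chart.openin_good[OF loc K(1,2)])
    show "strong_topology A closure_of G i = topspace (strong_topology A)" for i
      by (cases i) (simp only: G_good thin_condition_on_chart.dense_good[OF loc K(1,2)])
    fix H assume H: "H \<in> smooth_functions A" "\<And>i. i \<in> D \<times> UNIV \<times> UNIV \<Longrightarrow> H \<in> G i"
    let ?h = "in_chart c H"
    show "\<forall>y\<in>cod c. grad f y \<noteq> 0 \<longrightarrow> grad ?h y \<noteq> 0 \<longrightarrow> (\<exists>k\<ge>1. (ham ?h ^^ k) f y \<noteq> 0)"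
    proof (intro ballI impI)
      fix y assume y: "y \<in> cod c" and nz: "grad f y \<noteq> 0" "grad ?h y \<noteq> 0"
      obtain a where a: "a \<noteq> 0" "\<And>l. form y (grad ?h y) l = a \<bullet> l"
        using form_nondegenerate[OF y nz(2)] by blast
      obtain b where b: "b \<noteq> 0" "\<And>l. form y (grad f y) l = b \<bullet> l"
        using form_nondegenerate[OF y nz(1)] by blast
      have "open {l. a \<bullet> l \<noteq> 0 \<and> b \<bullet> l \<noteq> 0}"
        by (intro open_Collect_conj open_Collect_neq continuous_intros)
      \<comment> \<open>Two hyperplanes do not cover the space: \<open>a + b\<close> avoids both if
        \<open>a\<close> and \<open>b\<close> are orthogonal, and \<open>a\<close> does
        otherwise.\<close>
      moreover have "{l. a \<bullet> l \<noteq> 0 \<and> b \<bullet> l \<noteq> 0} \<noteq> {}"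
      proof (cases "a \<bullet> b = 0")
        case True
        then have "a + b \<in> {l. a \<bullet> l \<noteq> 0 \<and> b \<bullet> l \<noteq> 0}"
          using a b by (simp add: inner_add_right inner_commute)
        then show ?thesis by blast
      next
        case False
        then have "a \<in> {l. a \<bullet> l \<noteq> 0 \<and> b \<bullet> l \<noteq> 0}" using a by (simp add: inner_commute)
        then show ?thesis by blast
      qed
      ultimately obtain l where l: "l \<in> D" "a \<bullet> l \<noteq> 0" "b \<bullet> l \<noteq> 0" using D(2) by blast
      obtain n where n: "y \<in> K n" using K(3) y by blast
      have "0 < min \<bar>a \<bullet> l\<bar> \<bar>b \<bullet> l\<bar>" using l by simp
      then obtain m where m: "inverse (real (Suc m)) < min \<bar>a \<bullet> l\<bar> \<bar>b \<bullet> l\<bar>"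
        using reals_Archimedean by blast
      have "\<not> degenerate_jet ?n (inverse (real (Suc m))) l f ?h y 0"
        using H(2)[of "(l, n, m)"] l(1) n by (simp add: G_def)
      moreover have "ham ?h (\<lambda>y. y \<bullet> l) y = a \<bullet> l" "ham (\<lambda>y. y \<bullet> l) f y = - (b \<bullet> l)"
        by (simp_all add: ham_def grad_linear a(2) b(2)[symmetric] form_skew[OF y, of l])
      ultimately show "\<exists>k\<ge>1. (ham ?h ^^ k) f y \<noteq> 0"
        using m by (auto simp: degenerate_jet_def)
    qed
  qed
qed

lemma residual_nondegenerate_critical:
  assumes c: "c \<in> A"
  shows "residual_property (\<lambda>H. \<forall>y\<in>cod c. \<forall>v. v \<noteq> 0 \<longrightarrow> \<not> degenerate_critical (in_chart c H) y v)"
proof -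
  obtain K :: "nat \<Rightarrow> 'e set" where K: "\<And>n. compact (K n)" "\<And>n. K n \<subseteq> cod c" "\<Union>(range K) = cod c"
    by (rule open_Union_compact_subsets[OF open_cod[OF c]]) (rule that; assumption)
  let ?V = "\<lambda>b m. {v. v \<bullet> b = 1 \<and> norm v \<le> real m}"
  define G where "G = (\<lambda>(b, n, m). {H \<in> smooth_functions A. \<forall>x\<in>K n. \<forall>v\<in>?V b m.
      \<not> degenerate_critical (in_chart c H) x v})"
  have loc: "thin_condition_on_chart A (cod c) (?V b m) 2 (quadric b) degenerate_critical c" for b m
    by (intro thin_condition_on_chart.intro thin_condition_degenerate_critical
        thin_condition_on_chart_axioms.intro c refl smooth_atlas_axioms open_cod)
  have G_good: "G (b, n, m) = thin_condition_on_chart.good A (?V b m) degenerate_critical c (K n)" for b n m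
    unfolding G_def by (simp only: prod.case thin_condition_on_chart.good_def[OF loc])
  show ?thesis
  proof (rule residual_propertyI[where I = "Basis \<times> UNIV \<times> UNIV" and G = G])
    show "countable ((Basis :: 'e set) \<times> (UNIV :: nat set) \<times> (UNIV :: nat set))"
      by (simp add: countable_finite)
    show "openin (strong_topology A) (G i)" for i
      by (cases i) (simp only: G_good thin_condition_on_chart.openin_good[OF loc K(1,2)])
    show "strong_topology A closure_of G i = topspace (strong_topology A)" for i
      by (cases i) (simp only: G_good thin_condition_on_chart.dense_good[OF loc K(1,2)])
    fix H assume H: "H \<in> smooth_functions A" "\<And>i. i \<in> Basis \<times> UNIV \<times> UNIV \<Longrightarrow> H \<in> G i"
    show "\<forall>y\<in>cod c. \<forall>v. v \<noteq> 0 \<longrightarrow> \<not> degenerate_critical (in_chart c H) y v"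
    proof (intro ballI allI impI notI)
      fix y v assume y: "y \<in> cod c" and v: "v \<noteq> 0" and bad: "degenerate_critical (in_chart c H) y v"
      obtain b where b: "b \<in> Basis" "v \<bullet> b \<noteq> 0" using v by (metis euclidean_all_zero_iff)
      obtain n where n: "y \<in> K n" using K(3) y by blast
      \<comment> \<open>Some coordinate of \<open>v\<close> is nonzero; dividing by it normalizes
        the kernel vector, and the Hessian condition is homogeneous in \<open>v\<close>.\<close>
      let ?v = "v /\<^sub>R (v \<bullet> b)"
      obtain m where m: "norm ?v \<le> real m" using real_arch_simple by blast
      have "(\<Sum>i\<in>Basis. (?v \<bullet> i) * iterated_deriv [i, j] (in_chart c H) y)
          = inverse (v \<bullet> b) * (\<Sum>i\<in>Basis. (v \<bullet> i) * iterated_deriv [i, j] (in_chart c H) y)" for j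
        by (simp add: sum_distrib_left mult.assoc)
      then have "degenerate_critical (in_chart c H) y ?v"
        using bad unfolding degenerate_critical_def by (simp del: iterated_deriv.simps)
      moreover have "?v \<in> ?V b m" using m b by simp
      ultimately show False using H(2)[of "(b, n, m)"] b n unfolding G_def by blast
    qed
  qed
qed

end


section \<open>Tangent vectors in charts\<close>

context smooth_atlas
begin

definition tvec :: "('p, 'e) chart \<Rightarrow> 'p \<Rightarrow> 'e \<Rightarrow> 'p tangent" where
  "tvec c p \<xi> f = (if f \<in> smooth_functions A then frechet_derivative (in_chart c f) (at (snd c p)) \<xi> else 0)"

lemma in_chart_differentiable:
  "f \<in> smooth_functions A \<Longrightarrow> c \<in> A \<Longrightarrow> p \<in> fst c \<Longrightarrow> in_chart c f differentiable (at (snd c p))"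
  by (rule smooth_map_on_differentiable[OF smooth_functions_in_chart chart_in])

lemma tvec_add_scale:
  assumes "c \<in> A" "p \<in> fst c"
  shows "tvec c p (a *\<^sub>R \<xi> + b *\<^sub>R \<eta>) = (\<lambda>f. a * tvec c p \<xi> f + b * tvec c p \<eta> f)"
proof
  fix f
  show "tvec c p (a *\<^sub>R \<xi> + b *\<^sub>R \<eta>) f = a * tvec c p \<xi> f + b * tvec c p \<eta> f"
  proof (cases "f \<in> smooth_functions A")
    case True
    have lin: "linear (frechet_derivative (in_chart c f) (at (snd c p)))"
      by (rule linear_frechet_derivative[OF in_chart_differentiable[OF True assms]])
    show ?thesis using True by (simp add: tvec_def linear_add[OF lin] linear_scale[OF lin])
  qed (simp add: tvec_def)
qed

lemma tvec_zero:
  assumes "c \<in> A" "p \<in> fst c"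
  shows "tvec c p 0 = (\<lambda>f. 0)"
  using tvec_add_scale[OF assms, of 0 0 0 0] by simp

lemma tvec_tangent:
  assumes "c \<in> A" "p \<in> fst c"
  shows "tvec c p \<xi> \<in> tangent_space A p"
proof -
  have diff: "in_chart c f differentiable (at (snd c p))" if "f \<in> smooth_functions A" for f
    using in_chart_differentiable[OF that assms] .
  have "tvec c p \<xi> (\<lambda>q. a * f q + b * g q) = a * tvec c p \<xi> f + b * tvec c p \<xi> g"
    if f: "f \<in> smooth_functions A" and g: "g \<in> smooth_functions A" for f g a b
  proof -
    have "(\<lambda>q. a * f q + b * g q) \<in> smooth_functions A"
      by (intro smooth_functions_add smooth_functions_mult smooth_functions_const f g)
    moreover have "((\<lambda>y. a * in_chart c f y + b * in_chart c g y) has_derivative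
        (\<lambda>v. a * frechet_derivative (in_chart c f) (at (snd c p)) v
          + b * frechet_derivative (in_chart c g) (at (snd c p)) v)) (at (snd c p))"
      using diff[OF f] diff[OF g]
      by (intro has_derivative_add has_derivative_mult_right) (simp_all add: frechet_derivative_works)
    ultimately show ?thesis
      using f g by (simp add: tvec_def in_chart_eq frechet_derivative_at[symmetric])
  qed
  moreover have "tvec c p \<xi> (\<lambda>q. f q * g q) = f p * tvec c p \<xi> g + g p * tvec c p \<xi> f"
    if f: "f \<in> smooth_functions A" and g: "g \<in> smooth_functions A" for f g
    using smooth_functions_mult[OF f g] f g frechet_derivative_mult[OF diff[OF f] diff[OF g], of \<xi>]
      pt_chart[OF assms]
    by (simp add: tvec_def in_chart_eq)
  ultimately show ?thesis by (simp add: tangent_space_def tvec_def)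
qed

lemma tangent_linear:
  "v \<in> tangent_space A p \<Longrightarrow> f \<in> smooth_functions A \<Longrightarrow> g \<in> smooth_functions A \<Longrightarrow>
    v (\<lambda>q. a * f q + b * g q) = a * v f + b * v g"
  and tangent_leibniz:
  "v \<in> tangent_space A p \<Longrightarrow> f \<in> smooth_functions A \<Longrightarrow> g \<in> smooth_functions A \<Longrightarrow>
    v (\<lambda>q. f q * g q) = f p * v g + g p * v f"
  and tangent_nonsmooth: "v \<in> tangent_space A p \<Longrightarrow> f \<notin> smooth_functions A \<Longrightarrow> v f = 0"
  by (simp_all add: tangent_space_def)

lemma tangent_const:
  assumes "v \<in> tangent_space A p"
  shows "v (\<lambda>q. r) = 0"
proof -
  have one: "v (\<lambda>q. 1) = 0"
    using tangent_leibniz[OF assms smooth_functions_const[of 1] smooth_functions_const[of 1]] by simp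
  show ?thesis
    using tangent_linear[OF assms smooth_functions_const[of 1] smooth_functions_const[of 1], of r 0] one by simp
qed

lemma tangent_add:
  "v \<in> tangent_space A p \<Longrightarrow> f \<in> smooth_functions A \<Longrightarrow> g \<in> smooth_functions A \<Longrightarrow>
    v (\<lambda>q. f q + g q) = v f + v g"
  using tangent_linear[of v p f g 1 1] by simp

lemma tangent_sum:
  assumes v: "v \<in> tangent_space A p" and "finite I" "\<And>i. i \<in> I \<Longrightarrow> f i \<in> smooth_functions A"
  shows "v (\<lambda>q. \<Sum>i\<in>I. f i q) = (\<Sum>i\<in>I. v (f i))"
  using assms(2,3)
proof (induction I rule: finite_induct)
  case empty
  show ?case using tangent_const[OF v] by simp
next
  case (insert i I)
  have "(\<lambda>q. \<Sum>i\<in>I. f i q) \<in> smooth_functions A"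
    using insert by (intro smooth_functions_sum) auto
  then show ?case using insert tangent_add[OF v, of "f i" "\<lambda>q. \<Sum>i\<in>I. f i q"] by simp
qed

lemma lift_cutoff:
  assumes c: "c \<in> A" and \<beta>: "smooth_map_on UNIV \<beta>" "compact C" "C \<subseteq> cod c" "\<And>y. y \<notin> C \<Longrightarrow> \<beta> y = 0"
    and g: "smooth_map_on (cod c) g"
  shows "lift c (\<lambda>y. \<beta> y * g y) \<in> smooth_functions A"
  by (rule lift_smooth[OF c smooth_map_on_mult[OF open_cod[OF c] smooth_map_on_subset[OF \<beta>(1)] g] \<beta>(2,3)])
    (use \<beta>(4) in auto)

text \<open>With a bump \<kappa> at \<open>p\<close> supported in \<open>W\<close>, the product of
  \<kappa> and \<open>f - g\<close> is identically 0. Since \<open>f - g\<close> vanishes at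
  \<open>p\<close> and \<kappa> is 1 there, the Leibniz rule leaves
  \<open>v (f - g) = 0\<close>.\<close>

lemma tangent_local:
  assumes v: "v \<in> tangent_space A p" and f: "f \<in> smooth_functions A" and g: "g \<in> smooth_functions A"
    and W: "open W" "p \<in> W" "\<And>q. q \<in> W \<Longrightarrow> f q = g q"
  shows "v f = v g"
proof -
  obtain c where c: "c \<in> A" "p \<in> fst c" using chart_at by blast
  define U where "U = snd c ` (W \<inter> fst c)"
  have U: "open U" "U \<subseteq> cod c" "{snd c p} \<subseteq> U"
    using open_chart_image[OF c(1), of "W \<inter> fst c"] open_dom[OF c(1)] W c(2) by (auto simp: U_def cod_def)
  obtain \<beta> C N where \<beta>: "smooth_map_on UNIV \<beta>" "compact C" "C \<subseteq> U" "\<And>y. y \<notin> C \<Longrightarrow> \<beta> y = 0"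
    and N: "{snd c p} \<subseteq> N" "\<And>y. y \<in> N \<Longrightarrow> \<beta> y = (1::real)"
    by (rule bump_function[OF compact_sing U(1,3)]) (rule that; assumption)
  define \<kappa> where "\<kappa> = lift c (\<lambda>y. \<beta> y * 1)"
  have \<kappa>: "\<kappa> \<in> smooth_functions A"
    unfolding \<kappa>_def by (rule lift_cutoff[OF c(1) \<beta>(1,2) _ \<beta>(4) smooth_map_on_const]) (use \<beta>(3) U in auto)
  have "\<kappa> p = 1" using N c(2) by (simp add: \<kappa>_def lift_def)
  let ?h = "\<lambda>q. 1 * f q + (- 1) * g q"
  have h: "?h \<in> smooth_functions A"
    by (intro smooth_functions_add smooth_functions_mult smooth_functions_const f g)
  have "(\<lambda>q. \<kappa> q * ?h q) = (\<lambda>q. 0)"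
  proof
    fix q
    show "\<kappa> q * ?h q = 0"
    proof (cases "q \<in> fst c \<and> snd c q \<in> C")
      case True
      then obtain q' where "q' \<in> W \<inter> fst c" "snd c q = snd c q'" using \<beta>(3) by (auto simp: U_def)
      then have "q \<in> W" using True pt_chart[OF c(1)] by (metis IntD1 IntD2)
      then show ?thesis using W(3) by simp
    next
      case False
      then show ?thesis using \<beta>(4) by (auto simp: \<kappa>_def lift_def)
    qed
  qed
  then have "0 = \<kappa> p * v ?h + ?h p * v \<kappa>"
    using tangent_leibniz[OF v \<kappa> h] tangent_const[OF v, of 0] by simp
  then have "v ?h = 0" using W(2,3) \<open>\<kappa> p = 1\<close> by simp
  then show ?thesis using tangent_linear[OF v f g, of 1 "- 1"] by simp
qed

text \<open>The functions \<open>u b\<close> are the coordinates centred at \<open>p\<close>, cut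
  off to be globally smooth. By Hadamard's lemma every smooth function is near \<open>p\<close> its
  value at \<open>p\<close> plus a sum of products \<open>u b * w b\<close>, so a derivation is
  determined by its values on the \<open>u b\<close>.\<close>

lemma tangent_chart:
  assumes c: "c \<in> A" "p \<in> fst c"
  obtains u where "\<And>b. u b \<in> smooth_functions A"
    "\<And>v. v \<in> tangent_space A p \<Longrightarrow> v = tvec c p (\<Sum>b\<in>Basis. v (u b) *\<^sub>R b)"
    "\<And>\<xi> b. tvec c p \<xi> (u b) = \<xi> \<bullet> b"
proof -
  define x where "x = snd c p"
  have x: "x \<in> cod c" using c chart_in by (simp add: x_def)
  obtain r where r: "0 < r" "ball x r \<subseteq> cod c" using open_cod[OF c(1)] x open_contains_ball by blast
  have xr: "{x} \<subseteq> ball x r" using r by simp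
  obtain \<beta> C N where \<beta>: "smooth_map_on UNIV \<beta>" "compact C" "C \<subseteq> ball x r" "\<And>y. y \<notin> C \<Longrightarrow> \<beta> y = 0"
    and N: "open N" "{x} \<subseteq> N" "\<And>y. y \<in> N \<Longrightarrow> \<beta> y = (1::real)"
    by (rule bump_function[OF compact_sing open_ball xr]) (rule that; assumption)
  have C: "C \<subseteq> cod c" using \<beta>(3) r by blast
  define u where "u b = lift c (\<lambda>y. \<beta> y * ((y - x) \<bullet> b))" for b
  have lin: "smooth_map_on S (\<lambda>y. (y - x) \<bullet> b)" if "open S" for S and b :: 'e
    unfolding inner_diff_left by (intro smooth_map_on_diff smooth_map_on_inner_left smooth_map_on_const that)
  have u: "u b \<in> smooth_functions A" for b
    unfolding u_def by (rule lift_cutoff[OF c(1) \<beta>(1,2) C \<beta>(4) lin[OF open_cod[OF c(1)]]])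
  define W where "W = {q \<in> fst c. snd c q \<in> N \<inter> ball x r}"
  have W: "open W" "p \<in> W"
    unfolding W_def using open_chart_preimage[OF c(1), of "N \<inter> ball x r"] N r c(2) by (auto simp: x_def)
  have uW: "u b q = (snd c q - x) \<bullet> b" if "q \<in> W" for q b
    using that N by (auto simp: W_def u_def lift_def)
  have "tvec c p \<xi> (u b) = \<xi> \<bullet> b" for \<xi> b
  proof -
    have "frechet_derivative (in_chart c (u b)) (at x) = frechet_derivative (\<lambda>y. (y - x) \<bullet> b) (at x)"
    proof (rule frechet_derivative_cong[of "N \<inter> ball x r"])
      show "smooth_map_on (N \<inter> ball x r) (in_chart c (u b))"
        by (rule smooth_map_on_subset[OF smooth_functions_in_chart[OF u c(1)]]) (use r in blast)
      show "in_chart c (u b) y = (y - x) \<bullet> b" if "y \<in> N \<inter> ball x r" for y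
        using that r N(3) by (subst u_def, subst in_chart_lift[OF c(1)]) auto
    qed (use N r in auto)
    moreover have "((\<lambda>y. (y - x) \<bullet> b) has_derivative (\<lambda>v. v \<bullet> b)) (at x)"
      by (auto intro!: derivative_eq_intros)
    ultimately show ?thesis
      using u by (simp add: tvec_def x_def[symmetric] frechet_derivative_at[symmetric])
  qed
  moreover have "v = tvec c p (\<Sum>b\<in>Basis. v (u b) *\<^sub>R b)" if v: "v \<in> tangent_space A p" for v
  proof
    fix f
    show "v f = tvec c p (\<Sum>b\<in>Basis. v (u b) *\<^sub>R b) f"
    proof (cases "f \<in> smooth_functions A")
      case True
      let ?f = "in_chart c f"
      have fs: "smooth_map_on (cod c) ?f" using smooth_functions_in_chart[OF True c(1)] .
      obtain g where g: "\<And>b. smooth_map_on (ball x r) (g b)"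
        "\<And>b. g b x = frechet_derivative ?f (at x) b"
        "\<And>y. y \<in> ball x r \<Longrightarrow> ?f y = ?f x + (\<Sum>b\<in>Basis. ((y - x) \<bullet> b) * g b y)"
        by (rule hadamard[OF smooth_map_on_subset[OF fs r(2)]]) (rule that; assumption)
      \<comment> \<open>Hadamard's coefficients are smooth on the ball only; the cut-off, supported
        inside the ball, permits the extension by 0.\<close>
      define w where "w b = lift c (\<lambda>y. if y \<in> ball x r then \<beta> y * g b y else 0)" for b
      have w: "w b \<in> smooth_functions A" for b
        unfolding w_def
      proof (rule lift_smooth[OF c(1) smooth_map_on_subset[OF smooth_map_on_extend_zero] \<beta>(2) C])
        show "smooth_map_on (ball x r) (\<lambda>y. \<beta> y * g b y)"
          by (intro smooth_map_on_mult open_ball smooth_map_on_subset[OF \<beta>(1)] g(1)) simp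
      qed (use \<beta> compact_imp_closed in auto)
      have wp: "w b p = frechet_derivative ?f (at x) b" for b
        using c(2) r(1) N g(2) by (simp add: w_def lift_def x_def)
      have up: "u b p = 0" for b using uW[OF W(2)] by (simp add: x_def)
      let ?F = "\<lambda>q. f p + (\<Sum>b\<in>Basis. u b q * w b q)"
      have uw: "(\<lambda>q. u b q * w b q) \<in> smooth_functions A" for b
        by (intro smooth_functions_mult u w)
      have sum: "(\<lambda>q. \<Sum>b\<in>Basis. u b q * w b q) \<in> smooth_functions A"
        by (intro smooth_functions_sum uw finite_Basis)
      have "f q = ?F q" if "q \<in> W" for q
      proof -
        have q: "q \<in> fst c" "snd c q \<in> N" "snd c q \<in> ball x r" using that by (auto simp: W_def)
        have "f q = ?f (snd c q)" using pt_chart[OF c(1) q(1)] by (simp add: in_chart_eq)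
        also have "\<dots> = ?f x + (\<Sum>b\<in>Basis. ((snd c q - x) \<bullet> b) * g b (snd c q))" by (rule g(3)[OF q(3)])
        also have "?f x = f p" using pt_chart[OF c] by (simp add: in_chart_eq x_def)
        also have "(\<Sum>b\<in>Basis. ((snd c q - x) \<bullet> b) * g b (snd c q)) = (\<Sum>b\<in>Basis. u b q * w b q)"
          using uW[OF that] q N(3) by (intro sum.cong) (simp_all add: w_def lift_def)
        finally show ?thesis .
      qed
      then have "v f = v ?F"
        by (intro tangent_local[OF v True _ W] smooth_functions_add smooth_functions_const sum)
      also have "\<dots> = v (\<lambda>q. \<Sum>b\<in>Basis. u b q * w b q)"
        using tangent_add[OF v smooth_functions_const sum] tangent_const[OF v] by simp
      also have "\<dots> = (\<Sum>b\<in>Basis. v (\<lambda>q. u b q * w b q))"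
        by (rule tangent_sum[OF v finite_Basis uw])
      \<comment> \<open>In the Leibniz rule the other term vanishes because \<open>u b\<close> is 0
        at \<open>p\<close>, and \<open>w b\<close> takes the value of the partial derivative
        there.\<close>
      also have "\<dots> = (\<Sum>b\<in>Basis. v (u b) * frechet_derivative ?f (at x) b)"
        using tangent_leibniz[OF v u w] up wp by (simp add: mult.commute)
      also have "\<dots> = frechet_derivative ?f (at x) (\<Sum>b\<in>Basis. v (u b) *\<^sub>R b)"
        by (subst frechet_derivative_basis[OF smooth_map_on_differentiable[OF fs x], of "\<Sum>b\<in>Basis. v (u b) *\<^sub>R b"]) simp
      finally show ?thesis using True by (simp add: tvec_def x_def)
    next
      case False
      then show ?thesis using tangent_nonsmooth[OF v] by (simp add: tvec_def)
    qed
  qed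
  ultimately show ?thesis using that[of u] u by blast
qed

lemma tangent_eq_tvec:
  assumes "c \<in> A" "p \<in> fst c" "v \<in> tangent_space A p"
  obtains \<xi> where "v = tvec c p \<xi>"
proof -
  obtain u where u: "\<And>v. v \<in> tangent_space A p \<Longrightarrow> v = tvec c p (\<Sum>b\<in>Basis. v (u b) *\<^sub>R b)"
    by (rule tangent_chart[OF assms(1,2)]) (rule that; assumption)
  show ?thesis by (rule that[OF u[OF assms(3)]])
qed

lemma tvec_inject:
  assumes "c \<in> A" "p \<in> fst c" "tvec c p \<xi> = tvec c p \<eta>"
  shows "\<xi> = \<eta>"
proof -
  obtain u where u: "\<And>\<xi> b. tvec c p \<xi> (u b) = \<xi> \<bullet> b"
    by (rule tangent_chart[OF assms(1,2)]) (rule that; assumption)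
  show ?thesis
    by (rule euclidean_eqI) (metis u assms(3))
qed

lemma critical_pointI:
  assumes "c \<in> A" "p \<in> fst c" "F \<in> smooth_functions A" "grad (in_chart c F) (snd c p) = 0"
  shows "p \<in> critical_points A F"
  unfolding critical_points_def
proof (intro CollectI ballI)
  fix v assume "v \<in> tangent_space A p"
  then obtain \<xi> where "v = tvec c p \<xi>" using tangent_eq_tvec assms(1,2) by blast
  then show "v F = 0"
    using assms(3,4) grad_inner[OF in_chart_differentiable[OF assms(3,1,2)], of \<xi>] by (simp add: tvec_def)
qed

text \<open>A coordinate vector field made global. Smoothness of \<omega> is stated for globally
  defined vector fields, so coordinate fields must be extended before it can be tested on
  them.\<close>

definition cutoff_field :: "('p, 'e) chart \<Rightarrow> ('e \<Rightarrow> real) \<Rightarrow> 'e \<Rightarrow> 'p \<Rightarrow> 'p tangent" where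
  "cutoff_field c \<beta> b p = (if p \<in> fst c then tvec c p (\<beta> (snd c p) *\<^sub>R b) else (\<lambda>f. 0))"

lemma smooth_cutoff_field:
  assumes c: "c \<in> A" and \<beta>: "smooth_map_on UNIV \<beta>" "compact C" "C \<subseteq> cod c" "\<And>y. y \<notin> C \<Longrightarrow> \<beta> y = 0"
  shows "smooth_vector_field A (cutoff_field c \<beta> b)"
  unfolding smooth_vector_field_def
proof (intro conjI allI ballI)
  show "cutoff_field c \<beta> b p \<in> tangent_space A p" for p
    using tvec_tangent[OF c] by (auto simp: cutoff_field_def) (simp add: tangent_space_def)
  fix f assume f: "f \<in> smooth_functions A"
  let ?d = "\<lambda>y. frechet_derivative (in_chart c f) (at y) b"
  have "cutoff_field c \<beta> b p f = lift c (\<lambda>y. \<beta> y * ?d y) p" for p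
  proof (cases "p \<in> fst c")
    case True
    have "linear (frechet_derivative (in_chart c f) (at (snd c p)))"
      by (rule linear_frechet_derivative[OF in_chart_differentiable[OF f c True]])
    then show ?thesis using True f by (simp add: cutoff_field_def lift_def tvec_def linear_scale)
  qed (simp add: cutoff_field_def lift_def)
  moreover have "lift c (\<lambda>y. \<beta> y * ?d y) \<in> smooth_functions A"
    by (rule lift_cutoff[OF c \<beta> smooth_map_on_deriv[OF smooth_functions_in_chart[OF f c]]])
  ultimately show "(\<lambda>p. cutoff_field c \<beta> b p f) \<in> smooth_functions A" by presburger
qed

end

section \<open>Hamiltonian vector fields in charts\<close>

locale nondegenerate_form = smooth_atlas +
  fixes \<omega> :: "'a two_form"
  assumes smooth_form: "smooth_two_form A \<omega>" and nondegenerate: "nondegenerate_two_form A \<omega>"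
begin

definition coeff_form :: "('a, 'b) chart \<Rightarrow> 'b \<Rightarrow> 'b \<Rightarrow> 'b \<Rightarrow> real" where
  "coeff_form c i j y = \<omega> (pt c y) (tvec c (pt c y) i) (tvec c (pt c y) j)"

lemma form_skew: "u \<in> tangent_space A p \<Longrightarrow> v \<in> tangent_space A p \<Longrightarrow> \<omega> p u v = - \<omega> p v u"
  using smooth_form unfolding smooth_two_form_def by blast

lemma form_nondegenerateD:
  "v \<in> tangent_space A p \<Longrightarrow> (\<And>w. w \<in> tangent_space A p \<Longrightarrow> \<omega> p v w = 0) \<Longrightarrow> v = (\<lambda>f. 0)"
  using nondegenerate by (simp add: nondegenerate_two_form_def)

lemma linear_form_left:
  assumes "c \<in> A" "p \<in> fst c" "w \<in> tangent_space A p"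
  shows "linear (\<lambda>\<xi>. \<omega> p (tvec c p \<xi>) w)"
proof -
  have 1: "\<omega> p (tvec c p (a *\<^sub>R \<xi> + b *\<^sub>R \<eta>)) w = a * \<omega> p (tvec c p \<xi>) w + b * \<omega> p (tvec c p \<eta>) w" for a b \<xi> \<eta>
    unfolding tvec_add_scale[OF assms(1,2)]
    using smooth_form tvec_tangent[OF assms(1,2)] assms(3) unfolding smooth_two_form_def by blast
  show ?thesis
    using 1[of 1 _ 1] 1[of _ _ 0] by (intro linearI) simp_all
qed

lemma linear_form_right:
  assumes "c \<in> A" "p \<in> fst c" "w \<in> tangent_space A p"
  shows "linear (\<lambda>\<xi>. \<omega> p w (tvec c p \<xi>))"
proof -
  have "linear (\<lambda>\<xi>. - \<omega> p (tvec c p \<xi>) w)"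
    using linear_compose_neg[OF linear_form_left[OF assms]] .
  moreover have "(\<lambda>\<xi>. - \<omega> p (tvec c p \<xi>) w) = (\<lambda>\<xi>. \<omega> p w (tvec c p \<xi>))"
    using form_skew[OF assms(3) tvec_tangent[OF assms(1,2)]] by (simp add: fun_eq_iff)
  ultimately show ?thesis by simp
qed

lemma form_coeff:
  assumes c: "c \<in> A" and y: "y \<in> cod c"
  shows "\<omega> (pt c y) (tvec c (pt c y) \<xi>) (tvec c (pt c y) \<eta>)
    = (\<Sum>j\<in>Basis. (\<eta> \<bullet> j) * (\<Sum>i\<in>Basis. (\<xi> \<bullet> i) * coeff_form c i j y))"
proof -
  note p = pt_in[OF c y]
  let ?t = "tvec c (pt c y)"
  have "\<omega> (pt c y) (?t \<xi>) (?t (\<Sum>j\<in>Basis. (\<eta> \<bullet> j) *\<^sub>R j)) = (\<Sum>j\<in>Basis. (\<eta> \<bullet> j) * \<omega> (pt c y) (?t \<xi>) (?t j))"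
    using linear_sum[OF linear_form_right[OF c p tvec_tangent[OF c p, of \<xi>]], of "\<lambda>j. (\<eta> \<bullet> j) *\<^sub>R j" Basis]
      linear_scale[OF linear_form_right[OF c p tvec_tangent[OF c p]]] by simp
  moreover have "\<omega> (pt c y) (?t (\<Sum>i\<in>Basis. (\<xi> \<bullet> i) *\<^sub>R i)) (?t j) = (\<Sum>i\<in>Basis. (\<xi> \<bullet> i) * coeff_form c i j y)" for j
    using linear_sum[OF linear_form_left[OF c p tvec_tangent[OF c p, of j]], of "\<lambda>i. (\<xi> \<bullet> i) *\<^sub>R i" Basis]
      linear_scale[OF linear_form_left[OF c p tvec_tangent[OF c p]]] by (simp add: coeff_form_def)
  ultimately show ?thesis by (simp add: euclidean_representation)
qed

text \<open>Near a given point the cut-off fields equal the coordinate fields, so the coefficient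
  agrees there with a globally smooth function.\<close>

lemma coeff_form_smooth:
  assumes c: "c \<in> A"
  shows "smooth_map_on (cod c) (coeff_form c i j)"
proof (rule smooth_map_on_local)
  fix y assume y: "y \<in> cod c"
  then have y': "{y} \<subseteq> cod c" by simp
  obtain \<beta> C N where \<beta>: "smooth_map_on UNIV \<beta>" "compact C" "C \<subseteq> cod c" "\<And>y. y \<notin> C \<Longrightarrow> \<beta> y = 0"
    and N: "open N" "{y} \<subseteq> N" "\<And>y. y \<in> N \<Longrightarrow> \<beta> y = (1::real)"
    by (rule bump_function[OF compact_sing open_cod[OF c] y']) (rule that; assumption)
  let ?X = "cutoff_field c \<beta>"
  have "(\<lambda>p. \<omega> p (?X i p) (?X j p)) \<in> smooth_functions A"
    using smooth_form smooth_cutoff_field[OF c \<beta>] unfolding smooth_two_form_def by blast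
  from smooth_functions_in_chart[OF this c]
  have "smooth_map_on (N \<inter> cod c) (in_chart c (\<lambda>p. \<omega> p (?X i p) (?X j p)))"
    by (rule smooth_map_on_subset) simp
  then have "smooth_map_on (N \<inter> cod c) (coeff_form c i j)"
    by (rule smooth_map_on_cong[rotated])
      (use N open_cod[OF c] in \<open>auto simp: in_chart_eq coeff_form_def cutoff_field_def pt_in[OF c] chart_pt[OF c]\<close>)
  then show "\<exists>T. open T \<and> y \<in> T \<and> smooth_map_on T (coeff_form c i j)"
    using N open_cod[OF c] y by (intro exI[of _ "N \<inter> cod c"]) auto
qed

lemma coeff_form_nondegenerate:
  assumes c: "c \<in> A" and y: "y \<in> cod c" and z: "\<And>j. j \<in> Basis \<Longrightarrow> (\<Sum>i\<in>Basis. (\<xi> \<bullet> i) * coeff_form c i j y) = 0"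
  shows "\<xi> = 0"
proof -
  note p = pt_in[OF c y]
  have zero: "\<omega> (pt c y) (tvec c (pt c y) \<xi>) w = 0" if w: "w \<in> tangent_space A (pt c y)" for w
  proof -
    obtain \<eta> where "w = tvec c (pt c y) \<eta>" using tangent_eq_tvec[OF c p w] .
    then show ?thesis using form_coeff[OF c y] z by simp
  qed
  have "tvec c (pt c y) \<xi> = tvec c (pt c y) 0"
    unfolding tvec_zero[OF c p] by (rule form_nondegenerateD[OF tvec_tangent[OF c p] zero])
  then show ?thesis by (rule tvec_inject[OF c p])
qed

text \<open>For a basis vector \<open>k\<close> this is the Hamiltonian vector of the coordinate
  function in direction \<open>k\<close>, hence a row of the inverse matrix of \<omega>. The choice
  is unique at points of \<open>cod c\<close> by nondegeneracy.\<close>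

definition dual :: "('a, 'b) chart \<Rightarrow> 'b \<Rightarrow> 'b \<Rightarrow> 'b" where
  "dual c k y = (SOME \<xi>. \<forall>j\<in>Basis. (\<Sum>i\<in>Basis. (\<xi> \<bullet> i) * coeff_form c i j y) = (if j = k then 1 else 0))"

definition poisson :: "('a, 'b) chart \<Rightarrow> 'b \<Rightarrow> 'b \<Rightarrow> 'b \<Rightarrow> real" where
  "poisson c k i y = dual c k y \<bullet> i"

text \<open>Elimination gives a solution with smooth coefficients near \<open>y0\<close>; by
  nondegeneracy the solution picked by \<open>SOME\<close> equals it, so the pointwise choice is
  smooth.\<close>

lemma dual_local:
  assumes c: "c \<in> A" and y0: "y0 \<in> cod c"
  obtains N x where "open N" "y0 \<in> N" "N \<subseteq> cod c" "\<And>i. i \<in> Basis \<Longrightarrow> smooth_map_on N (x i)"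
    "\<And>y. y \<in> N \<Longrightarrow> dual c k y = (\<Sum>i\<in>Basis. x i y *\<^sub>R i)"
    "\<And>y j. y \<in> N \<Longrightarrow> j \<in> Basis \<Longrightarrow> (\<Sum>i\<in>Basis. (dual c k y \<bullet> i) * coeff_form c i j y) = (if j = k then 1 else 0)"
proof -
  have "\<exists>N' x. open N' \<and> y0 \<in> N' \<and> N' \<subseteq> cod c \<and> (\<forall>i\<in>Basis. smooth_map_on N' (x i)) \<and>
    (\<forall>y\<in>N'. \<forall>j\<in>Basis. (\<Sum>i\<in>Basis. x i y * coeff_form c i j y) = (if j = k then 1 else 0))"
  proof (rule smooth_linear_system[OF finite_Basis finite_Basis refl open_cod[OF c] y0])
    fix a assume a: "\<And>j. j \<in> Basis \<Longrightarrow> (\<Sum>i\<in>Basis. a i * coeff_form c i j y0) = 0"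
    have "(\<Sum>i\<in>Basis. a i *\<^sub>R i) = (0 :: 'b)"
      by (rule coeff_form_nondegenerate[OF c y0]) (use a in simp)
    then show "\<forall>i\<in>Basis. a i = 0" by (metis inner_sum_left_Basis inner_zero_left)
  qed (auto intro: coeff_form_smooth[OF c] smooth_map_on_const)
  then obtain N x where N: "open N" "y0 \<in> N" "N \<subseteq> cod c" and x: "\<And>i. i \<in> Basis \<Longrightarrow> smooth_map_on N (x i)"
    and sol: "\<And>y j. y \<in> N \<Longrightarrow> j \<in> Basis \<Longrightarrow> (\<Sum>i\<in>Basis. x i y * coeff_form c i j y) = (if j = k then 1 else 0)"
    by blast
  have dual: "\<forall>j\<in>Basis. (\<Sum>i\<in>Basis. (dual c k y \<bullet> i) * coeff_form c i j y) = (if j = k then 1 else 0)" if "y \<in> N" for y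
    unfolding dual_def
    by (rule someI[of "\<lambda>\<xi>. \<forall>j\<in>Basis. (\<Sum>i\<in>Basis. (\<xi> \<bullet> i) * coeff_form c i j y) = (if j = k then 1 else 0)"
          "\<Sum>i\<in>Basis. x i y *\<^sub>R i"])
      (use sol[OF that] in simp)
  have "dual c k y - (\<Sum>i\<in>Basis. x i y *\<^sub>R i) = 0" if "y \<in> N" for y
  proof (rule coeff_form_nondegenerate[OF c])
    show "y \<in> cod c" using that N by blast
    show "(\<Sum>i\<in>Basis. (dual c k y - (\<Sum>i\<in>Basis. x i y *\<^sub>R i)) \<bullet> i * coeff_form c i j y) = 0"
      if "j \<in> Basis" for j
      using dual[OF \<open>y \<in> N\<close>] sol[OF \<open>y \<in> N\<close> that] that
      by (simp add: inner_diff_left left_diff_distrib sum_subtractf)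
  qed
  then show ?thesis using that[OF N x] dual by simp
qed

lemma dual_solution:
  assumes "c \<in> A" "y \<in> cod c" "j \<in> Basis"
  shows "(\<Sum>i\<in>Basis. (dual c k y \<bullet> i) * coeff_form c i j y) = (if j = k then 1 else 0)"
  by (rule dual_local[OF assms(1,2), of k]) (use assms(3) in blast)

text \<open>The coordinates of the Hamiltonian vector of any function whose gradient at
  \<open>y\<close> is \<open>a\<close>, as \<open>ham_vec_solution\<close> confirms.\<close>

definition ham_vec :: "('a, 'b) chart \<Rightarrow> 'b \<Rightarrow> 'b \<Rightarrow> 'b" where
  "ham_vec c a y = (\<Sum>j\<in>Basis. (\<Sum>i\<in>Basis. poisson c i j y * (a \<bullet> i)) *\<^sub>R j)"

lemma ham_vec_solution:
  assumes c: "c \<in> A" and y: "y \<in> cod c" and k: "k \<in> Basis"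
  shows "(\<Sum>j\<in>Basis. (ham_vec c a y \<bullet> j) * coeff_form c j k y) = a \<bullet> k"
proof -
  have "(\<Sum>j\<in>Basis. (ham_vec c a y \<bullet> j) * coeff_form c j k y)
      = (\<Sum>j\<in>Basis. \<Sum>i\<in>Basis. (a \<bullet> i) * ((dual c i y \<bullet> j) * coeff_form c j k y))"
    by (simp add: ham_vec_def poisson_def sum_distrib_right sum_distrib_left mult_ac)
  also have "\<dots> = (\<Sum>i\<in>Basis. (a \<bullet> i) * (\<Sum>j\<in>Basis. (dual c i y \<bullet> j) * coeff_form c j k y))"
    by (subst sum.swap) (simp add: sum_distrib_left)
  also have "\<dots> = a \<bullet> k"
    using k by (simp add: dual_solution[OF c y k] if_distrib[of "(*) _"] cong: if_cong)
  finally show ?thesis .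
qed

lemma ham_vec_eq_zeroD:
  assumes "c \<in> A" "y \<in> cod c" "ham_vec c a y = 0"
  shows "a = 0"
proof (rule euclidean_eqI)
  fix k :: 'b assume "k \<in> Basis"
  then show "a \<bullet> k = 0 \<bullet> k" using ham_vec_solution[OF assms(1,2), of k a] assms(3) by simp
qed

lemma local_poisson_chart:
  assumes c: "c \<in> A"
  shows "local_poisson (cod c) (poisson c)"
proof
  show "open (cod c)" by (rule open_cod[OF c])
  show "smooth_map_on (cod c) (poisson c k i)" if "i \<in> Basis" for k i
  proof (rule smooth_map_on_local)
    fix y assume "y \<in> cod c"
    then obtain N x where N: "open N" "y \<in> N" "\<And>i. i \<in> Basis \<Longrightarrow> smooth_map_on N (x i)"
      "\<And>y. y \<in> N \<Longrightarrow> dual c k y = (\<Sum>i\<in>Basis. x i y *\<^sub>R i)"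
      by (rule dual_local[OF c, of y k]) (rule that; assumption)
    have "smooth_map_on N (poisson c k i)"
      by (rule smooth_map_on_cong[OF N(1) N(3)[OF that]]) (simp add: poisson_def N(4) that)
    then show "\<exists>T. open T \<and> y \<in> T \<and> smooth_map_on T (poisson c k i)" using N by blast
  qed
  show "(\<Sum>i\<in>Basis. \<Sum>j\<in>Basis. poisson c i j y * (a \<bullet> i) * (a \<bullet> j)) = 0" if y: "y \<in> cod c" for y a
  proof -
    note p = pt_in[OF c y]
    let ?\<xi> = "ham_vec c a y"
    have "(\<Sum>i\<in>Basis. \<Sum>j\<in>Basis. poisson c i j y * (a \<bullet> i) * (a \<bullet> j)) = (\<Sum>j\<in>Basis. (?\<xi> \<bullet> j) * (a \<bullet> j))"
      by (subst sum.swap) (simp add: ham_vec_def sum_distrib_right)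
    \<comment> \<open>Since the form sends \<open>?\<xi>\<close> to the covector \<open>a\<close>,
      pairing \<open>?\<xi>\<close> with \<open>a\<close> is \<omega> evaluated twice on
      \<open>?\<xi>\<close>; thus the inverse matrix inherits the alternating property.\<close>
    also have "\<dots> = \<omega> (pt c y) (tvec c (pt c y) ?\<xi>) (tvec c (pt c y) ?\<xi>)"
      unfolding form_coeff[OF c y] by (intro sum.cong refl) (simp add: ham_vec_solution[OF c y])
    also have "\<dots> = 0"
      using form_skew[OF tvec_tangent[OF c p] tvec_tangent[OF c p], of ?\<xi> ?\<xi>] by simp
    finally show ?thesis .
  qed
  show "a = 0" if y: "y \<in> cod c" and z: "\<And>j. j \<in> Basis \<Longrightarrow> (\<Sum>i\<in>Basis. poisson c i j y * (a \<bullet> i)) = 0" for y a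
  proof -
    have "ham_vec c a y = 0" using z by (simp add: ham_vec_def)
    then show ?thesis by (rule ham_vec_eq_zeroD[OF c y])
  qed
qed

abbreviation "chart_ham c \<equiv> local_poisson.ham (poisson c)"

lemma chart_ham_eq: "c \<in> A \<Longrightarrow> chart_ham c h f y = ham_vec c (grad h y) y \<bullet> grad f y"
  using local_poisson.form_left_vector[OF local_poisson_chart]
  by (simp add: local_poisson.ham_def[OF local_poisson_chart] ham_vec_def)

text \<open>Resolves the definite description: \<open>ham_vec\<close> provides a solution, and the
  difference of two solutions lies in the kernel of \<omega>.\<close>

lemma hamiltonian_vector_field_chart:
  assumes c: "c \<in> A" and p: "p \<in> fst c" and H: "H \<in> smooth_functions A"
  shows "hamiltonian_vector_field A \<omega> H p = tvec c p (ham_vec c (grad (in_chart c H) (snd c p)) (snd c p))"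
  unfolding hamiltonian_vector_field_def
proof (rule the_equality)
  let ?y = "snd c p" and ?h = "in_chart c H"
  let ?\<xi> = "ham_vec c (grad ?h ?y) ?y"
  have y: "?y \<in> cod c" "pt c ?y = p" using chart_in[OF c p] pt_chart[OF c p] by auto
  have eq: "\<omega> p (tvec c p ?\<xi>) w = w H" if w: "w \<in> tangent_space A p" for w
  proof -
    obtain \<eta> where \<eta>: "w = tvec c p \<eta>" using tangent_eq_tvec[OF c p w] .
    have "\<omega> p (tvec c p ?\<xi>) w = (\<Sum>j\<in>Basis. (\<eta> \<bullet> j) * (grad ?h ?y \<bullet> j))"
      using form_coeff[OF c y(1), of ?\<xi> \<eta>] unfolding \<eta> y(2) by (simp add: ham_vec_solution[OF c y(1)])
    also have "\<dots> = grad ?h ?y \<bullet> \<eta>"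
      by (subst euclidean_inner) (simp add: mult.commute)
    also have "\<dots> = w H"
      using H by (simp add: \<eta> tvec_def grad_inner[OF in_chart_differentiable[OF H c p]])
    finally show ?thesis .
  qed
  then show "tvec c p ?\<xi> \<in> tangent_space A p \<and> (\<forall>w\<in>tangent_space A p. \<omega> p (tvec c p ?\<xi>) w = w H)"
    using tvec_tangent[OF c p] by blast
  fix v assume v: "v \<in> tangent_space A p \<and> (\<forall>w\<in>tangent_space A p. \<omega> p v w = w H)"
  obtain \<zeta> where \<zeta>: "v = tvec c p \<zeta>" using tangent_eq_tvec[OF c p] v by blast
  have "tvec c p (\<zeta> - ?\<xi>) = (\<lambda>f. 0)"
  proof -
    have zero: "\<omega> p (tvec c p (\<zeta> - ?\<xi>)) w = 0" if w: "w \<in> tangent_space A p" for w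
      using linear_diff[OF linear_form_left[OF c p w], of \<zeta> ?\<xi>] v eq[OF w] w by (simp add: \<zeta>)
    show ?thesis by (rule form_nondegenerateD[OF tvec_tangent[OF c p] zero])
  qed
  then have "\<zeta> - ?\<xi> = 0"
    by (intro tvec_inject[OF c p]) (simp only: tvec_zero[OF c p])
  then show "v = tvec c p ?\<xi>" using \<zeta> by simp
qed

lemma hamiltonian_vector_field_apply:
  assumes c: "c \<in> A" and p: "p \<in> fst c" and H: "H \<in> smooth_functions A" and f: "f \<in> smooth_functions A"
  shows "hamiltonian_vector_field A \<omega> H p f = chart_ham c (in_chart c H) (in_chart c f) (snd c p)"
  using f grad_inner[OF in_chart_differentiable[OF f c p]]
  by (simp add: hamiltonian_vector_field_chart[OF c p H] tvec_def chart_ham_eq[OF c] inner_commute[of "ham_vec c _ _"])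

lemma equilibrium_iff:
  assumes c: "c \<in> A" and p: "p \<in> fst c" and H: "H \<in> smooth_functions A"
  shows "p \<in> equilibria A (hamiltonian_vector_field A \<omega> H) \<longleftrightarrow> grad (in_chart c H) (snd c p) = 0"
proof
  let ?X = "hamiltonian_vector_field A \<omega> H" and ?y = "snd c p"
  let ?\<xi> = "ham_vec c (grad (in_chart c H) ?y) ?y"
  assume "p \<in> equilibria A ?X"
  then have "((\<lambda>t. f p) has_real_derivative ?X p f) (at 0)" if "f \<in> smooth_functions A" for f
    using that by (simp add: equilibria_def integral_curve_def o_def)
  from DERIV_unique[OF this DERIV_const] have "?X p f = 0" if "f \<in> smooth_functions A" for f
    using that by blast
  then have "tvec c p ?\<xi> = (\<lambda>f. 0)"
    unfolding hamiltonian_vector_field_chart[OF c p H] by (auto simp: tvec_def fun_eq_iff)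
  then have "?\<xi> = 0" using tvec_inject[OF c p, of ?\<xi> 0] tvec_zero[OF c p] by simp
  then show "grad (in_chart c H) ?y = 0"
    by (rule ham_vec_eq_zeroD[OF c chart_in[OF c p]])
next
  let ?X = "hamiltonian_vector_field A \<omega> H"
  assume "grad (in_chart c H) (snd c p) = 0"
  then have "?X p f = 0" if "f \<in> smooth_functions A" for f
    using hamiltonian_vector_field_apply[OF c p H that] by (simp add: chart_ham_eq[OF c] ham_vec_def)
  then show "p \<in> equilibria A ?X"
    by (simp add: equilibria_def integral_curve_def o_def)
qed

text \<open>The definition of an integral curve tests global functions only. Here \<open>g\<close>
  lives on the chart: it is cut off near the point on the curve, which changes neither side in a
  neighbourhood of \<open>t\<close>.\<close>

lemma integral_curve_derivative:
  assumes c: "c \<in> A" and H: "H \<in> smooth_functions A"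
    and \<gamma>: "integral_curve A (hamiltonian_vector_field A \<omega> H) J \<gamma>" and t: "t \<in> J" "\<gamma> t \<in> fst c"
    and g: "smooth_map_on (cod c) g"
  shows "((\<lambda>s. g (snd c (\<gamma> s))) has_real_derivative chart_ham c (in_chart c H) g (snd c (\<gamma> t))) (at t)"
proof -
  let ?y = "snd c (\<gamma> t)"
  have y: "?y \<in> cod c" using chart_in[OF c t(2)] .
  then have y': "{?y} \<subseteq> cod c" by simp
  obtain \<beta> C N where \<beta>: "smooth_map_on UNIV \<beta>" "compact C" "C \<subseteq> cod c" "\<And>y. y \<notin> C \<Longrightarrow> \<beta> y = 0"
    and N: "open N" "{?y} \<subseteq> N" "\<And>y. y \<in> N \<Longrightarrow> \<beta> y = (1::real)"
    by (rule bump_function[OF compact_sing open_cod[OF c] y']) (rule that; assumption)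
  define f where "f = lift c (\<lambda>y. \<beta> y * g y)"
  have f: "f \<in> smooth_functions A" unfolding f_def by (rule lift_cutoff[OF c \<beta> g])
  have J: "open J" "continuous_on J \<gamma>"
    and d: "((f \<circ> \<gamma>) has_real_derivative hamiltonian_vector_field A \<omega> H (\<gamma> t) f) (at t)"
    using \<gamma> t(1) f by (auto simp: integral_curve_def)
  have sub: "N \<inter> cod c \<subseteq> cod c" by simp
  have "hamiltonian_vector_field A \<omega> H (\<gamma> t) f = chart_ham c (in_chart c H) (in_chart c f) ?y"
    by (rule hamiltonian_vector_field_apply[OF c t(2) H f])
  also have "\<dots> = chart_ham c (in_chart c H) g ?y"
    using N y open_cod[OF c] in_chart_lift[OF c]
    by (intro local_poisson.ham_cong[OF local_poisson_chart[OF c], of "N \<inter> cod c"]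
        smooth_map_on_subset[OF smooth_functions_in_chart[OF _ c] sub] H f) (auto simp: f_def)
  finally have d: "((f \<circ> \<gamma>) has_real_derivative chart_ham c (in_chart c H) g ?y) (at t)"
    using d by simp
  have op: "open {q \<in> fst c. snd c q \<in> N}" using open_chart_preimage[OF c N(1)] .
  have "open (J \<inter> \<gamma> -` {q \<in> fst c. snd c q \<in> N})"
    by (rule continuous_open_preimage[OF J(2,1) op])
  then show ?thesis
    by (rule has_field_derivative_transform_within_open[OF d]) (use t N in \<open>auto simp: f_def lift_def\<close>)
qed

text \<open>A function constant along an arc has vanishing derivative along the field there; this
  derivative is again constant, namely 0, along the same arc, and the argument repeats.\<close>

lemma integral_curve_constant:
  assumes c: "c \<in> A" and H: "H \<in> smooth_functions A"
    and \<gamma>: "integral_curve A (hamiltonian_vector_field A \<omega> H) J \<gamma>" and T: "open T" "T \<subseteq> J"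
    and g: "smooth_map_on (cod c) g"
    and const: "\<And>t. t \<in> T \<Longrightarrow> \<gamma> t \<in> fst c" "\<And>t. t \<in> T \<Longrightarrow> g (snd c (\<gamma> t)) = r" and t: "t \<in> T"
  shows "(chart_ham c (in_chart c H) ^^ Suc k) g (snd c (\<gamma> t)) = 0"
  using t
proof (induction k arbitrary: t)
  have zero: "chart_ham c (in_chart c H) f (snd c (\<gamma> t)) = 0"
    if "smooth_map_on (cod c) f" "\<And>t. t \<in> T \<Longrightarrow> f (snd c (\<gamma> t)) = r" "t \<in> T" for f r t
  proof -
    have "((\<lambda>s. f (snd c (\<gamma> s))) has_real_derivative 0) (at t)"
      by (rule has_field_derivative_transform_within_open[OF DERIV_const T(1) that(3), of r])
        (simp add: that(2))
    moreover have "t \<in> J" using T that by blast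
    ultimately show ?thesis
      using DERIV_unique[OF integral_curve_derivative[OF c H \<gamma> _ const(1)[OF that(3)] that(1)]] by blast
  qed
  case 0
  show ?case using zero[OF g const(2) 0] by simp
  case (Suc k)
  have "smooth_map_on (cod c) ((chart_ham c (in_chart c H) ^^ Suc k) g)"
    by (rule local_poisson.ham_funpow_smooth[OF local_poisson_chart[OF c] smooth_functions_in_chart[OF H c] g])
  from zero[OF this Suc.IH Suc.prems] show ?case by simp
qed

end


section \<open>Isolated equilibria and solutions on which F is constant\<close>

text \<open>An injective linear map expands norms by at least some \<open>B > 0\<close>, while near
  \<open>x\<close> the map \<open>G\<close> differs from its linearization by at most half of
  that.\<close>

lemma isolated_zero:
  fixes G :: "'a::euclidean_space \<Rightarrow> 'b::euclidean_space"
  assumes G: "(G has_derivative L) (at x)" and inj: "\<And>v. L v = 0 \<Longrightarrow> v = 0" and zero: "G x = 0"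
  obtains e where "0 < e" "\<And>y. y \<in> ball x e \<Longrightarrow> G y = 0 \<Longrightarrow> y = x"
proof -
  have L: "linear L" using G has_derivative_linear by blast
  then have "inj L" using inj linear_injective_0 by blast
  from linear_inj_bounded_below_pos[OF L this]
  obtain B where B: "0 < B" "\<And>v. B * norm v \<le> norm (L v)" by blast
  obtain d where d: "0 < d" "\<And>y. norm (y - x) < d \<Longrightarrow> norm (G y - G x - L (y - x)) \<le> B / 2 * norm (y - x)"
    using G B(1) unfolding has_derivative_at_alt by (meson half_gt_zero)
  show ?thesis
  proof (rule that[OF d(1)])
    fix y assume y: "y \<in> ball x d" and "G y = 0"
    then have "norm (L (y - x)) \<le> B / 2 * norm (y - x)"
      using d(2)[of y] zero by (simp add: dist_norm norm_minus_commute)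
    then have "B * norm (y - x) \<le> B / 2 * norm (y - x)"
      using B(2)[of "y - x"] by linarith
    then show "y = x" using B(1) by (simp add: mult_le_cancel_right)
  qed
qed

context smooth_atlas
begin

lemma countable_subcover:
  assumes "B \<subseteq> A"
  obtains B0 where "B0 \<subseteq> B" "countable B0" "(\<Union>c\<in>B0. fst c) = (\<Union>c\<in>B. fst c)"
proof -
  obtain \<F> where \<F>: "\<F> \<subseteq> fst ` B" "countable \<F>" "\<Union>\<F> = \<Union>(fst ` B)"
    by (rule Lindelof_openin[of "fst ` B" UNIV]) (use assms open_dom in auto)
  then obtain B0 where "countable B0" "B0 \<subseteq> B" "\<F> = fst ` B0"
    using countable_subset_image[of \<F> fst B] by blast
  then show ?thesis using that \<F> by blast
qed

text \<open>A subspace of codimension 1 lies in some hyperplane with normal \<open>n\<close>. The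
  linear function with gradient \<open>n\<close> then vanishes on the submanifold in this chart and
  has no critical points.\<close>

lemma submanifold_hyperplane_chart:
  assumes "submanifold_codim A 1 S" "p \<in> S"
  obtains c n where "c \<in> A" "p \<in> fst c" "n \<noteq> 0" "\<And>q. q \<in> fst c \<Longrightarrow> q \<in> S \<Longrightarrow> snd c q \<bullet> n = 0"
proof -
  from bspec[OF assms(1)[unfolded submanifold_codim_def] assms(2)]
  obtain x where x: "x \<in> A" "case x of (U, \<phi>) \<Rightarrow> p \<in> U \<and>
    (\<exists>L. subspace L \<and> dim L + 1 = DIM('e) \<and> \<phi> ` (U \<inter> S) = \<phi> ` U \<inter> L)" ..
  obtain U \<phi> where "x = (U, \<phi>)" by (cases x)
  with x obtain L where c: "(U, \<phi>) \<in> A" "p \<in> U"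
    and L: "dim L + 1 = DIM('e)" "\<phi> ` (U \<inter> S) = \<phi> ` U \<inter> L"
    by auto
  obtain n where n: "n \<noteq> 0" "span L \<subseteq> {x. n \<bullet> x = 0}"
    using lowdim_subset_hyperplane[of L] L(1) by auto
  show ?thesis
  proof (rule that[of "(U, \<phi>)" n])
    fix q assume "q \<in> fst (U, \<phi>)" "q \<in> S"
    then have "\<phi> q \<in> span L" using L(2) span_base[of "\<phi> q" L] by auto
    then show "snd (U, \<phi>) q \<bullet> n = 0" using n(2) by (auto simp: inner_commute)
  qed (use c n in auto)
qed

end

context nondegenerate_form
begin

lemma open_nonequilibria:
  assumes c: "c \<in> A" and H: "H \<in> smooth_functions A"
  shows "open {q \<in> fst c. grad (in_chart c H) (snd c q) \<noteq> 0}"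
proof -
  have "continuous_on (cod c) (grad (in_chart c H))"
    unfolding grad_def
    by (intro continuous_on_sum continuous_on_scaleR continuous_on_const
        smooth_map_on_continuous[OF smooth_map_on_deriv[OF smooth_functions_in_chart[OF H c]]])
  from continuous_open_preimage[OF this open_cod[OF c], of "- {0}"]
  have "open {y \<in> cod c. grad (in_chart c H) y \<noteq> 0}"
    by (simp add: vimage_def Int_def open_Compl)
  from open_chart_preimage[OF c this] show ?thesis
    using chart_in[OF c] by (simp add: conj_commute cong: conj_cong)
qed

text \<open>In a chart the equilibria are the zeros of the gradient, whose derivative is the
  Hessian. The order of the indices in \<open>degenerate_critical\<close> is that of this
  derivative, so the nondegeneracy assumption is precisely its injectivity.\<close>

lemma equilibria_isolated:
  assumes c: "c \<in> A" and p: "p \<in> fst c" and H: "H \<in> smooth_functions A"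
    and eq: "p \<in> equilibria A (hamiltonian_vector_field A \<omega> H)"
    and nd: "\<And>v. v \<noteq> 0 \<Longrightarrow> \<not> degenerate_critical (in_chart c H) (snd c p) v"
  shows "p isolated_in equilibria A (hamiltonian_vector_field A \<omega> H)"
proof -
  let ?h = "in_chart c H" and ?x = "snd c p" and ?E = "equilibria A (hamiltonian_vector_field A \<omega> H)"
  have zero: "grad ?h ?x = 0" using eq equilibrium_iff[OF c p H] by simp
  let ?d = "\<lambda>j y. frechet_derivative ?h (at y) j"
  let ?L = "\<lambda>v. \<Sum>j\<in>Basis. frechet_derivative (?d j) (at ?x) v *\<^sub>R j"
  note sm = smooth_map_on_deriv[OF smooth_functions_in_chart[OF H c]]
  have L: "(grad ?h has_derivative ?L) (at ?x)"
    unfolding grad_def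
    by (intro has_derivative_sum has_derivative_scaleR_left smooth_map_on_has_derivative[OF sm chart_in[OF c p]])
  have inj: "v = 0" if "?L v = 0" for v
  proof (rule ccontr)
    assume v: "v \<noteq> 0"
    have "(\<Sum>i\<in>Basis. (v \<bullet> i) * iterated_deriv [i, j] ?h ?x) = 0" if j: "j \<in> Basis" for j
    proof -
      have "?L v \<bullet> j = frechet_derivative (?d j) (at ?x) v" using j by simp
      then have "frechet_derivative (?d j) (at ?x) v = 0" using \<open>?L v = 0\<close> by simp
      then show ?thesis
        using frechet_derivative_basis[OF smooth_map_on_differentiable[OF sm chart_in[OF c p]], of j v] by simp
    qed
    moreover have "iterated_deriv [j] ?h ?x = 0" if "j \<in> Basis" for j
      using zero grad_inner_Basis[OF that, of ?h ?x] by simp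
    ultimately show False using nd[OF v] unfolding degenerate_critical_def by blast
  qed
  obtain e where e: "0 < e" "\<And>y. y \<in> ball ?x e \<Longrightarrow> grad ?h y = 0 \<Longrightarrow> y = ?x"
    using isolated_zero[OF L inj zero] by blast
  let ?T = "{q \<in> fst c. snd c q \<in> ball ?x e}"
  have "q = p" if "q \<in> ?T" "q \<in> ?E" for q
  proof -
    have "snd c q = ?x" using that e(2) equilibrium_iff[OF c _ H] by blast
    then show ?thesis using that pt_chart[OF c] p by (metis (no_types, lifting) mem_Collect_eq)
  qed
  then have "?T \<inter> ?E = {p}" using eq p e(1) by auto
  then show ?thesis
    unfolding isolated_in_def using open_chart_preimage[OF c open_ball] eq by blast
qed

text \<open>The chart coordinates of the curve have derivative 0 wherever it passes through
  equilibria, so the curve is locally constant on the connected set \<open>J\<close>.\<close>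

lemma constant_at_equilibria:
  assumes H: "H \<in> smooth_functions A" and \<gamma>: "integral_curve A (hamiltonian_vector_field A \<omega> H) J \<gamma>"
    and eq: "\<And>t. t \<in> J \<Longrightarrow> \<gamma> t \<in> equilibria A (hamiltonian_vector_field A \<omega> H)"
  shows "\<exists>p\<in>equilibria A (hamiltonian_vector_field A \<omega> H). \<forall>t\<in>J. \<gamma> t = p"
proof -
  have J: "open J" "connected J" "J \<noteq> {}" "continuous_on J \<gamma>"
    using \<gamma> by (auto simp: integral_curve_def is_interval_connected)
  have "\<gamma> constant_on J"
  proof (rule locally_constant_imp_constant[OF J(2)])
    fix t assume t: "t \<in> J"
    obtain c where c: "c \<in> A" "\<gamma> t \<in> fst c" using chart_at by blast
    have "open (J \<inter> \<gamma> -` fst c)" by (rule continuous_open_preimage[OF J(4,1) open_dom[OF c(1)]])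
    then obtain e where e: "0 < e" "ball t e \<subseteq> J \<inter> \<gamma> -` fst c"
      using t c(2) open_contains_ball by (metis IntI vimageI)
    have "snd c (\<gamma> s) \<bullet> b = snd c (\<gamma> t) \<bullet> b" if s: "s \<in> ball t e" for s and b :: 'b
    proof -
      have "((\<lambda>s. snd c (\<gamma> s) \<bullet> b) has_real_derivative 0) (at r within ball t e)" if "r \<in> ball t e" for r
      proof -
        have r: "r \<in> J" "\<gamma> r \<in> fst c" using that e by auto
        have "grad (in_chart c H) (snd c (\<gamma> r)) = 0"
          using eq[OF r(1)] equilibrium_iff[OF c(1) r(2) H] by simp
        then have "((\<lambda>s. snd c (\<gamma> s) \<bullet> b) has_real_derivative 0) (at r)"
          using integral_curve_derivative[OF c(1) H \<gamma> r smooth_map_on_inner_left, of b]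
          by (simp add: chart_ham_eq[OF c(1)] ham_vec_def)
        then show ?thesis by (rule has_field_derivative_at_within)
      qed
      from has_field_derivative_zero_constant[OF convex_ball this]
      obtain k where "\<forall>r\<in>ball t e. snd c (\<gamma> r) \<bullet> b = k" ..
      then show ?thesis using s e(1) by simp
    qed
    then have *: "snd c (\<gamma> s) = snd c (\<gamma> t)" if "s \<in> ball t e" for s
      using that by (intro euclidean_eqI[of "snd c (\<gamma> s)"])
    have **: "pt c (snd c (\<gamma> s)) = \<gamma> s" if "s \<in> ball t e" for s
      by (rule pt_chart[OF c(1)]) (use that e(2) in blast)
    have "\<forall>s\<in>ball t e. \<gamma> s = \<gamma> t"
    proof
      fix s assume s: "s \<in> ball t e"
      show "\<gamma> s = \<gamma> t"
        using **[OF s] pt_chart[OF c] unfolding *[OF s] by (rule trans[OF sym])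
    qed
    moreover have "openin (top_of_set J) (ball t e)"
      using e(2) J(1) by (simp add: openin_open_eq)
    moreover have "t \<in> ball t e" using e(1) by simp
    ultimately show "\<exists>T. openin (top_of_set J) T \<and> t \<in> T \<and> (\<forall>x\<in>T. \<gamma> x = \<gamma> t)"
      by blast
  qed
  then obtain p where p: "\<forall>t\<in>J. \<gamma> t = p" unfolding constant_on_def ..
  obtain t where "t \<in> J" using J(3) by blast
  then show ?thesis using eq[of t] p by (intro bexI[of _ p]) simp_all
qed

text \<open>Near a time with a nonequilibrium value the solution stays among nonequilibria. There
  \<open>genF\<close> forces every value to be a critical point of \<open>F\<close>; the arc then
  satisfies the local equation of the hypersurface, and \<open>genS\<close> gives the
  contradiction.\<close>

lemma solution_in_equilibria:
  assumes H: "H \<in> smooth_functions A" and F: "F \<in> smooth_functions A" and A0: "A0 \<subseteq> A" "(\<Union>c\<in>A0. fst c) = UNIV"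
    and B0: "B0 \<subseteq> A" "critical_points A F \<subseteq> (\<Union>c\<in>B0. fst c)"
    and n: "\<And>c. c \<in> B0 \<Longrightarrow> n c \<noteq> 0" "\<And>c q. c \<in> B0 \<Longrightarrow> q \<in> fst c \<Longrightarrow> q \<in> critical_points A F \<Longrightarrow> snd c q \<bullet> n c = 0"
    and genF: "\<And>c y. c \<in> A0 \<Longrightarrow> y \<in> cod c \<Longrightarrow> grad (in_chart c F) y \<noteq> 0 \<Longrightarrow> grad (in_chart c H) y \<noteq> 0 \<Longrightarrow>
      \<exists>k\<ge>1. (chart_ham c (in_chart c H) ^^ k) (in_chart c F) y \<noteq> 0"
    and genS: "\<And>c y. c \<in> B0 \<Longrightarrow> y \<in> cod c \<Longrightarrow> grad (in_chart c H) y \<noteq> 0 \<Longrightarrow>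
      \<exists>k\<ge>1. (chart_ham c (in_chart c H) ^^ k) (\<lambda>y. y \<bullet> n c) y \<noteq> 0"
    and \<gamma>: "integral_curve A (hamiltonian_vector_field A \<omega> H) J \<gamma>" and const: "F constant_on (\<gamma> ` J)"
    and t: "t \<in> J"
  shows "\<gamma> t \<in> equilibria A (hamiltonian_vector_field A \<omega> H)"
proof (rule ccontr)
  assume non: "\<gamma> t \<notin> equilibria A (hamiltonian_vector_field A \<omega> H)"
  have J: "open J" "continuous_on J \<gamma>" using \<gamma> by (auto simp: integral_curve_def)
  obtain c where c0: "c \<in> A0" and ct: "\<gamma> t \<in> fst c" using A0(2) by blast
  have c: "c \<in> A" using c0 A0(1) by blast
  let ?h = "in_chart c H" and ?F = "in_chart c F"
  \<comment> \<open>Open times at which the curve lies in one chart and has not reached an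
    equilibrium.\<close>
  define T where "T = J \<inter> \<gamma> -` {q \<in> fst c. grad ?h (snd c q) \<noteq> 0}"
  have T: "open T" "T \<subseteq> J" "t \<in> T"
    using continuous_open_preimage[OF J(2,1) open_nonequilibria[OF c H]] t ct non equilibrium_iff[OF c ct H]
    by (auto simp: T_def)
  obtain r where r: "\<And>s. s \<in> J \<Longrightarrow> F (\<gamma> s) = r" using const unfolding constant_on_def by blast
  have crit: "\<gamma> s \<in> critical_points A F" if s: "s \<in> T" for s
  proof (rule ccontr)
    have sc: "\<gamma> s \<in> fst c" "grad ?h (snd c (\<gamma> s)) \<noteq> 0" using s by (auto simp: T_def)
    assume "\<gamma> s \<notin> critical_points A F"
    then have "grad ?F (snd c (\<gamma> s)) \<noteq> 0" using critical_pointI[OF c sc(1) F] by blast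
    then obtain k where k: "k \<ge> 1" "(chart_ham c ?h ^^ k) ?F (snd c (\<gamma> s)) \<noteq> 0"
      using genF[OF c0 chart_in[OF c sc(1)]] sc(2) by blast
    \<comment> \<open>\<open>Suc (k - 1)\<close> is \<open>k\<close> because \<open>k\<close> is at
      least 1; the iterate of order 0 is \<open>F\<close> itself and need not vanish.\<close>
    have "(chart_ham c ?h ^^ Suc (k - 1)) ?F (snd c (\<gamma> s)) = 0"
      by (rule integral_curve_constant[OF c H \<gamma> T(1,2) smooth_functions_in_chart[OF F c] _ _ s, of r])
        (use pt_chart[OF c] r T(2) in \<open>auto simp: T_def in_chart_eq\<close>)
    then show False using k by simp
  qed
  then obtain d where d0: "d \<in> B0" and dt: "\<gamma> t \<in> fst d" using B0(2) T(3) by blast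
  have d: "d \<in> A" using d0 B0(1) by blast
  have T': "open (T \<inter> \<gamma> -` fst d)"
    using continuous_open_preimage[OF continuous_on_subset[OF J(2) T(2)] T(1) open_dom[OF d]] .
  have "grad (in_chart d H) (snd d (\<gamma> t)) \<noteq> 0" using non equilibrium_iff[OF d dt H] by blast
  then obtain k where k: "k \<ge> 1" "(chart_ham d (in_chart d H) ^^ k) (\<lambda>y. y \<bullet> n d) (snd d (\<gamma> t)) \<noteq> 0"
    using genS[OF d0 chart_in[OF d dt]] by blast
  have "(chart_ham d (in_chart d H) ^^ Suc (k - 1)) (\<lambda>y. y \<bullet> n d) (snd d (\<gamma> t)) = 0"
    by (rule integral_curve_constant[OF d H \<gamma> T' _ smooth_map_on_inner_left, where r = 0])
      (use T dt crit n(2)[OF d0] in auto)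
  then show False using k by simp
qed

end

theorem theorem4p5:
  fixes A :: "('p::{t2_space,second_countable_topology}, 'e::euclidean_space) chart set"
    and \<omega> :: "'p two_form"
    and F :: "'p \<Rightarrow> real"
    and S :: "'p set"
  assumes "symplectic_manifold A \<omega>"
    and "F \<in> smooth_functions A"
    and "submanifold_codim A 1 S"
    and "critical_points A F \<subseteq> S"
  shows "\<exists>C. residual_in (strong_topology A) C \<and>
    (\<forall>H\<in>C.
       (\<forall>J \<gamma>. integral_curve A (hamiltonian_vector_field A \<omega> H) J \<gamma> \<and> F constant_on (\<gamma> ` J) \<longrightarrow>
          (\<exists>p\<in>equilibria A (hamiltonian_vector_field A \<omega> H). \<forall>t\<in>J. \<gamma> t = p)) \<and>
       (\<forall>p\<in>equilibria A (hamiltonian_vector_field A \<omega> H).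
          p isolated_in equilibria A (hamiltonian_vector_field A \<omega> H)))"
proof -
  interpret nondegenerate_form A \<omega>
    using assms(1) by unfold_locales (auto simp: symplectic_manifold_def)
  obtain A0 where A0: "A0 \<subseteq> A" "countable A0" "(\<Union>c\<in>A0. fst c) = (\<Union>c\<in>A. fst c)"
    by (rule countable_subcover[OF order_refl])
  then have cover: "(\<Union>c\<in>A0. fst c) = UNIV" using manifold by (simp add: smooth_manifold_def)
  \<comment> \<open>The charts in which \<open>S\<close> satisfies a nontrivial linear equation.
    They cover \<open>S\<close>, hence the critical points of \<open>F\<close>, and second
    countability leaves countably many of them.\<close>
  define B where "B = {c \<in> A. \<exists>n. n \<noteq> 0 \<and> (\<forall>q\<in>fst c \<inter> S. snd c q \<bullet> n = 0)}"
  obtain B0 where B0: "B0 \<subseteq> B" "countable B0" "(\<Union>c\<in>B0. fst c) = (\<Union>c\<in>B. fst c)"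
    by (rule countable_subcover[of B]) (auto simp: B_def)
  have B0A: "B0 \<subseteq> A" using B0(1) by (auto simp: B_def)
  have "S \<subseteq> (\<Union>c\<in>B. fst c)"
  proof
    fix p assume "p \<in> S"
    then obtain c n where "c \<in> A" "p \<in> fst c" "n \<noteq> 0" "\<And>q. q \<in> fst c \<Longrightarrow> q \<in> S \<Longrightarrow> snd c q \<bullet> n = 0"
      by (rule submanifold_hyperplane_chart[OF assms(3)]) (rule that; assumption)
    then show "p \<in> (\<Union>c\<in>B. fst c)" unfolding B_def by blast
  qed
  then have crit_cover: "critical_points A F \<subseteq> (\<Union>c\<in>B0. fst c)" using assms(4) B0(3) by simp
  have "\<forall>c\<in>B0. \<exists>n. n \<noteq> 0 \<and> (\<forall>q\<in>fst c \<inter> S. snd c q \<bullet> n = 0)" using B0(1) by (auto simp: B_def)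
  from bchoice[OF this] obtain n where n: "\<forall>c\<in>B0. n c \<noteq> 0 \<and> (\<forall>q\<in>fst c \<inter> S. snd c q \<bullet> n c = 0)" ..
  \<comment> \<open>Used with two choices of \<open>f\<close>: the representative of
    \<open>F\<close> in the charts of \<open>A0\<close>, and the linear equation of \<open>S\<close>
    in the charts of \<open>B0\<close>.\<close>
  let ?gen = "\<lambda>c f H. \<forall>y\<in>cod c. grad f y \<noteq> 0 \<longrightarrow> grad (in_chart c H) y \<noteq> 0 \<longrightarrow>
    (\<exists>k\<ge>1. (chart_ham c (in_chart c H) ^^ k) f y \<noteq> 0)"
  let ?nd = "\<lambda>c H. \<forall>y\<in>cod c. \<forall>v. v \<noteq> 0 \<longrightarrow> \<not> degenerate_critical (in_chart c H) y v"
  let ?Q = "\<lambda>H. (\<forall>c\<in>A0. ?gen c (in_chart c F) H) \<and> (\<forall>c\<in>B0. ?gen c (\<lambda>y. y \<bullet> n c) H) \<and> (\<forall>c\<in>A0. ?nd c H)"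
  have "residual_property ?Q"
    using A0(1) B0A assms(2)
    by (intro residual_property_conj residual_property_countable_all A0(2) B0(2) residual_degenerate_jet
        residual_nondegenerate_critical local_poisson_chart smooth_functions_in_chart smooth_map_on_inner_left) auto
  then have res: "residual_in (strong_topology A) {H \<in> smooth_functions A. ?Q H}"
    by (simp only: residual_property_def)
  show ?thesis
  proof (intro exI[of _ "{H \<in> smooth_functions A. ?Q H}"] conjI res ballI allI impI)
    fix H assume H: "H \<in> {H \<in> smooth_functions A. ?Q H}"
    then have Hs: "H \<in> smooth_functions A" by simp
    let ?E = "equilibria A (hamiltonian_vector_field A \<omega> H)"
    show "\<exists>p\<in>?E. \<forall>t\<in>J. \<gamma> t = p"
      if "integral_curve A (hamiltonian_vector_field A \<omega> H) J \<gamma> \<and> F constant_on (\<gamma> ` J)" for J \<gamma>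
    proof (rule constant_at_equilibria[OF Hs])
      show "integral_curve A (hamiltonian_vector_field A \<omega> H) J \<gamma>" using that by blast
      show "\<gamma> t \<in> ?E" if "t \<in> J" for t
      proof (rule solution_in_equilibria[OF Hs assms(2) A0(1) cover B0A crit_cover, where n = n])
        show "\<exists>k\<ge>1. (chart_ham c (in_chart c H) ^^ k) (\<lambda>y. y \<bullet> n c) y \<noteq> 0"
          if "c \<in> B0" "y \<in> cod c" "grad (in_chart c H) y \<noteq> 0" for c y
        proof -
          have "grad (\<lambda>y. y \<bullet> n c) y \<noteq> 0" using n that(1) by (simp add: grad_linear)
          then show ?thesis using H that by blast
        qed
        show "\<exists>k\<ge>1. (chart_ham c (in_chart c H) ^^ k) (in_chart c F) y \<noteq> 0"
          if "c \<in> A0" "y \<in> cod c" "grad (in_chart c F) y \<noteq> 0" "grad (in_chart c H) y \<noteq> 0" for c y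
          using H that by blast
      qed (use that n assms(4) \<open>t \<in> J\<close>
          \<open>integral_curve A (hamiltonian_vector_field A \<omega> H) J \<gamma> \<and> F constant_on (\<gamma> ` J)\<close> in blast)+
    qed
    show "p isolated_in ?E" if "p \<in> ?E" for p
    proof -
      obtain c where c: "c \<in> A0" "p \<in> fst c" using cover by blast
      then have cA: "c \<in> A" using A0(1) by blast
      have "?nd c H" using H c(1) by blast
      then show ?thesis
        using chart_in[OF cA c(2)] by (intro equilibria_isolated[OF cA c(2) Hs that]) blast
    qed
  qed
qed

end
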